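(* Let $\mathcal{N}=(N,g_{\mathcal{N}})$ be a Riemann surface (a $2$-dimensional Riemannian manifold) with scalar curvature $\tau_{\mathcal{N}}$. Assume $\tau_{\mathcal{N}}(P_0)\neq 2$ for some $P_0\in N$. Let $M=(0,\infty)\times N$ and give $M$ the metric $g_{\mathcal{M}}$ whose non-zero components, relative to local coordinates $(t,x_1,x_2)$ with $t\in(0,\infty)$ and $(x_1,x_2)$ local coordinates on $N$, are $$g_{\mathcal{M}}(\partial_t,\partial_t)=1\quad\text{and}\quad g_{\mathcal{M}}(\partial_{x_i},\partial_{x_j})=t^2g_{\mathcal{N}}(\partial_{x_i},\partial_{x_j}).$$ Then: (1) $\mathcal{M}=(M,g_{\mathcal{M}})$ is a $3$-dimensional Riemannian Puffini--Videv manifold. (2) For every $t\in(0,\infty)$, at the point $P=(t,P_0)$ the $1$-model $\mathfrak{M}_1(\mathcal{M},P)$ is indecomposable and $\mathcal{M}$ is locally irreducible at $P$. (3) $\mathcal{M}$ exhibits scalar curvature blowup and is not Einstein.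
   Context: For a Riemannian manifold $\mathcal{M}=(M,g)$, $R$ is the Riemann curvature tensor, with sign convention such that the scalar curvature $\tau_{\mathcal{M}}=\sum_{ijkl}g^{jk}g^{il}R_{ijkl}$ equals $+2$ on the unit round $2$-sphere. For $P\in M$ and $k\ge0$, the $k$-model is $\mathfrak{M}_k(\mathcal{M},P)=(T_PM,\langle\cdot,\cdot\rangle=g_P,R_P,\nabla R_P,\dots,\nabla^kR_P)$, and $\mathfrak{M}(\mathcal{M},P)=\mathfrak{M}_0(\mathcal{M},P)$. A $k$-model is decomposable if there is a non-trivial orthogonal decomposition $T_PM=V_1\oplus V_2$ (both $V_i\ne\{0\}$) with respect to which each of the tensors $R_P,\nabla R_P,\dots,\nabla^kR_P$ decomposes as a direct sum of a tensor on $V_1$ and a tensor on $V_2$ (i.e. it vanishes whenever its arguments each lie in $V_1$ or $V_2$ but not all in the same $V_i$); otherwise it is indecomposable. Let $V=T_PM$ and let $\mathcal{A}$ be the curvature operator of $A=R_P$, $\langle\mathcal{A}(v_1,v_2)v_3,v_4\rangle=A(v_1,v_2,v_3,v_4)$. The Jacobi operator is $\mathcal{J}(v)w=\mathcal{A}(w,v)v$. For a subspace $\pi\subset V$ with orthonormal basis $v_1,\dots,v_k$, the higher order Jacobi operator is $\mathcal{J}(\pi)=\sum_{i=1}^k\mathcal{J}(v_i)$ (independent of the basis), and the Ricci operator is $\rho=\mathcal{J}(V)$. The $0$-model $\mathfrak{M}(\mathcal{M},P)$ is Puffini--Videv if $\mathcal{J}(\pi)\mathcal{J}(\pi^\perp)=\mathcal{J}(\pi^\perp)\mathcal{J}(\pi)$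 for every subspace $\pi$ of $V$ (equivalently, $\mathcal{J}(\pi)\rho=\rho\mathcal{J}(\pi)$ for every $\pi$). $\mathcal{M}$ is Puffini--Videv if $\mathfrak{M}(\mathcal{M},P)$ is Puffini--Videv at each $P\in M$. $\mathcal{M}$ is Einstein if its Ricci operator is a scalar multiple of the identity at each point. $\mathcal{M}$ is locally reducible at $P$ if there is a neighborhood $\mathcal{O}$ of $P$ such that $(\mathcal{O},g)=(\mathcal{O}_1\times\mathcal{O}_2,g_1\oplus g_2)$ decomposes as a Cartesian (Riemannian) product of positive-dimensional factors; it is locally irreducible at $P$ if this does not happen. $\mathcal{M}$ exhibits scalar curvature blowup if there is a geodesic $\gamma$ in $\mathcal{M}$ defined on a finite interval $(0,T)$ such that $\lim_{t\to0}|\tau_{\mathcal{M}}(\gamma(t))|=\infty$. *)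

theory Defs
  imports "HOL-Analysis.Analysis"
begin

text \<open>
  Conventions.  Smooth means of class C-infinity.  A Riemannian manifold is a topological space
  together with an atlas of charts, each of which carries the components of the metric in its own
  coordinates.  The model space \<open>'e\<close> is a Euclidean space, so that the dimension is \<open>DIM('e)\<close>.
  A chart around \<open>P\<close> identifies the tangent space at \<open>P\<close> with \<open>'e\<close> through its coordinate
  frame; two charts give models that are isomorphic through the derivative of the transition map.
  Properties of the model at \<open>P\<close> are required in all charts of the atlas around \<open>P\<close>.
\<close>

subsection \<open>Smooth maps between open subsets of Euclidean spaces\<close>

primrec differentiable_upto ::
    "nat \<Rightarrow> 'a::real_normed_vector set \<Rightarrow> ('a \<Rightarrow> 'b::real_normed_vector) \<Rightarrow> bool" where
  "differentiable_upto 0 S f \<longleftrightarrow> continuous_on S f"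
| "differentiable_upto (Suc n) S f \<longleftrightarrow>
     (\<forall>x\<in>S. f differentiable (at x)) \<and>
     (\<forall>v. differentiable_upto n S (\<lambda>x. frechet_derivative f (at x) v))"

definition smooth_on :: "'a::real_normed_vector set \<Rightarrow> ('a \<Rightarrow> 'b::real_normed_vector) \<Rightarrow> bool" where
  "smooth_on S f \<longleftrightarrow> (\<forall>n. differentiable_upto n S f)"


subsection \<open>Riemannian manifolds\<close>

text \<open>A metric in coordinates: \<open>G x u v\<close> is the inner product at the coordinate point \<open>x\<close> of the
  tangent vectors with components \<open>u\<close> and \<open>v\<close>.\<close>

type_synonym 'e metric_field = "'e \<Rightarrow> 'e \<Rightarrow> 'e \<Rightarrow> real"

definition inner_product :: "('v::real_vector \<Rightarrow> 'v \<Rightarrow> real) \<Rightarrow> bool" where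
  "inner_product g \<longleftrightarrow>
     bilinear g \<and> (\<forall>u v. g u v = g v u) \<and> (\<forall>u. u \<noteq> 0 \<longrightarrow> 0 < g u u)"

definition metric_field_on :: "'e::euclidean_space set \<Rightarrow> 'e metric_field \<Rightarrow> bool" where
  "metric_field_on S G \<longleftrightarrow>
     (\<forall>x\<in>S. inner_product (G x)) \<and> (\<forall>u v. smooth_on S (\<lambda>x. G x u v))"

record ('m, 'e) rchart =
  chart_dom :: "'m set"
  chart_map :: "'m \<Rightarrow> 'e"
  chart_metric :: "'e metric_field"

record ('m, 'e) rmanifold =
  man_top :: "'m topology"
  man_atlas :: "('m, 'e) rchart set"

definition riemannian_chart :: "'m topology \<Rightarrow> ('m, 'e::euclidean_space) rchart \<Rightarrow> bool" where
  "riemannian_chart X c \<longleftrightarrow>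
     openin X (chart_dom c) \<and> open (chart_map c ` chart_dom c) \<and>
     homeomorphic_map (subtopology X (chart_dom c)) (top_of_set (chart_map c ` chart_dom c))
       (chart_map c) \<and>
     metric_field_on (chart_map c ` chart_dom c) (chart_metric c)"

definition coord_expr ::
    "('m, 'e) rchart \<Rightarrow> ('n, 'f) rchart \<Rightarrow> ('m \<Rightarrow> 'n) \<Rightarrow> 'e \<Rightarrow> 'f" where
  "coord_expr c d F = chart_map d \<circ> F \<circ> inv_into (chart_dom c) (chart_map c)"

definition smooth_isometric_in ::
    "('m, 'e::euclidean_space) rchart \<Rightarrow> ('n, 'f::euclidean_space) rchart \<Rightarrow> ('m \<Rightarrow> 'n) \<Rightarrow> bool"
  where
  "smooth_isometric_in c d F \<longleftrightarrow>
     (let S = chart_map c ` {p \<in> chart_dom c. F p \<in> chart_dom d}; f = coord_expr c d F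
      in smooth_on S f \<and>
         (\<forall>x\<in>S. \<forall>u v. chart_metric c x u v =
            chart_metric d (f x) (frechet_derivative f (at x) u) (frechet_derivative f (at x) v)))"

text \<open>For \<open>F = id\<close> the previous definition says that the transition map from \<open>c\<close> to \<open>d\<close> is smooth
  and that the metric components transform as those of a covariant 2-tensor.\<close>

definition riemannian_manifold :: "nat \<Rightarrow> ('m, 'e::euclidean_space) rmanifold \<Rightarrow> bool" where
  "riemannian_manifold n M \<longleftrightarrow>
     DIM('e) = n \<and> Hausdorff_space (man_top M) \<and> second_countable (man_top M) \<and>
     (\<forall>c\<in>man_atlas M. riemannian_chart (man_top M) c) \<and>
     (\<Union>c\<in>man_atlas M. chart_dom c) = topspace (man_top M) \<and>
     (\<forall>c\<in>man_atlas M. \<forall>d\<in>man_atlas M. smooth_isometric_in c d id)"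

definition charts_at :: "('m, 'e) rmanifold \<Rightarrow> 'm \<Rightarrow> ('m, 'e) rchart set" where
  "charts_at M P = {c \<in> man_atlas M. P \<in> chart_dom c}"

definition open_submanifold :: "('m, 'e) rmanifold \<Rightarrow> 'm set \<Rightarrow> ('m, 'e) rmanifold" where
  "open_submanifold M U =
     \<lparr>man_top = subtopology (man_top M) U,
      man_atlas = (\<lambda>c. c\<lparr>chart_dom := chart_dom c \<inter> U\<rparr>) ` man_atlas M\<rparr>"

definition product_chart ::
    "('a, 'e) rchart \<Rightarrow> ('b, 'f) rchart \<Rightarrow> ('a \<times> 'b, 'e \<times> 'f) rchart" where
  "product_chart c d =
     \<lparr>chart_dom = chart_dom c \<times> chart_dom d,
      chart_map = map_prod (chart_map c) (chart_map d),
      chart_metric = (\<lambda>(x, y) (u1, u2) (v1, v2). chart_metric c x u1 v1 + chart_metric d y u2 v2)\<rparr>"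

definition product_manifold ::
    "('a, 'e) rmanifold \<Rightarrow> ('b, 'f) rmanifold \<Rightarrow> ('a \<times> 'b, 'e \<times> 'f) rmanifold" where
  "product_manifold M1 M2 =
     \<lparr>man_top = prod_topology (man_top M1) (man_top M2),
      man_atlas = {product_chart c d | c d. c \<in> man_atlas M1 \<and> d \<in> man_atlas M2}\<rparr>"

definition isometry ::
    "('m, 'e::euclidean_space) rmanifold \<Rightarrow> ('n, 'f::euclidean_space) rmanifold \<Rightarrow> ('m \<Rightarrow> 'n) \<Rightarrow> bool"
  where
  "isometry M M' F \<longleftrightarrow>
     homeomorphic_map (man_top M) (man_top M') F \<and>
     (\<forall>c\<in>man_atlas M. \<forall>d\<in>man_atlas M'.
        smooth_isometric_in c d F \<and>
        smooth_isometric_in d c (inv_into (topspace (man_top M)) F))"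

text \<open>
  The points and the model spaces of the two factors range over the type arguments
  \<open>('a, 'e1)\<close> and \<open>('b, 'e2)\<close>.  HOL cannot quantify over types inside a formula, so full local
  irreducibility is \<open>locally_irreducible\<close> for all type arguments, that is, for free type variables
  in a theorem.  The factors have positive dimension because \<open>DIM\<close> of a Euclidean space is
  positive.
\<close>

definition locally_irreducible ::
    "('a, 'e1::euclidean_space) rmanifold itself \<Rightarrow> ('b, 'e2::euclidean_space) rmanifold itself \<Rightarrow>
     ('m, 'e::euclidean_space) rmanifold \<Rightarrow> 'm \<Rightarrow> bool" where
  "locally_irreducible _ _ M P \<longleftrightarrow>
     \<not> (\<exists>U (M1 :: ('a, 'e1) rmanifold) (M2 :: ('b, 'e2) rmanifold) F.
          openin (man_top M) U \<and> P \<in> U \<and>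
          riemannian_manifold (DIM('e1)) M1 \<and> riemannian_manifold (DIM('e2)) M2 \<and>
          isometry (open_submanifold M U) (product_manifold M1 M2) F)"


subsection \<open>Curvature in a chart\<close>

text \<open>The vector metrically dual to the linear form \<open>\<alpha>\<close>.\<close>

definition sharp :: "('v \<Rightarrow> 'v \<Rightarrow> real) \<Rightarrow> ('v \<Rightarrow> real) \<Rightarrow> 'v" where
  "sharp g \<alpha> = (THE z. \<forall>w. g z w = \<alpha> w)"

text \<open>The Levi-Civita derivative of the constant coordinate field \<open>v\<close> in direction \<open>u\<close>, from the
  Koszul formula.\<close>

definition christoffel :: "'e::euclidean_space metric_field \<Rightarrow> 'e \<Rightarrow> 'e \<Rightarrow> 'e \<Rightarrow> 'e" where
  "christoffel G x u v = sharp (G x) (\<lambda>w.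
     (frechet_derivative (\<lambda>y. G y v w) (at x) u
      + frechet_derivative (\<lambda>y. G y u w) (at x) v
      - frechet_derivative (\<lambda>y. G y u v) (at x) w) / 2)"

text \<open>\<open>R(u,v)w = \<nabla>\<^sub>u\<nabla>\<^sub>v w - \<nabla>\<^sub>v\<nabla>\<^sub>u w\<close> for constant
  coordinate fields, whose brackets vanish.  With this sign \<open>G x (R(u,v)v) u\<close> is the sectional
  curvature for orthonormal \<open>u\<close>, \<open>v\<close>, and the scalar curvature of the unit 2-sphere is 2.\<close>

definition riemann_op :: "'e::euclidean_space metric_field \<Rightarrow> 'e \<Rightarrow> 'e \<Rightarrow> 'e \<Rightarrow> 'e \<Rightarrow> 'e" where
  "riemann_op G x u v w =
     frechet_derivative (\<lambda>y. christoffel G y v w) (at x) u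
     - frechet_derivative (\<lambda>y. christoffel G y u w) (at x) v
     + christoffel G x u (christoffel G x v w)
     - christoffel G x v (christoffel G x u w)"

text \<open>A covariant tensor of rank \<open>r\<close> is a function on lists, of which only the values on lists of
  length \<open>r\<close> matter.\<close>

definition riemann_tensor :: "'e::euclidean_space metric_field \<Rightarrow> 'e \<Rightarrow> 'e list \<Rightarrow> real" where
  "riemann_tensor G x vs = G x (riemann_op G x (vs ! 0) (vs ! 1) (vs ! 2)) (vs ! 3)"

text \<open>The last argument of a covariant derivative is the direction of differentiation.\<close>

definition cov_deriv ::
    "'e::euclidean_space metric_field \<Rightarrow> ('e \<Rightarrow> 'e list \<Rightarrow> real) \<Rightarrow> 'e \<Rightarrow> 'e list \<Rightarrow> real" where
  "cov_deriv G T x ws =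
     (let w = last ws; vs = butlast ws
      in frechet_derivative (\<lambda>y. T y vs) (at x) w
         - (\<Sum>i<length vs. T x (vs[i := christoffel G x w (vs ! i)])))"

definition inverse_metric :: "('e::euclidean_space \<Rightarrow> 'e \<Rightarrow> real) \<Rightarrow> 'e \<Rightarrow> 'e \<Rightarrow> real" where
  "inverse_metric g i j = sharp g (\<lambda>w. w \<bullet> i) \<bullet> j"

definition scalar_curvature_in :: "'e::euclidean_space metric_field \<Rightarrow> 'e \<Rightarrow> real" where
  "scalar_curvature_in G x =
     (\<Sum>i\<in>Basis. \<Sum>j\<in>Basis. \<Sum>k\<in>Basis. \<Sum>l\<in>Basis.
        inverse_metric (G x) j k * inverse_metric (G x) i l * riemann_tensor G x [i, j, k, l])"

definition scalar_curvature :: "('m, 'e::euclidean_space) rmanifold \<Rightarrow> 'm \<Rightarrow> real" where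
  "scalar_curvature M P =
     (let c = (SOME c. c \<in> charts_at M P) in scalar_curvature_in (chart_metric c) (chart_map c P))"


subsection \<open>Models\<close>

text \<open>A \<open>k\<close>-model on the vector space \<open>'v\<close>: the \<open>j\<close>-th entry of the list has rank \<open>4 + j\<close>.\<close>

record 'v curvature_model =
  model_ip :: "'v \<Rightarrow> 'v \<Rightarrow> real"
  model_tensors :: "('v list \<Rightarrow> real) list"

definition kmodel ::
    "nat \<Rightarrow> ('m, 'e::euclidean_space) rchart \<Rightarrow> 'm \<Rightarrow> 'e curvature_model" where
  "kmodel k c P =
     (let G = chart_metric c; x = chart_map c P
      in \<lparr>model_ip = G x,
          model_tensors = map (\<lambda>j. (cov_deriv G ^^ j) (riemann_tensor G) x) [0..<Suc k]\<rparr>)"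

definition splits_along :: "'v set \<Rightarrow> 'v set \<Rightarrow> nat \<Rightarrow> ('v list \<Rightarrow> real) \<Rightarrow> bool" where
  "splits_along V1 V2 r A \<longleftrightarrow>
     (\<forall>vs. length vs = r \<and> set vs \<subseteq> V1 \<union> V2 \<and> \<not> set vs \<subseteq> V1 \<and> \<not> set vs \<subseteq> V2 \<longrightarrow> A vs = 0)"

definition decomposable :: "'v::real_vector curvature_model \<Rightarrow> bool" where
  "decomposable m \<longleftrightarrow>
     (\<exists>V1 V2. subspace V1 \<and> subspace V2 \<and> V1 \<noteq> {0} \<and> V2 \<noteq> {0} \<and>
        V1 \<inter> V2 = {0} \<and> (\<forall>v. \<exists>v1\<in>V1. \<exists>v2\<in>V2. v = v1 + v2) \<and>
        (\<forall>v1\<in>V1. \<forall>v2\<in>V2. model_ip m v1 v2 = 0) \<and>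
        (\<forall>j<length (model_tensors m). splits_along V1 V2 (4 + j) (model_tensors m ! j)))"

definition indecomposable_at :: "('m, 'e::euclidean_space) rmanifold \<Rightarrow> nat \<Rightarrow> 'm \<Rightarrow> bool" where
  "indecomposable_at M k P \<longleftrightarrow> (\<forall>c\<in>charts_at M P. \<not> decomposable (kmodel k c P))"

definition curvature_operator :: "'v curvature_model \<Rightarrow> 'v \<Rightarrow> 'v \<Rightarrow> 'v \<Rightarrow> 'v" where
  "curvature_operator m v1 v2 v3 =
     sharp (model_ip m) (\<lambda>v4. (model_tensors m ! 0) [v1, v2, v3, v4])"

definition jacobi :: "'v curvature_model \<Rightarrow> 'v \<Rightarrow> 'v \<Rightarrow> 'v" where
  "jacobi m v w = curvature_operator m w v v"

definition orthonormal_basis ::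
    "('v::real_vector \<Rightarrow> 'v \<Rightarrow> real) \<Rightarrow> 'v set \<Rightarrow> 'v set \<Rightarrow> bool" where
  "orthonormal_basis g V B \<longleftrightarrow>
     finite B \<and> span B = V \<and> (\<forall>u\<in>B. \<forall>v\<in>B. g u v = (if u = v then 1 else 0))"

definition higher_jacobi :: "'v::real_vector curvature_model \<Rightarrow> 'v set \<Rightarrow> 'v \<Rightarrow> 'v" where
  "higher_jacobi m V w =
     (\<Sum>v\<in>(SOME B. orthonormal_basis (model_ip m) V B). jacobi m v w)"

definition ricci_operator :: "'v::real_vector curvature_model \<Rightarrow> 'v \<Rightarrow> 'v" where
  "ricci_operator m = higher_jacobi m UNIV"

definition perp :: "('v \<Rightarrow> 'v \<Rightarrow> real) \<Rightarrow> 'v set \<Rightarrow> 'v set" where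
  "perp g V = {w. \<forall>v\<in>V. g v w = 0}"

definition puffini_videv_model :: "'v::real_vector curvature_model \<Rightarrow> bool" where
  "puffini_videv_model m \<longleftrightarrow>
     (\<forall>V. subspace V \<longrightarrow>
        higher_jacobi m V \<circ> higher_jacobi m (perp (model_ip m) V) =
        higher_jacobi m (perp (model_ip m) V) \<circ> higher_jacobi m V)"

definition puffini_videv :: "('m, 'e::euclidean_space) rmanifold \<Rightarrow> bool" where
  "puffini_videv M \<longleftrightarrow>
     (\<forall>P\<in>topspace (man_top M). \<forall>c\<in>charts_at M P. puffini_videv_model (kmodel 0 c P))"

definition einstein :: "('m, 'e::euclidean_space) rmanifold \<Rightarrow> bool" where
  "einstein M \<longleftrightarrow>
     (\<forall>P\<in>topspace (man_top M). \<forall>c\<in>charts_at M P.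
        \<exists>r. \<forall>v. ricci_operator (kmodel 0 c P) v = r *\<^sub>R v)"


subsection \<open>Geodesics and scalar curvature blowup\<close>

definition geodesic_on ::
    "('m, 'e::euclidean_space) rmanifold \<Rightarrow> (real \<Rightarrow> 'm) \<Rightarrow> real set \<Rightarrow> bool" where
  "geodesic_on M \<gamma> I \<longleftrightarrow>
     continuous_map (top_of_set I) (man_top M) \<gamma> \<and>
     (\<forall>s\<in>I. \<forall>c\<in>charts_at M (\<gamma> s). \<exists>d.
        (\<forall>\<^sub>F r in nhds s. ((chart_map c \<circ> \<gamma>) has_vector_derivative d r) (at r)) \<and>
        (d has_vector_derivative
           - christoffel (chart_metric c) (chart_map c (\<gamma> s)) (d s) (d s)) (at s))"

definition scalar_curvature_blowup :: "('m, 'e::euclidean_space) rmanifold \<Rightarrow> bool" where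
  "scalar_curvature_blowup M \<longleftrightarrow>
     (\<exists>\<gamma> T. 0 < T \<and> geodesic_on M \<gamma> {0<..<T} \<and>
        filterlim (\<lambda>t. \<bar>scalar_curvature M (\<gamma> t)\<bar>) at_top (at_right 0))"


subsection \<open>The manifold \<open>(0,\<infinity>) \<times> N\<close> with metric \<open>dt\<^sup>2 + t\<^sup>2 g\<^sub>N\<close>\<close>

definition cone_chart :: "('n, 'e::euclidean_space) rchart \<Rightarrow> (real \<times> 'n, real \<times> 'e) rchart" where
  "cone_chart c =
     \<lparr>chart_dom = {0<..} \<times> chart_dom c,
      chart_map = (\<lambda>(t, p). (t, chart_map c p)),
      chart_metric = (\<lambda>(t, x) (a, u) (b, v). a * b + t\<^sup>2 * chart_metric c x u v)\<rparr>"

definition cone_manifold ::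
    "('n, 'e::euclidean_space) rmanifold \<Rightarrow> (real \<times> 'n, real \<times> 'e) rmanifold" where
  "cone_manifold N =
     \<lparr>man_top = prod_topology (top_of_set {0<..}) (man_top N),
      man_atlas = cone_chart ` man_atlas N\<rparr>"

end

theory Submission
  imports Defs
begin

text \<open>
  The curvature of the cone is \<open>t\<^sup>2 (\<tau>/2 - 1)\<close> times the Gram form of the components tangent to \<open>N\<close>, where
  \<open>\<tau>\<close> is the scalar curvature of \<open>N\<close>. Hence the Ricci operator is a multiple of the projection onto
  these components, and every Jacobi operator commutes with it. Where \<open>\<tau> \<noteq> 2\<close>, an orthogonal splitting
  of the curvature tensor must split off the radial direction \<open>T = \<partial>\<^sub>t\<close>, because two complementary
  subspaces with vanishing mixed Gram determinants cannot both project nontrivially to the plane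
  tangent to \<open>N\<close>. But \<open>\<nabla>\<^sub>X T = X/t\<close> for \<open>X\<close> tangent to \<open>N\<close>, so \<open>\<nabla>R\<close> does not split.

  The same identity excludes a local Riemannian product: curvature is natural under isometries, so
  near the point \<open>T\<close> would be tangent to one factor, and then so would be \<open>\<nabla>\<^sub>X T\<close>, that is, every
  tangent vector. Blowup occurs along the radial geodesics, since the scalar curvature of the
  cone is \<open>(\<tau> - 2)/t\<^sup>2\<close>.
\<close>

subsection \<open>Smooth functions\<close>

text \<open>The value 2 is the scalar curvature of the unit sphere, whose cone is flat; the
  \<open>- 1\<close> in \<open>scalar_curvature_in G x / 2 - 1\<close> is this comparison. The
  analytic obstacle is that \<open>sharp\<close>, and with it \<open>christoffel\<close>, is a
  definite description, so smoothness must be recovered: the Christoffel vector solves a linear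
  system with smooth coefficients, and solutions of such systems inherit the smoothness of the data.
  Naturality of curvature under local isometries enters twice: between charts of the surface, since
  \<open>scalar_curvature\<close> evaluates one arbitrarily chosen chart, and between a cone chart
  and a product chart. Information at a single point cannot exclude a product, because the 0-model
  does split there into the radial line and the plane tangent to \<open>N\<close>. So the splitting
  is followed over a neighbourhood, where continuity keeps the scalar curvature of \<open>N\<close>
  away from 2 and \<open>T\<close> in the same factor, and then it is differentiated.\<close>

abbreviation fderiv :: "('a::real_normed_vector \<Rightarrow> 'b::real_normed_vector) \<Rightarrow> 'a \<Rightarrow> 'a \<Rightarrow> 'b" where
  "fderiv f x \<equiv> frechet_derivative f (at x)"

lemma fderiv_eq: "(f has_derivative f') (at x) \<Longrightarrow> fderiv f x v = f' v"
  using frechet_derivative_at[of f f' x] by simp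

lemma fderiv_transform:
  assumes "open S" "x \<in> S" "\<And>y. y \<in> S \<Longrightarrow> f y = g y" "f differentiable at x"
  shows "g differentiable at x" "fderiv f x = fderiv g x"
proof -
  have "(f has_derivative fderiv f x) (at x)"
    using assms(4) by (simp add: frechet_derivative_works)
  then have "(g has_derivative fderiv f x) (at x)"
    using assms(1-3) has_derivative_transform_within_open by blast
  then show "g differentiable at x" "fderiv f x = fderiv g x"
    by (auto simp: differentiable_def intro: frechet_derivative_at)
qed

text \<open>Derivatives at a point depend on nearby values only, so on an open set equality of
  functions passes to all their derivatives.\<close>

lemma differentiable_upto_cong:
  assumes "open S" "\<And>x. x \<in> S \<Longrightarrow> f x = g x" "differentiable_upto n S f"
  shows "differentiable_upto n S g"
  using assms(2,3)
proof (induction n arbitrary: f g)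
  case 0
  then show ?case by (simp cong: continuous_on_cong)
next
  case (Suc n)
  have d: "g differentiable at x" "fderiv f x = fderiv g x" if "x \<in> S" for x
    using fderiv_transform[OF \<open>open S\<close> that, of f g] Suc.prems that by auto
  show ?case
    using Suc.prems d Suc.IH[of "\<lambda>x. fderiv f x _" "\<lambda>x. fderiv g x _"] by auto
qed

lemma differentiable_upto_Suc_imp:
  "differentiable_upto (Suc n) S f \<Longrightarrow> differentiable_upto n S f"
proof (induction n arbitrary: f)
  case 0
  then show ?case
    by (auto intro!: continuous_at_imp_continuous_on differentiable_imp_continuous_within)
next
  case (Suc n)
  then show ?case by (metis differentiable_upto.simps(2))
qed

lemma differentiable_upto_subset:
  "differentiable_upto n S f \<Longrightarrow> T \<subseteq> S \<Longrightarrow> differentiable_upto n T f"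
  by (induction n arbitrary: f) (auto intro: continuous_on_subset)

lemma differentiable_upto_const: "differentiable_upto n S (\<lambda>x. c)"
  by (induction n arbitrary: c) auto

lemma differentiable_upto_linear:
  assumes "bounded_linear L"
  shows "differentiable_upto n S L"
proof (cases n)
  case 0
  then show ?thesis using assms by (simp add: linear_continuous_on)
next
  case (Suc m)
  have "fderiv L x v = L v" for x v
    using bounded_linear_imp_has_derivative[OF assms] by (rule fderiv_eq)
  then show ?thesis
    using assms Suc
    by (auto simp: differentiable_upto_const intro: bounded_linear_imp_differentiable)
qed

lemma differentiable_upto_compose_linear:
  assumes "bounded_linear L" "open S" "differentiable_upto n S f"
  shows "differentiable_upto n S (\<lambda>x. L (f x))"
  using assms(3)
proof (induction n arbitrary: f)
  case 0
  then show ?case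
    using assms by (auto intro: bounded_linear.continuous_on)
next
  case (Suc n)
  have d: "((\<lambda>x. L (f x)) has_derivative (\<lambda>v. L (fderiv f x v))) (at x)" if "x \<in> S" for x
    using Suc.prems that bounded_linear.has_derivative[OF assms(1), of f "fderiv f x"]
    by (auto simp: frechet_derivative_works)
  have "differentiable_upto n S (\<lambda>x. fderiv (\<lambda>x. L (f x)) x v)" for v
    by (rule differentiable_upto_cong[OF assms(2) _ Suc.IH[of "\<lambda>x. fderiv f x v"]])
      (use Suc.prems fderiv_eq[OF d] in auto)
  then show ?case using d by (auto simp: differentiable_def)
qed

lemma differentiable_upto_add:
  assumes "open S" "differentiable_upto n S f" "differentiable_upto n S g"
  shows "differentiable_upto n S (\<lambda>x. f x + g x)"
  using assms(2,3)
proof (induction n arbitrary: f g)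
  case 0
  then show ?case by (auto intro: continuous_intros)
next
  case (Suc n)
  have d: "((\<lambda>x. f x + g x) has_derivative (\<lambda>v. fderiv f x v + fderiv g x v)) (at x)" if "x \<in> S" for x
    using Suc.prems that by (auto simp: frechet_derivative_works intro: has_derivative_add)
  have "differentiable_upto n S (\<lambda>x. fderiv (\<lambda>x. f x + g x) x v)" for v
    by (rule differentiable_upto_cong[OF assms(1) _ Suc.IH[of "\<lambda>x. fderiv f x v" "\<lambda>x. fderiv g x v"]])
      (use Suc.prems fderiv_eq[OF d] in auto)
  then show ?case using d by (auto simp: differentiable_def)
qed

lemma differentiable_upto_sum:
  assumes "open S" "\<And>i. i \<in> I \<Longrightarrow> differentiable_upto n S (f i)"
  shows "differentiable_upto n S (\<lambda>x. \<Sum>i\<in>I. f i x)"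
  using assms(2)
  by (induction I rule: infinite_finite_induct)
    (auto simp: differentiable_upto_const intro: differentiable_upto_add[OF assms(1)])

text \<open>Each term of the product rule keeps one factor undifferentiated; the induction
  hypothesis uses that factor at the lower order, supplied by
  \<open>differentiable_upto_Suc_imp\<close>.\<close>

lemma differentiable_upto_bilinear:
  assumes "bounded_bilinear B" "open S" "differentiable_upto n S f" "differentiable_upto n S g"
  shows "differentiable_upto n S (\<lambda>x. B (f x) (g x))"
  using assms(3,4)
proof (induction n arbitrary: f g)
  case 0
  then show ?case using assms by (auto intro: bounded_bilinear.continuous_on)
next
  case (Suc n)
  have d: "((\<lambda>x. B (f x) (g x)) has_derivative (\<lambda>v. B (f x) (fderiv g x v) + B (fderiv f x v) (g x))) (at x)"
    if "x \<in> S" for x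
    using Suc.prems that bounded_bilinear.FDERIV[OF assms(1), of f "fderiv f x" x UNIV g "fderiv g x"]
    by (auto simp: frechet_derivative_works)
  have "differentiable_upto n S (\<lambda>x. fderiv (\<lambda>x. B (f x) (g x)) x v)" for v
    by (rule differentiable_upto_cong[OF assms(2) _ differentiable_upto_add[OF assms(2)
         Suc.IH[of "f" "\<lambda>x. fderiv g x v"] Suc.IH[of "\<lambda>x. fderiv f x v" g]]])
      (use Suc.prems fderiv_eq[OF d] in \<open>auto intro: differentiable_upto_Suc_imp\<close>)
  then show ?case using d by (auto simp: differentiable_def)
qed

text \<open>Serves for functions on a product that depend on one factor only, where the inner map is
  a projection.\<close>

lemma differentiable_upto_linear_arg:
  assumes "bounded_linear L" "L ` T \<subseteq> S" "open T" "differentiable_upto n S f"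
  shows "differentiable_upto n T (\<lambda>x. f (L x))"
  using assms(4)
proof (induction n arbitrary: f)
  case 0
  then show ?case
    using assms(1,2) continuous_on_compose2[of S f T L] by (auto intro: linear_continuous_on)
next
  case (Suc n)
  have d: "((\<lambda>x. f (L x)) has_derivative (\<lambda>v. fderiv f (L x) (L v))) (at x)" if "x \<in> T" for x
    using Suc.prems that assms(1,2)
      has_derivative_compose[OF bounded_linear_imp_has_derivative[OF assms(1)], of f "fderiv f (L x)" x UNIV]
    by (auto simp: frechet_derivative_works)
  have "differentiable_upto n T (\<lambda>x. fderiv (\<lambda>x. f (L x)) x v)" for v
    by (rule differentiable_upto_cong[OF assms(3) _ Suc.IH[of "\<lambda>x. fderiv f x (L v)"]])
      (use Suc.prems fderiv_eq[OF d] in auto)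
  then show ?case using d by (auto simp: differentiable_def)
qed

lemma smooth_on_cong: "open S \<Longrightarrow> (\<And>x. x \<in> S \<Longrightarrow> f x = g x) \<Longrightarrow> smooth_on S f \<Longrightarrow> smooth_on S g"
  unfolding smooth_on_def using differentiable_upto_cong by blast

lemma smooth_on_subset: "smooth_on S f \<Longrightarrow> T \<subseteq> S \<Longrightarrow> smooth_on T f"
  unfolding smooth_on_def using differentiable_upto_subset by blast

lemma smooth_on_const: "smooth_on S (\<lambda>x. c)"
  by (simp add: smooth_on_def differentiable_upto_const)

lemma smooth_on_linear: "bounded_linear L \<Longrightarrow> smooth_on S L"
  by (simp add: smooth_on_def differentiable_upto_linear)

lemma smooth_on_compose_linear:
  "bounded_linear L \<Longrightarrow> open S \<Longrightarrow> smooth_on S f \<Longrightarrow> smooth_on S (\<lambda>x. L (f x))"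
  by (simp add: smooth_on_def differentiable_upto_compose_linear)

lemma smooth_on_add:
  "open S \<Longrightarrow> smooth_on S f \<Longrightarrow> smooth_on S g \<Longrightarrow> smooth_on S (\<lambda>x. f x + g x)"
  by (simp add: smooth_on_def differentiable_upto_add)

lemma smooth_on_bilinear:
  "bounded_bilinear B \<Longrightarrow> open S \<Longrightarrow> smooth_on S f \<Longrightarrow> smooth_on S g \<Longrightarrow>
    smooth_on S (\<lambda>x. B (f x) (g x))"
  by (simp add: smooth_on_def differentiable_upto_bilinear)

lemma smooth_on_linear_arg:
  "bounded_linear L \<Longrightarrow> L ` T \<subseteq> S \<Longrightarrow> open T \<Longrightarrow> smooth_on S f \<Longrightarrow> smooth_on T (\<lambda>x. f (L x))"
  unfolding smooth_on_def using differentiable_upto_linear_arg by blast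

lemma smooth_on_Pair:
  assumes "open S" "smooth_on S f" "smooth_on S g"
  shows "smooth_on S (\<lambda>x. (f x, g x))"
proof -
  have "smooth_on S (\<lambda>x. (f x, 0) + (0, g x))"
    using assms by (intro smooth_on_add smooth_on_compose_linear[of "\<lambda>u. (u, 0)"] smooth_on_compose_linear[of "\<lambda>u. (0, u)"])
      (auto intro: bounded_linear_Pair bounded_linear_ident bounded_linear_zero)
  then show ?thesis by simp
qed

lemma smooth_on_differentiable: "smooth_on S f \<Longrightarrow> x \<in> S \<Longrightarrow> f differentiable at x"
  unfolding smooth_on_def by (metis differentiable_upto.simps(2))

lemma smooth_on_has_derivative:
  "smooth_on S f \<Longrightarrow> x \<in> S \<Longrightarrow> (f has_derivative fderiv f x) (at x)"
  using smooth_on_differentiable frechet_derivative_works by blast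

lemma smooth_on_fderiv: "smooth_on S f \<Longrightarrow> smooth_on S (\<lambda>x. fderiv f x v)"
  unfolding smooth_on_def by (metis differentiable_upto.simps(2))

lemma smooth_on_continuous: "smooth_on S f \<Longrightarrow> continuous_on S f"
  unfolding smooth_on_def by (metis differentiable_upto.simps(1))

section \<open>Symmetry of second derivatives\<close>

text \<open>The mean value theorem is applied twice: in direction \<open>u\<close> to the increment
  \<open>p\<close> of \<open>f\<close> along \<open>v\<close>, then in direction \<open>v\<close> to
  the derivative \<open>q\<close> along \<open>u\<close>. The bound on \<open>y\<close> localises
  the intermediate point as \<open>h\<close> shrinks.\<close>

lemma second_difference_mvt:
  fixes f :: "'a::real_normed_vector \<Rightarrow> real"
  assumes f: "\<And>y. y \<in> ball x r \<Longrightarrow> f differentiable at y"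
    and f': "\<And>y. y \<in> ball x r \<Longrightarrow> (\<lambda>z. fderiv f z u) differentiable at y"
    and h: "0 < h" "h * (norm u + norm v) < r"
  shows "\<exists>y. norm (y - x) \<le> h * (norm u + norm v) \<and>
     f (x + h *\<^sub>R u + h *\<^sub>R v) - f (x + h *\<^sub>R u) - f (x + h *\<^sub>R v) + f x
       = h\<^sup>2 * fderiv (\<lambda>z. fderiv f z u) y v"
proof -
  have bound: "norm (s *\<^sub>R u + t *\<^sub>R v) \<le> h * (norm u + norm v)" if "0 \<le> s" "s \<le> h" "0 \<le> t" "t \<le> h" for s t
  proof -
    have "norm (s *\<^sub>R u + t *\<^sub>R v) \<le> s * norm u + t * norm v"
      using that norm_triangle_ineq[of "s *\<^sub>R u" "t *\<^sub>R v"] by simp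
    also have "\<dots> \<le> h * norm u + h * norm v"
      using that by (intro add_mono mult_right_mono) auto
    finally show ?thesis by (simp add: distrib_left)
  qed
  have inball: "x + s *\<^sub>R u + t *\<^sub>R v \<in> ball x r" if "0 \<le> s" "s \<le> h" "0 \<le> t" "t \<le> h" for s t
    using bound[OF that] h(2) norm_minus_cancel[of "s *\<^sub>R u + t *\<^sub>R v"]
    by (simp add: dist_norm add.assoc del: norm_minus_cancel)
  define p where "p s = f (x + s *\<^sub>R u + h *\<^sub>R v) - f (x + s *\<^sub>R u)" for s
  have dp: "(p has_derivative (\<lambda>k. k * (fderiv f (x + s *\<^sub>R u + h *\<^sub>R v) u - fderiv f (x + s *\<^sub>R u) u)))
      (at s within {0..h})" if s: "0 \<le> s" "s \<le> h" for s
  proof -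
    have 1: "((\<lambda>s. f (x + s *\<^sub>R u + c)) has_derivative (\<lambda>k. k * fderiv f (x + s *\<^sub>R u + c) u)) (at s within {0..h})"
      if "x + s *\<^sub>R u + c \<in> ball x r" for c
    proof -
      have lin: "linear (fderiv f (x + s *\<^sub>R u + c))"
        using f[OF that] by (rule linear_frechet_derivative)
      have "((\<lambda>s. x + s *\<^sub>R u + c) has_derivative (\<lambda>k. k *\<^sub>R u)) (at s within {0..h})"
        by (auto intro!: derivative_eq_intros)
      from has_derivative_compose[OF this, of f "fderiv f (x + s *\<^sub>R u + c)"]
      show ?thesis using f[OF that] linear_cmul[OF lin] by (simp add: frechet_derivative_works)
    qed
    have "((\<lambda>s. f (x + s *\<^sub>R u + h *\<^sub>R v) - f (x + s *\<^sub>R u + 0)) has_derivative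
       (\<lambda>k. k * fderiv f (x + s *\<^sub>R u + h *\<^sub>R v) u - k * fderiv f (x + s *\<^sub>R u + 0) u)) (at s within {0..h})"
      using inball[of s h] inball[of s 0] s h(1) by (intro has_derivative_diff 1) auto
    then show ?thesis unfolding p_def by (simp add: right_diff_distrib)
  qed
  obtain s where s: "s \<in> {0..h}" and
    ps: "p h - p 0 = h * (fderiv f (x + s *\<^sub>R u + h *\<^sub>R v) u - fderiv f (x + s *\<^sub>R u) u)"
    using mvt_very_simple[of 0 h p, OF _ dp] h(1) by auto
  define q where "q t = fderiv f (x + s *\<^sub>R u + t *\<^sub>R v) u" for t
  have dq: "(q has_derivative (\<lambda>k. k * fderiv (\<lambda>z. fderiv f z u) (x + s *\<^sub>R u + t *\<^sub>R v) v)) (at t within {0..h})"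
    if t: "0 \<le> t" "t \<le> h" for t
  proof -
    have i: "x + s *\<^sub>R u + t *\<^sub>R v \<in> ball x r" using inball s t by auto
    have lin: "linear (fderiv (\<lambda>z. fderiv f z u) (x + s *\<^sub>R u + t *\<^sub>R v))"
      using f'[OF i] by (rule linear_frechet_derivative)
    have "((\<lambda>t. x + s *\<^sub>R u + t *\<^sub>R v) has_derivative (\<lambda>k. k *\<^sub>R v)) (at t within {0..h})"
      by (auto intro!: derivative_eq_intros)
    from has_derivative_compose[OF this, of "\<lambda>z. fderiv f z u" "fderiv (\<lambda>z. fderiv f z u) (x + s *\<^sub>R u + t *\<^sub>R v)"]
    show ?thesis unfolding q_def using f'[OF i] linear_cmul[OF lin] by (simp add: frechet_derivative_works)
  qed
  obtain t where t: "t \<in> {0..h}" and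
    qt: "q h - q 0 = h * fderiv (\<lambda>z. fderiv f z u) (x + s *\<^sub>R u + t *\<^sub>R v) v"
    using mvt_very_simple[of 0 h q, OF _ dq] h(1) by auto
  have "f (x + h *\<^sub>R u + h *\<^sub>R v) - f (x + h *\<^sub>R u) - f (x + h *\<^sub>R v) + f x = p h - p 0"
    by (simp add: p_def)
  also have "\<dots> = h * (q h - q 0)" by (simp add: ps q_def)
  also have "\<dots> = h\<^sup>2 * fderiv (\<lambda>z. fderiv f z u) (x + s *\<^sub>R u + t *\<^sub>R v) v"
    by (simp add: qt power2_eq_square)
  finally show ?thesis
    using bound[of s t] s t by (intro exI[of _ "x + s *\<^sub>R u + t *\<^sub>R v"]) (auto simp: add.assoc)
qed

text \<open>The second difference is symmetric in \<open>u\<close> and \<open>v\<close>, so the two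
  mixed derivatives agree at a pair of points arbitrarily close to \<open>x\<close>; their
  continuity moves the equality to \<open>x\<close>.\<close>

lemma symmetric_second_derivative_real:
  fixes f :: "'a::real_normed_vector \<Rightarrow> real"
  assumes "open S" "x \<in> S" "differentiable_upto 2 S f"
  shows "fderiv (\<lambda>z. fderiv f z u) x v = fderiv (\<lambda>z. fderiv f z v) x u"
proof -
  obtain r where r: "0 < r" "ball x r \<subseteq> S"
    using assms by (meson open_contains_ball)
  define a where "a y = fderiv (\<lambda>z. fderiv f z u) y v" for y
  define b where "b y = fderiv (\<lambda>z. fderiv f z v) y u" for y
  have d: "f differentiable at y" "(\<lambda>z. fderiv f z w) differentiable at y" if "y \<in> S" for y w
    using assms(3) that by (auto simp: numeral_2_eq_2)
  have cont: "continuous (at x) a" "continuous (at x) b"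
    using assms unfolding a_def b_def by (auto simp: numeral_2_eq_2 continuous_on_eq_continuous_at)
  have "\<bar>a x - b x\<bar> < e" if e: "e > 0" for e
  proof -
    obtain da where da: "da > 0" "\<And>y. dist y x < da \<Longrightarrow> dist (a y) (a x) < e/2"
      using cont(1)[unfolded continuous_at_eps_delta, rule_format, OF half_gt_zero[OF e]] by blast
    obtain db where db: "db > 0" "\<And>y. dist y x < db \<Longrightarrow> dist (b y) (b x) < e/2"
      using cont(2)[unfolded continuous_at_eps_delta, rule_format, OF half_gt_zero[OF e]] by blast
    define m where "m = min r (min da db)"
    \<comment> \<open>The summand 1 keeps \<open>c\<close> positive when \<open>u\<close> and
      \<open>v\<close> vanish; the factor 2 in \<open>h\<close> makes the next bound strict.\<close>
    define c where "c = norm u + norm v + 1"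
    define h where "h = m / (2 * c)"
    have m: "m > 0" "m \<le> r" "m \<le> da" "m \<le> db" using r da db by (auto simp: m_def)
    have n: "c > 0" unfolding c_def
      by (meson add_nonneg_nonneg add_nonneg_pos norm_ge_zero zero_less_one)
    have h: "h > 0" unfolding h_def using m(1) n by simp
    have "h * (norm u + norm v) \<le> h * c" using h by (simp add: c_def)
    also have "\<dots> = m / 2" unfolding h_def using n by simp
    also have "\<dots> < m" using m by simp
    finally have hm: "h * (norm u + norm v) < m" .
    have hm': "h * (norm v + norm u) < m" using hm by (simp add: add.commute)
    have d1: "f differentiable at y" and d2: "(\<lambda>z. fderiv f z w) differentiable at y" if "y \<in> ball x r" for y w
      using d r(2) that by auto
    obtain y where y: "norm (y - x) \<le> h * (norm u + norm v)"
      "f (x + h *\<^sub>R u + h *\<^sub>R v) - f (x + h *\<^sub>R u) - f (x + h *\<^sub>R v) + f x = h\<^sup>2 * a y"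
      using second_difference_mvt[of x r f u h v, OF d1 d2 h] hm m(2) unfolding a_def by auto
    obtain z where z: "norm (z - x) \<le> h * (norm v + norm u)"
      "f (x + h *\<^sub>R v + h *\<^sub>R u) - f (x + h *\<^sub>R v) - f (x + h *\<^sub>R u) + f x = h\<^sup>2 * b z"
      using second_difference_mvt[of x r f v h u, OF d1 d2 h] hm' m(2) unfolding b_def by auto
    have "h\<^sup>2 * a y = h\<^sup>2 * b z"
      using y(2) z(2) by (simp add: algebra_simps)
    then have ab: "a y = b z" using h by simp
    have "dist (a y) (a x) < e/2" using da(2) y(1) hm m by (simp add: dist_norm)
    moreover have "dist (b z) (b x) < e/2" using db(2) z(1) hm' m by (simp add: dist_norm)
    ultimately show ?thesis using ab unfolding dist_real_def by linarith
  qed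
  then have "a x = b x"
    by (metis less_irrefl right_minus_eq zero_less_abs_iff)
  then show ?thesis by (simp add: a_def b_def)
qed

text \<open>The mean value argument is for real values, hence the passage to components along
  \<open>Basis\<close>.\<close>

lemma symmetric_second_derivative:
  fixes f :: "'a::real_normed_vector \<Rightarrow> 'b::euclidean_space"
  assumes "open S" "x \<in> S" "smooth_on S f"
  shows "fderiv (\<lambda>z. fderiv f z u) x v = fderiv (\<lambda>z. fderiv f z v) x u"
proof (rule euclidean_eqI)
  fix i :: 'b assume "i \<in> Basis"
  have inner: "fderiv (\<lambda>y. g y \<bullet> i) y w = fderiv g y w \<bullet> i" if "smooth_on S g" "y \<in> S" for g :: "'a \<Rightarrow> 'b" and y w
    using bounded_linear.has_derivative[OF bounded_linear_inner_left smooth_on_has_derivative[OF that]]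
    by (rule fderiv_eq)
  have "fderiv (\<lambda>z. fderiv f z u) x v \<bullet> i = fderiv (\<lambda>z. fderiv (\<lambda>y. f y \<bullet> i) z u) x v" for u v
  proof -
    have s: "smooth_on S (\<lambda>z. fderiv f z u)" by (rule smooth_on_fderiv[OF assms(3)])
    have "fderiv (\<lambda>z. fderiv f z u) x v \<bullet> i = fderiv (\<lambda>y. fderiv f y u \<bullet> i) x v"
      using inner[OF s assms(2)] by simp
    also have "fderiv (\<lambda>y. fderiv f y u \<bullet> i) x = fderiv (\<lambda>z. fderiv (\<lambda>y. f y \<bullet> i) z u) x"
    proof (rule fderiv_transform(2)[OF assms(1,2)])
      show "(\<lambda>y. fderiv f y u \<bullet> i) differentiable at x"
        using bounded_linear.has_derivative[OF bounded_linear_inner_left smooth_on_has_derivative[OF s assms(2)]]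
        by (auto simp: differentiable_def)
    qed (simp add: inner[OF assms(3)])
    finally show ?thesis .
  qed
  moreover have "smooth_on S (\<lambda>y. f y \<bullet> i)"
    using smooth_on_compose_linear[OF bounded_linear_inner_left assms(1,3)] .
  then have "differentiable_upto 2 S (\<lambda>y. f y \<bullet> i)" by (simp add: smooth_on_def)
  ultimately show "fderiv (\<lambda>z. fderiv f z u) x v \<bullet> i = fderiv (\<lambda>z. fderiv f z v) x u \<bullet> i"
    using symmetric_second_derivative_real[OF assms(1,2), of "\<lambda>y. f y \<bullet> i"] by simp
qed

subsection \<open>Families of linear maps\<close>

lemma linear_expand:
  fixes L :: "'f::euclidean_space \<Rightarrow> 'g::real_vector"
  assumes "linear L"
  shows "L u = (\<Sum>i\<in>Basis. (u \<bullet> i) *\<^sub>R L i)"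
proof -
  have "L u = L (\<Sum>i\<in>Basis. (u \<bullet> i) *\<^sub>R i)" by (simp add: euclidean_representation)
  then show ?thesis using assms by (simp add: linear_sum linear_cmul)
qed

text \<open>Expanding the argument along \<open>Basis\<close> turns \<open>T y (p y)\<close> into a
  finite sum of products, so differentiability of \<open>T\<close> for each fixed argument is enough
  for the product rule.\<close>

lemma linear_family_has_derivative:
  fixes T :: "'e::real_normed_vector \<Rightarrow> 'f::euclidean_space \<Rightarrow> 'g::real_normed_vector"
  assumes S: "open S" "x \<in> S" and lin: "\<And>y. y \<in> S \<Longrightarrow> linear (T y)"
    and d: "\<And>u. (\<lambda>y. T y u) differentiable at x" and p: "(p has_derivative p') (at x)"
  shows "((\<lambda>y. T y (p y)) has_derivative (\<lambda>h. fderiv (\<lambda>y. T y (p x)) x h + T x (p' h))) (at x)"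
proof -
  have dT: "((\<lambda>y. T y u) has_derivative fderiv (\<lambda>y. T y u) x) (at x)" for u
    using d by (simp add: frechet_derivative_works)
  have "((\<lambda>y. \<Sum>i\<in>Basis. (p x \<bullet> i) *\<^sub>R T y i) has_derivative
      (\<lambda>h. \<Sum>i\<in>Basis. (p x \<bullet> i) *\<^sub>R fderiv (\<lambda>y. T y i) x h)) (at x)"
    by (intro has_derivative_sum has_derivative_scaleR_right dT)
  then have "((\<lambda>y. T y (p x)) has_derivative
      (\<lambda>h. \<Sum>i\<in>Basis. (p x \<bullet> i) *\<^sub>R fderiv (\<lambda>y. T y i) x h)) (at x)"
    by (rule has_derivative_transform_within_open[OF _ S]) (rule linear_expand[OF lin, symmetric])
  note 1 = fderiv_eq[OF this]
  have 2: "((\<lambda>y. p y \<bullet> i) has_derivative (\<lambda>h. p' h \<bullet> i)) (at x)" for i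
    using p by (rule has_derivative_inner_left)
  have "((\<lambda>y. \<Sum>i\<in>Basis. (p y \<bullet> i) *\<^sub>R T y i) has_derivative
      (\<lambda>h. \<Sum>i\<in>Basis. (p x \<bullet> i) *\<^sub>R fderiv (\<lambda>y. T y i) x h + (p' h \<bullet> i) *\<^sub>R T x i)) (at x)"
    by (intro has_derivative_sum has_derivative_scaleR 2 dT)
  then have "((\<lambda>y. T y (p y)) has_derivative
      (\<lambda>h. \<Sum>i\<in>Basis. (p x \<bullet> i) *\<^sub>R fderiv (\<lambda>y. T y i) x h + (p' h \<bullet> i) *\<^sub>R T x i)) (at x)"
    by (rule has_derivative_transform_within_open[OF _ S]) (rule linear_expand[OF lin, symmetric])
  then show ?thesis
    by (simp add: 1 sum.distrib linear_expand[OF lin[OF S(2)], of "p' h" for h])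
qed

lemma linear_family_fderiv_linear:
  fixes T :: "'e::real_normed_vector \<Rightarrow> 'f::real_vector \<Rightarrow> 'g::real_normed_vector"
  assumes S: "open S" "x \<in> S" and lin: "\<And>y. y \<in> S \<Longrightarrow> linear (T y)"
    and d: "\<And>u. (\<lambda>y. T y u) differentiable at x"
  shows "linear (\<lambda>u. fderiv (\<lambda>y. T y u) x h)"
proof (rule linearI)
  have dT: "((\<lambda>y. T y u) has_derivative fderiv (\<lambda>y. T y u) x) (at x)" for u
    using d by (simp add: frechet_derivative_works)
  show "fderiv (\<lambda>y. T y (u + v)) x h = fderiv (\<lambda>y. T y u) x h + fderiv (\<lambda>y. T y v) x h" for u v
    by (rule fderiv_eq, rule has_derivative_transform_within_open[OF has_derivative_add[OF dT dT] S])
      (simp add: linear_add[OF lin])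
  show "fderiv (\<lambda>y. T y (c *\<^sub>R u)) x h = c *\<^sub>R fderiv (\<lambda>y. T y u) x h" for c u
    by (rule fderiv_eq, rule has_derivative_transform_within_open[OF has_derivative_scaleR_right[OF dT] S])
      (simp add: linear_cmul[OF lin])
qed

lemma bilinear_family_has_derivative:
  fixes B :: "'e::real_normed_vector \<Rightarrow> 'f::euclidean_space \<Rightarrow> 'h::euclidean_space \<Rightarrow> 'g::real_normed_vector"
  assumes S: "open S" "x \<in> S" and lin: "\<And>y. y \<in> S \<Longrightarrow> bilinear (B y)"
    and d: "\<And>u v. (\<lambda>y. B y u v) differentiable at x"
    and p: "(p has_derivative p') (at x)" and q: "(q has_derivative q') (at x)"
  shows "((\<lambda>y. B y (p y) (q y)) has_derivative
    (\<lambda>h. fderiv (\<lambda>y. B y (p x) (q x)) x h + B x (p' h) (q x) + B x (p x) (q' h))) (at x)"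
proof -
  have 1: "((\<lambda>y. B y u (q y)) has_derivative (\<lambda>h. fderiv (\<lambda>y. B y u (q x)) x h + B x u (q' h))) (at x)" for u
    using lin by (intro linear_family_has_derivative[OF S _ d q]) (auto simp: bilinear_def)
  have "((\<lambda>y. B y (p y) (q y)) has_derivative
      (\<lambda>h. fderiv (\<lambda>y. B y (p x) (q y)) x h + B x (p' h) (q x))) (at x)"
    by (rule linear_family_has_derivative[where T = "\<lambda>y u. B y u (q y)", OF S _ _ p])
      (use lin differentiableI[OF 1] in \<open>auto simp: bilinear_def\<close>)
  then show ?thesis by (simp add: fderiv_eq[OF 1] ac_simps)
qed

lemma linear_family_differentiable_upto:
  fixes T :: "'e::real_normed_vector \<Rightarrow> 'f::euclidean_space \<Rightarrow> 'g::real_normed_vector"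
  assumes S: "open S" and lin: "\<And>y. y \<in> S \<Longrightarrow> linear (T y)"
    and d: "\<And>u. differentiable_upto n S (\<lambda>y. T y u)" and p: "differentiable_upto n S p"
  shows "differentiable_upto n S (\<lambda>y. T y (p y))"
proof (rule differentiable_upto_cong[OF S])
  show "differentiable_upto n S (\<lambda>y. \<Sum>i\<in>Basis. (p y \<bullet> i) *\<^sub>R T y i)"
    by (intro differentiable_upto_sum[OF S] differentiable_upto_bilinear[OF bounded_bilinear_scaleR S] d
      differentiable_upto_compose_linear[OF bounded_linear_inner_left S p])
qed (rule linear_expand[OF lin, symmetric])

text \<open>Injectivity is an open condition, in quantitative form: \<open>T y\<close> differs from
  \<open>T x\<close> by at most \<open>norm u * e y\<close> with \<open>e\<close> tending to 0, so
  half of the lower bound at \<open>x\<close> survives nearby.\<close>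

lemma linear_family_bounded_below:
  fixes T :: "'e::real_normed_vector \<Rightarrow> 'f::euclidean_space \<Rightarrow> 'g::euclidean_space"
  assumes S: "open S" "x \<in> S" and lin: "\<And>y. y \<in> S \<Longrightarrow> linear (T y)"
    and c: "\<And>u. continuous_on S (\<lambda>y. T y u)" and inj: "inj (T x)"
  shows "\<exists>C>0. \<forall>\<^sub>F y in at x. \<forall>u. norm u \<le> C * norm (T y u)"
proof -
  obtain B where B: "B > 0" "\<And>u. B * norm u \<le> norm (T x u)"
    using linear_inj_bounded_below_pos[OF lin[OF S(2)] inj] by auto
  define e where "e y = (\<Sum>i\<in>Basis. norm (T y i - T x i))" for y
  have "continuous_on S e" unfolding e_def
    by (intro continuous_intros c)
  then have "isCont e x" using S by (simp add: continuous_on_eq_continuous_at)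
  then have "(e \<longlongrightarrow> 0) (at x)" by (simp add: isCont_def e_def)
  then have "\<forall>\<^sub>F y in at x. e y < B / 2" using B(1) by (intro order_tendstoD(2)) auto
  moreover have "\<forall>\<^sub>F y in at x. y \<in> S" using S by (rule eventually_at_in_open')
  ultimately have "\<forall>\<^sub>F y in at x. \<forall>u. norm u \<le> 2 / B * norm (T y u)"
  proof eventually_elim
    case (elim y)
    show ?case
    proof
      fix u
      have "norm (T y u - T x u) = norm (\<Sum>i\<in>Basis. (u \<bullet> i) *\<^sub>R (T y i - T x i))"
        using linear_expand[OF lin[OF elim(2)], of u] linear_expand[OF lin[OF S(2)], of u]
        by (simp add: scaleR_diff_right sum_subtractf)
      also have "\<dots> \<le> (\<Sum>i\<in>Basis. norm ((u \<bullet> i) *\<^sub>R (T y i - T x i)))" by (rule norm_sum)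
      also have "\<dots> \<le> (\<Sum>i\<in>Basis. norm u * norm (T y i - T x i))"
        by (intro sum_mono) (auto intro!: mult_right_mono Basis_le_norm)
      also have "\<dots> = norm u * e y" by (simp add: e_def sum_distrib_left)
      also have "\<dots> \<le> norm u * (B / 2)" using elim by (intro mult_left_mono) auto
      finally have "norm (T x u - T y u) \<le> norm u * (B / 2)" by (simp add: norm_minus_commute)
      then have "norm u * (B / 2) \<le> norm (T y u)"
        using B(2)[of u] norm_triangle_ineq2[of "T x u" "T y u"] by argo
      then show "norm u \<le> 2 / B * norm (T y u)" using B(1) by (simp add: field_simps)
    qed
  qed
  then show ?thesis using B(1) by (intro exI[of _ "2 / B"]) auto
qed

text \<open>The difference \<open>z y - z x\<close> is mapped by \<open>T y\<close> to
  \<open>a y - T y (z x)\<close>, which tends to 0; the uniform lower bound carries this back to the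
  difference.\<close>

lemma linear_solution_continuous:
  fixes T :: "'e::real_normed_vector \<Rightarrow> 'f::euclidean_space \<Rightarrow> 'g::euclidean_space"
  assumes S: "open S" and lin: "\<And>y. y \<in> S \<Longrightarrow> linear (T y)"
    and c: "\<And>u. continuous_on S (\<lambda>y. T y u)" and inj: "\<And>y. y \<in> S \<Longrightarrow> inj (T y)"
    and a: "continuous_on S a" and z: "\<And>y. y \<in> S \<Longrightarrow> T y (z y) = a y"
  shows "continuous_on S z"
proof -
  have "isCont z x" if x: "x \<in> S" for x
  proof -
    obtain C where "C > 0" and C: "\<forall>\<^sub>F y in at x. \<forall>u. norm u \<le> C * norm (T y u)"
      using linear_family_bounded_below[where T = T, OF S x lin c inj[OF x]] by auto
    have "isCont (\<lambda>y. C * norm (a y - T y (z x))) x"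
      using continuous_on_mult_left[OF continuous_on_norm[OF continuous_on_diff[OF a c]]] S x
      by (simp add: continuous_on_eq_continuous_at)
    then have lim: "((\<lambda>y. C * norm (a y - T y (z x))) \<longlongrightarrow> 0) (at x)"
      using z[OF x] by (simp add: isCont_def)
    have "\<forall>\<^sub>F y in at x. y \<in> S" using S x by (rule eventually_at_in_open')
    with C have "\<forall>\<^sub>F y in at x. norm (z y - z x) \<le> C * norm (a y - T y (z x))"
    proof eventually_elim
      case (elim y)
      then show ?case using linear_diff[OF lin[OF elim(2)], of "z y" "z x"] z by metis
    qed
    from Lim_null_comparison[OF this lim] have "((\<lambda>y. z y - z x) \<longlongrightarrow> 0) (at x)" .
    then show ?thesis by (simp add: isCont_def LIM_zero_iff)
  qed
  then show ?thesis using S by (simp add: continuous_on_eq_continuous_at)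
qed

text \<open>Implicit differentiation of \<open>T y (z y) = a y\<close> dictates the candidate
  \<open>z'\<close>. Its remainder \<open>r\<close> has value and derivative 0 at \<open>x\<close>
  and is the image under \<open>T y\<close> of the first-order error of \<open>z\<close>, so the
  uniform lower bound makes that error negligible.\<close>

lemma linear_solution_has_derivative:
  fixes T :: "'e::real_normed_vector \<Rightarrow> 'f::euclidean_space \<Rightarrow> 'f"
  assumes S: "open S" "x \<in> S" and lin: "\<And>y. y \<in> S \<Longrightarrow> linear (T y)"
    and c: "\<And>u. continuous_on S (\<lambda>y. T y u)" and inj: "inj (T x)"
    and d: "\<And>u. (\<lambda>y. T y u) differentiable at x"
    and a: "a differentiable at x" and z: "\<And>y. y \<in> S \<Longrightarrow> T y (z y) = a y"
  shows "\<exists>z'. (z has_derivative z') (at x) \<and> (\<forall>v. T x (z' v) = fderiv a x v - fderiv (\<lambda>y. T y (z x)) x v)"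
proof -
  obtain L where L: "linear L" "\<And>u. T x (L u) = u" "\<And>u. L (T x u) = u"
    using linear_injective_isomorphism[OF lin[OF S(2)] inj] by auto
  define z' where "z' v = L (fderiv a x v - fderiv (\<lambda>y. T y (z x)) x v)" for v
  have da: "(a has_derivative fderiv a x) (at x)" using a by (simp add: frechet_derivative_works)
  have dT: "((\<lambda>y. T y (z x)) has_derivative fderiv (\<lambda>y. T y (z x)) x) (at x)"
    using d by (simp add: frechet_derivative_works)
  have bl: "bounded_linear z'" unfolding z'_def
    by (intro bounded_linear_compose[OF linear_conv_bounded_linear[THEN iffD1, OF L(1)]] bounded_linear_sub
      has_derivative_bounded_linear[OF da] has_derivative_bounded_linear[OF dT])
  have z'0: "z' 0 = 0" using bl by (rule linear_0[OF bounded_linear.linear])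
  define r where "r y = a y - T y (z x) - T y (z' (y - x))" for y
  have "((\<lambda>y. z' (y - x)) has_derivative z') (at x)"
    using bounded_linear.has_derivative[OF bl has_derivative_diff[OF has_derivative_ident has_derivative_const]]
    by simp
  from linear_family_has_derivative[where T = T, OF S lin d this]
  have "((\<lambda>y. T y (z' (y - x))) has_derivative (\<lambda>h. fderiv (\<lambda>y. T y 0) x h + T x (z' h))) (at x)"
    using z'0 by simp
  moreover have "fderiv (\<lambda>y. T y 0) x = fderiv (\<lambda>y. 0) x"
    using linear_0[OF lin] d by (intro fderiv_transform(2)[OF S]) auto
  ultimately have "((\<lambda>y. T y (z' (y - x))) has_derivative (\<lambda>h. T x (z' h))) (at x)" by simp
  from has_derivative_diff[OF has_derivative_diff[OF da dT] this]
  have r: "(r has_derivative (\<lambda>h. 0)) (at x)"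
    unfolding r_def by (simp add: z'_def L(2))
  have rx: "r x = 0" using z[OF S(2)] linear_0[OF lin[OF S(2)]] z'0 by (simp add: r_def)
  obtain C where "C > 0" and C: "\<forall>\<^sub>F y in at x. \<forall>u. norm u \<le> C * norm (T y u)"
    using linear_family_bounded_below[where T = T, OF S lin c inj] by auto
  have lim: "((\<lambda>y. C * (norm (r y) / norm (y - x))) \<longlongrightarrow> 0) (at x)"
    using tendsto_mult_right_zero[of "\<lambda>y. norm (r y) / norm (y - x)" "at x" C] r
    unfolding has_derivative_iff_norm by (simp add: rx)
  have "\<forall>\<^sub>F y in at x. y \<in> S" using S by (rule eventually_at_in_open')
  with C have "\<forall>\<^sub>F y in at x. norm (norm (z y - z x - z' (y - x)) / norm (y - x)) \<le> C * (norm (r y) / norm (y - x))"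
  proof eventually_elim
    case (elim y)
    have "T y (z y - z x - z' (y - x)) = r y"
      using linear_diff[OF lin[OF elim(2)]] z[OF elim(2)] by (simp add: r_def)
    then have "norm (z y - z x - z' (y - x)) \<le> C * norm (r y)" using elim(1) by metis
    then show ?case by (simp add: divide_right_mono)
  qed
  from Lim_null_comparison[OF this lim] bl have "(z has_derivative z') (at x)"
    by (simp add: has_derivative_iff_norm)
  then show ?thesis by (auto simp: z'_def L(2))
qed

text \<open>A directional derivative of \<open>z\<close> solves a system with the same coefficients
  \<open>T\<close> and a new right-hand side, to which the induction hypothesis applies.\<close>

lemma linear_solution_differentiable_upto:
  fixes T :: "'e::real_normed_vector \<Rightarrow> 'f::euclidean_space \<Rightarrow> 'f"
  assumes S: "open S" and lin: "\<And>y. y \<in> S \<Longrightarrow> linear (T y)" and inj: "\<And>y. y \<in> S \<Longrightarrow> inj (T y)"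
    and T: "\<And>u. differentiable_upto n S (\<lambda>y. T y u)" and a: "differentiable_upto n S a"
    and z: "\<And>y. y \<in> S \<Longrightarrow> T y (z y) = a y"
  shows "differentiable_upto n S z"
  using T a z
proof (induction n arbitrary: a z)
  case 0
  have "continuous_on S z"
    by (rule linear_solution_continuous[where T = T and a = a, OF S])
      (fact lin inj 0[unfolded differentiable_upto.simps])+
  then show ?case by simp
next
  case (Suc n)
  have c: "continuous_on S (\<lambda>y. T y u)" for u
    using Suc.prems(1)[of u] by (auto intro!: continuous_at_imp_continuous_on differentiable_imp_continuous_within)
  have dz: "z differentiable at x" "T x (fderiv z x v) = fderiv a x v - fderiv (\<lambda>y. T y (z x)) x v"
    if x: "x \<in> S" for x v
  proof -
    obtain z' where z': "(z has_derivative z') (at x)" "T x (z' v) = fderiv a x v - fderiv (\<lambda>y. T y (z x)) x v"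
      using linear_solution_has_derivative[where T = T, OF S x lin c inj[OF x] _ _ Suc.prems(3)] Suc.prems(1,2) x by auto
    then show "z differentiable at x" "T x (fderiv z x v) = fderiv a x v - fderiv (\<lambda>y. T y (z x)) x v"
      by (auto simp: differentiable_def fderiv_eq[OF z'(1)])
  qed
  have T': "differentiable_upto n S (\<lambda>y. T y u)" and a': "differentiable_upto n S a" for u
    using Suc.prems(1,2) differentiable_upto_Suc_imp by blast+
  \<comment> \<open>The new right-hand side contains \<open>z\<close> itself, inserted into the
    derivative of \<open>T\<close>; one order less suffices there.\<close>
  have z_n: "differentiable_upto n S z" using Suc.IH[OF T' a' Suc.prems(3)] .
  have "differentiable_upto n S (\<lambda>x. fderiv z x v)" for v
  proof (rule Suc.IH[OF T' _ dz(2)])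
    have "differentiable_upto n S (\<lambda>x. - fderiv (\<lambda>y. T y (z x)) x v)"
      using Suc.prems(1)
      by (intro differentiable_upto_compose_linear[OF bounded_linear_minus[OF bounded_linear_ident] S]
        linear_family_differentiable_upto[OF S _ _ z_n, of "\<lambda>x u. fderiv (\<lambda>y. T y u) x v"]
        linear_family_fderiv_linear[where T = T, OF S _ lin]) auto
    from differentiable_upto_add[OF S _ this, of "\<lambda>x. fderiv a x v"] Suc.prems(2)
    show "differentiable_upto n S (\<lambda>x. fderiv a x v - fderiv (\<lambda>y. T y (z x)) x v)" by simp
  qed
  then show ?case using dz(1) by simp
qed

subsection \<open>Inner products and musical isomorphisms\<close>

lemma inner_product_bilinear: "inner_product g \<Longrightarrow> bilinear g"
  by (simp add: inner_product_def)

lemma inner_product_nondegenerate: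
  assumes "inner_product g" "\<And>w. g a w = g b w"
  shows "a = b"
proof (rule ccontr)
  assume "a \<noteq> b"
  then have "0 < g (a - b) (a - b)" using assms(1) by (simp add: inner_product_def)
  also have "g (a - b) (a - b) = 0"
    using assms(1) bilinear_lsub[of g a b "a - b"] assms(2)[of "a - b"] by (auto simp: inner_product_def)
  finally show False by simp
qed

lemma sharp_eqI:
  assumes "inner_product g" "\<And>w. g z w = \<alpha> w"
  shows "sharp g \<alpha> = z"
  unfolding sharp_def
  using assms by (intro the_equality) (auto intro: inner_product_nondegenerate)

lemma linear_real_expand:
  fixes \<alpha> :: "'e::euclidean_space \<Rightarrow> real"
  assumes "linear \<alpha>"
  shows "\<alpha> w = (\<Sum>i\<in>Basis. \<alpha> i *\<^sub>R i) \<bullet> w"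
  using linear_expand[OF assms, of w] by (simp add: inner_sum_left inner_commute[of w] mult.commute)

text \<open>Lowering the index, with covectors stored as vectors through the Euclidean product. The
  equation that defines \<open>sharp\<close> thereby becomes a linear system in one space.\<close>

definition flat :: "('e::euclidean_space \<Rightarrow> 'e \<Rightarrow> real) \<Rightarrow> 'e \<Rightarrow> 'e" where
  "flat g z = (\<Sum>i\<in>Basis. g z i *\<^sub>R i)"

lemma inner_flat: "inner_product g \<Longrightarrow> flat g z \<bullet> w = g z w"
  unfolding flat_def using linear_real_expand[of "g z" w] by (simp add: inner_product_def bilinear_def)

lemma linear_flat: "inner_product g \<Longrightarrow> linear (flat g)"
  by (rule linearI)
    (auto dest!: inner_product_bilinear
      simp: flat_def bilinear_ladd bilinear_lmul scaleR_add_left sum.distrib scaleR_sum_right)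

lemma inj_flat: "inner_product g \<Longrightarrow> inj (flat g)"
  by (intro injI inner_product_nondegenerate[of g]) (auto simp flip: inner_flat)

text \<open>Nondegeneracy makes \<open>flat g\<close> injective, hence surjective in finite
  dimension; this is the existence part of the description in \<open>sharp\<close>.\<close>

lemma flat_sharp:
  fixes g :: "'e::euclidean_space \<Rightarrow> 'e \<Rightarrow> real"
  assumes "inner_product g" "linear \<alpha>"
  shows "flat g (sharp g \<alpha>) = (\<Sum>i\<in>Basis. \<alpha> i *\<^sub>R i)"
proof -
  have "surj (flat g)"
    using linear_injective_imp_surjective[OF linear_flat inj_flat] assms(1) by blast
  then obtain z where z: "(\<Sum>i\<in>Basis. \<alpha> i *\<^sub>R i) = flat g z" by (metis surjD)
  have "g z w = \<alpha> w" for w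
    unfolding linear_real_expand[OF assms(2), of w] z by (simp add: inner_flat assms(1))
  then show ?thesis using sharp_eqI[OF assms(1)] z by metis
qed

lemma inner_product_sharp:
  fixes g :: "'e::euclidean_space \<Rightarrow> 'e \<Rightarrow> real"
  assumes "inner_product g" "linear \<alpha>"
  shows "g (sharp g \<alpha>) w = \<alpha> w"
  using flat_sharp[OF assms] linear_real_expand[OF assms(2), of w] inner_flat[OF assms(1)] by metis


subsection \<open>The Levi-Civita connection and the curvature in coordinates\<close>

locale metric_chart =
  fixes S :: "'e::euclidean_space set" and G :: "'e metric_field"
  assumes open_S: "open S" and metric_field: "metric_field_on S G"
begin

lemma inner_product: "x \<in> S \<Longrightarrow> inner_product (G x)"
  using metric_field by (simp add: metric_field_on_def)

lemma metric_bilinear: "x \<in> S \<Longrightarrow> bilinear (G x)"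
  using inner_product by (simp add: inner_product_def)

lemma metric_commute: "x \<in> S \<Longrightarrow> G x u v = G x v u"
  using inner_product by (simp add: inner_product_def)

lemma metric_smooth: "smooth_on S (\<lambda>x. G x u v)"
  using metric_field by (simp add: metric_field_on_def)

lemma metric_differentiable: "x \<in> S \<Longrightarrow> (\<lambda>y. G y u v) differentiable at x"
  using metric_smooth by (rule smooth_on_differentiable)

lemma fderiv_metric_linear:
  assumes "x \<in> S"
  shows "linear (\<lambda>v. fderiv (\<lambda>y. G y v w) x u)" "linear (\<lambda>w. fderiv (\<lambda>y. G y v w) x u)"
    "linear (\<lambda>u. fderiv (\<lambda>y. G y v w) x u)"
proof -
  show "linear (\<lambda>v. fderiv (\<lambda>y. G y v w) x u)"
    using linear_family_fderiv_linear[where T = "\<lambda>y v. G y v w", OF open_S assms]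
      metric_differentiable[OF assms] metric_bilinear unfolding bilinear_def by blast
  show "linear (\<lambda>w. fderiv (\<lambda>y. G y v w) x u)"
    using linear_family_fderiv_linear[where T = "\<lambda>y w. G y v w", OF open_S assms]
      metric_differentiable[OF assms] metric_bilinear unfolding bilinear_def by blast
  show "linear (\<lambda>u. fderiv (\<lambda>y. G y v w) x u)"
    by (rule linear_frechet_derivative[OF metric_differentiable[OF assms]])
qed

lemma fderiv_metric_commute:
  assumes "x \<in> S"
  shows "fderiv (\<lambda>y. G y v w) x u = fderiv (\<lambda>y. G y w v) x u"
  using fderiv_transform(2)[OF open_S assms metric_commute metric_differentiable[OF assms]] by metis

text \<open>The side condition under which \<open>sharp\<close> represents the Koszul form.\<close>

lemma koszul_linear:
  assumes "x \<in> S"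
  shows "linear (\<lambda>w. (fderiv (\<lambda>y. G y v w) x u + fderiv (\<lambda>y. G y u w) x v - fderiv (\<lambda>y. G y u v) x w) / 2)"
proof -
  note l = fderiv_metric_linear[OF assms]
  show ?thesis
    by (rule linearI)
      (simp_all add: linear_add[OF l(2)] linear_cmul[OF l(2)] linear_add[OF l(3)] linear_cmul[OF l(3)]
        algebra_simps add_divide_distrib diff_divide_distrib)
qed

lemma metric_christoffel:
  assumes "x \<in> S"
  shows "G x (christoffel G x u v) w =
    (fderiv (\<lambda>y. G y v w) x u + fderiv (\<lambda>y. G y u w) x v - fderiv (\<lambda>y. G y u v) x w) / 2"
  unfolding christoffel_def by (rule inner_product_sharp[OF inner_product[OF assms] koszul_linear[OF assms]])

lemma christoffel_eqI:
  assumes "x \<in> S"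
    "\<And>w. G x z w = (fderiv (\<lambda>y. G y v w) x u + fderiv (\<lambda>y. G y u w) x v - fderiv (\<lambda>y. G y u v) x w) / 2"
  shows "christoffel G x u v = z"
  unfolding christoffel_def by (rule sharp_eqI[OF inner_product[OF assms(1)] assms(2)])

lemma christoffel_commute:
  assumes "x \<in> S"
  shows "christoffel G x u v = christoffel G x v u"
  by (rule christoffel_eqI[OF assms])
    (simp add: metric_christoffel[OF assms] fderiv_metric_commute[OF assms, of u v])

text \<open>In the sum of the Koszul formulas for \<open>v\<close>, \<open>w\<close> and for
  \<open>w\<close>, \<open>v\<close>, only the derivative in direction \<open>u\<close> does not
  cancel.\<close>

lemma metric_compatible:
  assumes "x \<in> S"
  shows "fderiv (\<lambda>y. G y v w) x u = G x (christoffel G x u v) w + G x v (christoffel G x u w)"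
proof -
  have 1: "G x v (christoffel G x u w) = G x (christoffel G x u w) v"
    by (rule metric_commute[OF assms])
  have 2: "fderiv (\<lambda>y. G y w v) x u = fderiv (\<lambda>y. G y v w) x u"
    by (rule fderiv_metric_commute[OF assms])
  show ?thesis
    unfolding 1 metric_christoffel[OF assms] 2 by (simp add: field_simps)
qed

lemma christoffel_bilinear:
  assumes "x \<in> S"
  shows "bilinear (christoffel G x)"
proof -
  note l = fderiv_metric_linear[OF assms]
  note b = metric_bilinear[OF assms]
  have "linear (christoffel G x u)" for u
  proof (rule linearI)
    show "christoffel G x u (v + v') = christoffel G x u v + christoffel G x u v'" for v v'
      by (rule christoffel_eqI[OF assms])
        (simp add: bilinear_ladd[OF b] metric_christoffel[OF assms] linear_add[OF l(1)]
          linear_add[OF l(2)] linear_add[OF l(3)] add_divide_distrib diff_divide_distrib)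
    show "christoffel G x u (c *\<^sub>R v) = c *\<^sub>R christoffel G x u v" for c v
      by (rule christoffel_eqI[OF assms])
        (simp add: bilinear_lmul[OF b] metric_christoffel[OF assms] linear_cmul[OF l(1)]
          linear_cmul[OF l(2)] linear_cmul[OF l(3)] algebra_simps add_divide_distrib diff_divide_distrib)
  qed
  moreover have "(\<lambda>u. christoffel G x u v) = christoffel G x v" for v
    using christoffel_commute[OF assms] by blast
  ultimately show ?thesis
    unfolding bilinear_def by simp
qed

text \<open>The Christoffel vector solves a linear system with coefficients
  \<open>flat (G x)\<close> and with the Koszul form as right-hand side, both smooth in
  \<open>x\<close>.\<close>

lemma christoffel_smooth: "smooth_on S (\<lambda>x. christoffel G x u v)"
  unfolding smooth_on_def
proof
  fix n
  define \<alpha> where "\<alpha> x w = (fderiv (\<lambda>y. G y v w) x u + fderiv (\<lambda>y. G y u w) x v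
    - fderiv (\<lambda>y. G y u v) x w) / 2" for x w
  have *: "differentiable_upto n S (\<lambda>x. fderiv (\<lambda>y. G y a b) x c)" for a b c
    using smooth_on_fderiv[OF metric_smooth] by (simp add: smooth_on_def)
  have "differentiable_upto n S (\<lambda>x. (1/2) *\<^sub>R (fderiv (\<lambda>y. G y v w) x u + fderiv (\<lambda>y. G y u w) x v
    + (-1) *\<^sub>R fderiv (\<lambda>y. G y u v) x w))" for w
    by (intro differentiable_upto_compose_linear[OF bounded_linear_scaleR_right open_S]
        differentiable_upto_add[OF open_S] *)
  then have \<alpha>: "differentiable_upto n S (\<lambda>x. \<alpha> x w)" for w
    by (simp add: \<alpha>_def)
  show "differentiable_upto n S (\<lambda>x. christoffel G x u v)"
  proof (rule linear_solution_differentiable_upto[where T = "\<lambda>x. flat (G x)"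
        and a = "\<lambda>x. \<Sum>i\<in>Basis. \<alpha> x i *\<^sub>R i", OF open_S])
    show "differentiable_upto n S (\<lambda>x. flat (G x) z)" for z
      unfolding flat_def using metric_smooth
      by (intro differentiable_upto_sum[OF open_S]
          differentiable_upto_compose_linear[OF bounded_linear_scaleR_left open_S]) (simp add: smooth_on_def)
    show "differentiable_upto n S (\<lambda>x. \<Sum>i\<in>Basis. \<alpha> x i *\<^sub>R i)"
      by (intro differentiable_upto_sum[OF open_S] \<alpha>
          differentiable_upto_compose_linear[OF bounded_linear_scaleR_left open_S])
    show "flat (G x) (christoffel G x u v) = (\<Sum>i\<in>Basis. \<alpha> x i *\<^sub>R i)" if "x \<in> S" for x
      unfolding christoffel_def \<alpha>_def
      by (rule flat_sharp[OF inner_product[OF that] koszul_linear[OF that]])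
  qed (simp_all add: linear_flat inj_flat inner_product)
qed

lemma christoffel_differentiable: "x \<in> S \<Longrightarrow> (\<lambda>y. christoffel G y u v) differentiable at x"
  using christoffel_smooth by (rule smooth_on_differentiable)

lemma fderiv_christoffel_linear:
  assumes "x \<in> S"
  shows "linear (\<lambda>v. fderiv (\<lambda>y. christoffel G y v w) x u)"
    "linear (\<lambda>w. fderiv (\<lambda>y. christoffel G y v w) x u)"
    "linear (\<lambda>u. fderiv (\<lambda>y. christoffel G y v w) x u)"
proof -
  show "linear (\<lambda>v. fderiv (\<lambda>y. christoffel G y v w) x u)"
    using linear_family_fderiv_linear[where T = "\<lambda>y v. christoffel G y v w", OF open_S assms]
      christoffel_differentiable[OF assms] christoffel_bilinear unfolding bilinear_def by blast
  show "linear (\<lambda>w. fderiv (\<lambda>y. christoffel G y v w) x u)"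
    using linear_family_fderiv_linear[where T = "\<lambda>y w. christoffel G y v w", OF open_S assms]
      christoffel_differentiable[OF assms] christoffel_bilinear unfolding bilinear_def by blast
  show "linear (\<lambda>u. fderiv (\<lambda>y. christoffel G y v w) x u)"
    by (rule linear_frechet_derivative[OF christoffel_differentiable[OF assms]])
qed

lemma riemann_linear:
  assumes "x \<in> S"
  shows "linear (\<lambda>u. riemann_op G x u v w)" "linear (\<lambda>v. riemann_op G x u v w)" "linear (riemann_op G x u v)"
proof -
  note l = fderiv_christoffel_linear[OF assms]
  note b = christoffel_bilinear[OF assms]
  note s = linear_add[OF l(1)] linear_add[OF l(2)] linear_add[OF l(3)]
    linear_cmul[OF l(1)] linear_cmul[OF l(2)] linear_cmul[OF l(3)]
    bilinear_ladd[OF b] bilinear_radd[OF b] bilinear_lmul[OF b] bilinear_rmul[OF b]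
  show "linear (\<lambda>u. riemann_op G x u v w)" "linear (\<lambda>v. riemann_op G x u v w)" "linear (riemann_op G x u v)"
    by (rule linearI; simp add: riemann_op_def s algebra_simps)+
qed

text \<open>By compatibility with the metric, antisymmetrising the second derivative of
  \<open>G z w w\<close> in \<open>u\<close> and \<open>v\<close> leaves twice this curvature term,
  while symmetry of second derivatives makes the result 0.\<close>

lemma riemann_last_pair_zero:
  assumes "x \<in> S"
  shows "G x (riemann_op G x u v w) w = 0"
proof -
  note b = metric_bilinear[OF assms]
  have d: "fderiv (\<lambda>y. fderiv (\<lambda>z. G z w w) y v) x u =
      2 * (G x (christoffel G x u (christoffel G x v w)) w + G x (christoffel G x v w) (christoffel G x u w)
        + G x (fderiv (\<lambda>y. christoffel G y v w) x u) w)" for u v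
  proof -
    have "((\<lambda>y. G y (christoffel G y v w) w) has_derivative
       (\<lambda>h. fderiv (\<lambda>y. G y (christoffel G x v w) w) x h + G x (fderiv (\<lambda>y. christoffel G y v w) x h) w
         + G x (christoffel G x v w) 0)) (at x)"
      by (rule bilinear_family_has_derivative[OF open_S assms metric_bilinear metric_differentiable[OF assms]])
        (use smooth_on_has_derivative[OF christoffel_smooth assms] in auto)
    then have "((\<lambda>y. 2 * G y (christoffel G y v w) w) has_derivative
       (\<lambda>h. 2 * (fderiv (\<lambda>y. G y (christoffel G x v w) w) x h + G x (fderiv (\<lambda>y. christoffel G y v w) x h) w
         + G x (christoffel G x v w) 0))) (at x)"
      by (rule has_derivative_mult_right)
    then have "((\<lambda>y. fderiv (\<lambda>z. G z w w) y v) has_derivative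
       (\<lambda>h. 2 * (fderiv (\<lambda>y. G y (christoffel G x v w) w) x h + G x (fderiv (\<lambda>y. christoffel G y v w) x h) w
         + G x (christoffel G x v w) 0))) (at x)"
      by (rule has_derivative_transform_within_open[OF _ open_S assms])
        (simp add: metric_compatible metric_commute[of _ w])
    from fderiv_eq[OF this] show ?thesis
      by (simp add: metric_compatible[OF assms] bilinear_rzero[OF b])
  qed
  have "fderiv (\<lambda>y. fderiv (\<lambda>z. G z w w) y v) x u = fderiv (\<lambda>y. fderiv (\<lambda>z. G z w w) y u) x v"
    by (rule symmetric_second_derivative[OF open_S assms metric_smooth])
  then show ?thesis
    unfolding d riemann_op_def
    by (simp add: bilinear_ladd[OF b] bilinear_lsub[OF b] metric_commute[OF assms, of "christoffel G x v w"])
qed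

end


subsection \<open>Naturality of connection and curvature\<close>

text \<open>A map into a larger space can preserve the metric and have a nonzero second fundamental
  form, which would break naturality of the connection; surjectivity of the derivative excludes
  this.\<close>

locale isometric_coords =
  dom: metric_chart S G + cod: metric_chart S' G'
  for S :: "'e::euclidean_space set" and G and S' :: "'f::euclidean_space set" and G' +
  fixes f :: "'e \<Rightarrow> 'f"
  assumes f_smooth: "smooth_on S f"
    and f_in: "x \<in> S \<Longrightarrow> f x \<in> S'"
    and isometric: "x \<in> S \<Longrightarrow> G x u v = G' (f x) (fderiv f x u) (fderiv f x v)"
    and surj: "x \<in> S \<Longrightarrow> surj (fderiv f x)"
begin

lemma f_linear: "x \<in> S \<Longrightarrow> linear (fderiv f x)"
  by (rule linear_frechet_derivative[OF smooth_on_differentiable[OF f_smooth]])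

lemma second_derivative_commute:
  "x \<in> S \<Longrightarrow> fderiv (\<lambda>y. fderiv f y v) x u = fderiv (\<lambda>y. fderiv f y u) x v"
  by (rule symmetric_second_derivative[OF dom.open_S _ f_smooth])

lemma compose_has_derivative:
  assumes "x \<in> S" "h differentiable at (f x)"
  shows "((\<lambda>y. h (f y)) has_derivative (\<lambda>u. fderiv h (f x) (fderiv f x u))) (at x)"
  using has_derivative_compose[OF smooth_on_has_derivative[OF f_smooth assms(1)]] assms(2)
  by (simp add: frechet_derivative_works)

lemma fderiv_has_derivative:
  "x \<in> S \<Longrightarrow> ((\<lambda>y. fderiv f y v) has_derivative fderiv (\<lambda>y. fderiv f y v) x) (at x)"
  by (rule smooth_on_has_derivative[OF smooth_on_fderiv[OF f_smooth]])

lemma bilinear_pullback_has_derivative: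
  fixes B :: "'f \<Rightarrow> 'f \<Rightarrow> 'f \<Rightarrow> 'g::real_normed_vector"
  assumes x: "x \<in> S" and B: "\<And>z. z \<in> S' \<Longrightarrow> bilinear (B z)"
    "\<And>u v. (\<lambda>z. B z u v) differentiable at (f x)"
  shows "((\<lambda>y. B (f y) (fderiv f y v) (fderiv f y w)) has_derivative
    (\<lambda>u. fderiv (\<lambda>z. B z (fderiv f x v) (fderiv f x w)) (f x) (fderiv f x u)
      + B (f x) (fderiv (\<lambda>y. fderiv f y v) x u) (fderiv f x w)
      + B (f x) (fderiv f x v) (fderiv (\<lambda>y. fderiv f y w) x u))) (at x)"
proof -
  have 1: "((\<lambda>y. B (f y) p q) has_derivative (\<lambda>u. fderiv (\<lambda>z. B z p q) (f x) (fderiv f x u))) (at x)" for p q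
    by (rule compose_has_derivative[OF x B(2)])
  have "((\<lambda>y. B (f y) (fderiv f y v) (fderiv f y w)) has_derivative
    (\<lambda>u. fderiv (\<lambda>y. B (f y) (fderiv f x v) (fderiv f x w)) x u
      + B (f x) (fderiv (\<lambda>y. fderiv f y v) x u) (fderiv f x w)
      + B (f x) (fderiv f x v) (fderiv (\<lambda>y. fderiv f y w) x u))) (at x)"
    by (rule bilinear_family_has_derivative[where B = "\<lambda>y. B (f y)", OF dom.open_S x B(1)[OF f_in]
          differentiableI[OF 1] fderiv_has_derivative[OF x] fderiv_has_derivative[OF x]])
  then show ?thesis by (simp add: fderiv_eq[OF 1])
qed

text \<open>Differentiating the isometry equation adds second derivatives of \<open>f\<close> to
  each term of the Koszul formula; by their symmetry only twice the pairing of the second derivative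
  along \<open>u\<close>, \<open>v\<close> with the image of \<open>w\<close> is left.\<close>

lemma christoffel_natural:
  assumes x: "x \<in> S"
  shows "fderiv (\<lambda>y. fderiv f y v) x u + christoffel G' (f x) (fderiv f x u) (fderiv f x v)
    = fderiv f x (christoffel G x u v)"
proof (rule inner_product_nondegenerate[OF cod.inner_product[OF f_in[OF x]]])
  fix w'
  \<comment> \<open>The Koszul formula upstairs tests only against images of vectors, so every test
    vector has to be one.\<close>
  obtain w where w: "w' = fderiv f x w" using surj[OF x] by (metis surjD)
  note b = cod.metric_bilinear[OF f_in[OF x]]
  have d: "fderiv (\<lambda>y. G y v w) x u =
      fderiv (\<lambda>z. G' z (fderiv f x v) (fderiv f x w)) (f x) (fderiv f x u)
      + G' (f x) (fderiv (\<lambda>y. fderiv f y v) x u) (fderiv f x w)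
      + G' (f x) (fderiv f x v) (fderiv (\<lambda>y. fderiv f y w) x u)" for u v w
  proof (rule fderiv_eq, rule has_derivative_transform_within_open[OF _ dom.open_S x])
    show "((\<lambda>y. G' (f y) (fderiv f y v) (fderiv f y w)) has_derivative
      (\<lambda>u. fderiv (\<lambda>z. G' z (fderiv f x v) (fderiv f x w)) (f x) (fderiv f x u)
      + G' (f x) (fderiv (\<lambda>y. fderiv f y v) x u) (fderiv f x w)
      + G' (f x) (fderiv f x v) (fderiv (\<lambda>y. fderiv f y w) x u))) (at x)"
      by (rule bilinear_pullback_has_derivative[OF x cod.metric_bilinear cod.metric_differentiable[OF f_in[OF x]]])
  qed (simp add: isometric)
  have "G' (f x) (fderiv f x (christoffel G x u v)) w' = G x (christoffel G x u v) w"
    by (simp add: isometric[OF x] w)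
  also have "\<dots> = G' (f x) (fderiv (\<lambda>y. fderiv f y v) x u) w'
      + G' (f x) (christoffel G' (f x) (fderiv f x u) (fderiv f x v)) w'"
    unfolding dom.metric_christoffel[OF x] cod.metric_christoffel[OF f_in[OF x]] d w
    using second_derivative_commute[OF x]
      cod.metric_commute[OF f_in[OF x], of "fderiv f x v"] cod.metric_commute[OF f_in[OF x], of "fderiv f x u"]
    by (simp add: field_simps)
  finally show "G' (f x) (fderiv (\<lambda>y. fderiv f y v) x u
      + christoffel G' (f x) (fderiv f x u) (fderiv f x v)) w' = G' (f x) (fderiv f x (christoffel G x u v)) w'"
    by (simp add: bilinear_ladd[OF b])
qed

text \<open>Differentiating the transformation law of the Christoffel symbols and antisymmetrising
  in \<open>u\<close> and \<open>v\<close> cancels all second and third derivatives of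
  \<open>f\<close>.\<close>

lemma riemann_natural:
  assumes x: "x \<in> S"
  shows "fderiv f x (riemann_op G x u v w)
    = riemann_op G' (f x) (fderiv f x u) (fderiv f x v) (fderiv f x w)"
proof -
  define f2 where "f2 u v = fderiv (\<lambda>y. fderiv f y v) x u" for u v
  define f3 where "f3 u v = fderiv (\<lambda>y. fderiv (\<lambda>z. fderiv f z w) y v) x u" for u v
  define L where "L = fderiv f x"
  define C where "C = christoffel G x"
  define C' where "C' = christoffel G' (f x)"
  note b = cod.christoffel_bilinear[OF f_in[OF x], folded C'_def]
  have s2: "f2 u v = f2 v u" for u v
    unfolding f2_def by (rule second_derivative_commute[OF x])
  have s3: "f3 u v = f3 v u" for u v
    unfolding f3_def by (rule symmetric_second_derivative[OF dom.open_S x smooth_on_fderiv[OF f_smooth]])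
  have nat: "L (C u v) = f2 u v + C' (L u) (L v)" for u v
    unfolding L_def C_def C'_def f2_def by (simp add: christoffel_natural[OF x])
  \<comment> \<open>Both sides are the derivative along \<open>u\<close> of
    \<open>fderiv f y (christoffel G y v w)\<close>: the left by the product rule, the right after
    rewriting with \<open>christoffel_natural\<close>.\<close>
  have d: "f2 u (C v w) + L (fderiv (\<lambda>y. christoffel G y v w) x u) =
      f3 u v + (fderiv (\<lambda>z. christoffel G' z (L v) (L w)) (f x) (L u) + C' (f2 u v) (L w) + C' (L v) (f2 u w))" for u v
  proof -
    have 1: "((\<lambda>y. fderiv f y (christoffel G y v w)) has_derivative
        (\<lambda>u. f2 u (C v w) + L (fderiv (\<lambda>y. christoffel G y v w) x u))) (at x)"
      unfolding f2_def L_def C_def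
      by (rule linear_family_has_derivative[OF dom.open_S x f_linear differentiableI[OF fderiv_has_derivative[OF x]]
            smooth_on_has_derivative[OF dom.christoffel_smooth x]])
    have "((\<lambda>y. fderiv (\<lambda>z. fderiv f z w) y v + christoffel G' (f y) (fderiv f y v) (fderiv f y w)) has_derivative
       (\<lambda>u. f3 u v + (fderiv (\<lambda>z. christoffel G' z (L v) (L w)) (f x) (L u) + C' (f2 u v) (L w) + C' (L v) (f2 u w)))) (at x)"
      unfolding f2_def f3_def L_def C'_def
      by (intro has_derivative_add smooth_on_has_derivative[OF smooth_on_fderiv[OF smooth_on_fderiv[OF f_smooth]] x]
          bilinear_pullback_has_derivative[OF x] cod.christoffel_bilinear cod.christoffel_differentiable[OF f_in[OF x]])
    then have 2: "((\<lambda>y. fderiv f y (christoffel G y v w)) has_derivative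
       (\<lambda>u. f3 u v + (fderiv (\<lambda>z. christoffel G' z (L v) (L w)) (f x) (L u) + C' (f2 u v) (L w) + C' (L v) (f2 u w)))) (at x)"
      by (rule has_derivative_transform_within_open[OF _ dom.open_S x]) (simp add: christoffel_natural)
    show ?thesis using fderiv_eq[OF 1, of u] fderiv_eq[OF 2, of u] by simp
  qed
  have L: "linear L" unfolding L_def by (rule f_linear[OF x])
  have e: "L (fderiv (\<lambda>y. christoffel G y v w) x u) = f3 u v + fderiv (\<lambda>z. christoffel G' z (L v) (L w)) (f x) (L u)
      + C' (f2 u v) (L w) + C' (L v) (f2 u w) - f2 u (C v w)" for u v
    using d[of u v] by (simp add: algebra_simps)
  show ?thesis
    unfolding riemann_op_def C_def[symmetric] C'_def[symmetric] L_def[symmetric]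
    by (simp add: linear_add[OF L] linear_diff[OF L] e nat bilinear_radd[OF b])
      (simp add: s2[of v u] s3[of v u] algebra_simps)
qed

lemma riemann_tensor_natural:
  assumes x: "x \<in> S"
  shows "G x (riemann_op G x u v w) z
    = G' (f x) (riemann_op G' (f x) (fderiv f x u) (fderiv f x v) (fderiv f x w)) (fderiv f x z)"
  by (simp add: isometric[OF x] riemann_natural[OF x])

end

subsection \<open>Charts and transition maps\<close>

lemma second_countable_prod_topology:
  assumes "second_countable X" "second_countable Y"
  shows "second_countable (prod_topology X Y)"
proof -
  obtain A where A: "countable A" "\<forall>V\<in>A. openin X V"
    "\<forall>U x. openin X U \<and> x \<in> U \<longrightarrow> (\<exists>V\<in>A. x \<in> V \<and> V \<subseteq> U)"
    using assms(1) unfolding second_countable_def by (elim exE conjE)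
  obtain B where B: "countable B" "\<forall>V\<in>B. openin Y V"
    "\<forall>U x. openin Y U \<and> x \<in> U \<longrightarrow> (\<exists>V\<in>B. x \<in> V \<and> V \<subseteq> U)"
    using assms(2) unfolding second_countable_def by (elim exE conjE)
  show ?thesis
    unfolding second_countable_def
  proof (intro exI conjI)
    show "countable ((\<lambda>(V, W). V \<times> W) ` (A \<times> B))" using A(1) B(1) by auto
    show "\<forall>V\<in>(\<lambda>(V, W). V \<times> W) ` (A \<times> B). openin (prod_topology X Y) V"
      using A(2) B(2) by (auto simp: openin_prod_Times_iff)
    show "\<forall>U x. openin (prod_topology X Y) U \<and> x \<in> U \<longrightarrow> (\<exists>V\<in>(\<lambda>(V, W). V \<times> W) ` (A \<times> B). x \<in> V \<and> V \<subseteq> U)"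
    proof (intro allI impI)
      fix U x assume *: "openin (prod_topology X Y) U \<and> x \<in> U"
      obtain p q where x: "x = (p, q)" by (rule prod.exhaust)
      obtain U1 U2 where U: "openin X U1" "openin Y U2" "p \<in> U1" "q \<in> U2" "U1 \<times> U2 \<subseteq> U"
        using *[THEN conjunct1, unfolded openin_prod_topology_alt, rule_format, of p q] * x by auto
      obtain V W where "V \<in> A" "p \<in> V" "V \<subseteq> U1" "W \<in> B" "q \<in> W" "W \<subseteq> U2"
        using A(3) B(3) U by meson
      then show "\<exists>V\<in>(\<lambda>(V, W). V \<times> W) ` (A \<times> B). x \<in> V \<and> V \<subseteq> U"
        using U(5) x by (intro bexI[of _ "V \<times> W"]) auto
    qed
  qed
qed

lemma second_countable_euclidean: "second_countable (euclidean :: 'a::second_countable_topology topology)"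
proof -
  obtain B :: "'a set set" where B: "countable B" "topological_basis B"
    using ex_countable_basis by blast
  have "\<exists>V\<in>B. x \<in> V \<and> V \<subseteq> U" if "open U" "x \<in> U" for U x
    by (rule topological_basisE[OF B(2) that]) blast
  then show ?thesis
    unfolding second_countable_def using B by (intro exI[of _ B]) (auto simp: topological_basis_open)
qed

lemma homeomorphic_map_prod:
  assumes "homeomorphic_map X X' f" "homeomorphic_map Y Y' g"
  shows "homeomorphic_map (prod_topology X Y) (prod_topology X' Y') (map_prod f g)"
proof -
  obtain f' g' where "homeomorphic_maps X X' f f'" "homeomorphic_maps Y Y' g g'"
    using assms unfolding homeomorphic_map_maps by blast
  then have "homeomorphic_maps (prod_topology X Y) (prod_topology X' Y') (\<lambda>(x,y). (f x, g y)) (\<lambda>(x,y). (f' x, g' y))"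
    by (simp add: homeomorphic_maps_prod)
  then show ?thesis
    unfolding map_prod_def using homeomorphic_map_maps by blast
qed

lemma top_of_set_Times: "prod_topology (top_of_set A) (top_of_set B) = top_of_set (A \<times> B)"
  by (simp flip: subtopology_Times)

lemma riemannian_chart_metric_chart:
  "riemannian_chart X c \<Longrightarrow> metric_chart (chart_map c ` chart_dom c) (chart_metric c)"
  by (simp add: riemannian_chart_def metric_chart_def)

lemma riemannian_chart_inj:
  assumes "riemannian_chart X c"
  shows "inj_on (chart_map c) (chart_dom c)"
proof -
  have "topspace (subtopology X (chart_dom c)) = chart_dom c"
    using assms openin_subset by (fastforce simp: riemannian_chart_def)
  then show ?thesis
    using assms by (simp add: riemannian_chart_def homeomorphic_map_def)
qed

lemma inv_into_chart:
  "riemannian_chart X c \<Longrightarrow> p \<in> chart_dom c \<Longrightarrow> inv_into (chart_dom c) (chart_map c) (chart_map c p) = p"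
  by (rule inv_into_f_f[OF riemannian_chart_inj])

lemma coord_expr_chart:
  "riemannian_chart X c \<Longrightarrow> p \<in> chart_dom c \<Longrightarrow> coord_expr c d F (chart_map c p) = chart_map d (F p)"
  by (simp add: coord_expr_def inv_into_chart)

lemma riemannian_chart_open_image:
  assumes "riemannian_chart X c" "openin X W" "W \<subseteq> chart_dom c"
  shows "open (chart_map c ` W)"
proof -
  have "openin (subtopology X (chart_dom c)) W"
    using assms by (simp add: openin_subset_topspace_eq openin_open_subtopology riemannian_chart_def)
  then have "openin (top_of_set (chart_map c ` chart_dom c)) (chart_map c ` W)"
    using assms(1) homeomorphic_imp_open_map unfolding riemannian_chart_def open_map_def by blast
  then show ?thesis
    using assms(1) openin_open_trans unfolding riemannian_chart_def by blast
qed

text \<open>That \<open>H\<close> inverts \<open>F\<close> gives the surjectivity of the derivative.\<close>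

lemma isometric_coords_charts:
  fixes c :: "('m, 'e::euclidean_space) rchart" and d :: "('n, 'f::euclidean_space) rchart"
  assumes c: "riemannian_chart X c" and d: "riemannian_chart Y d"
    and F: "smooth_isometric_in c d F" and H: "smooth_isometric_in d c H"
    and W: "openin X {p \<in> chart_dom c. F p \<in> chart_dom d}"
    and W': "openin Y {q \<in> chart_dom d. H q \<in> chart_dom c}"
    and HF: "\<And>p. p \<in> chart_dom c \<Longrightarrow> F p \<in> chart_dom d \<Longrightarrow> H (F p) = p"
    and FH: "\<And>q. q \<in> chart_dom d \<Longrightarrow> H q \<in> chart_dom c \<Longrightarrow> F (H q) = q"
  shows "isometric_coords (chart_map c ` {p \<in> chart_dom c. F p \<in> chart_dom d}) (chart_metric c)
    (chart_map d ` chart_dom d) (chart_metric d) (coord_expr c d F)"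
proof -
  define S where "S = chart_map c ` {p \<in> chart_dom c. F p \<in> chart_dom d}"
  define S' where "S' = chart_map d ` {q \<in> chart_dom d. H q \<in> chart_dom c}"
  define f where "f = coord_expr c d F"
  define h where "h = coord_expr d c H"
  have "metric_field_on (chart_map c ` chart_dom c) (chart_metric c)"
    using c by (simp add: riemannian_chart_def)
  then have mf: "metric_field_on S (chart_metric c)"
    unfolding metric_field_on_def S_def by (blast intro: smooth_on_subset)
  have oS: "open S" unfolding S_def by (rule riemannian_chart_open_image[OF c W]) blast
  have oS': "open S'" unfolding S'_def by (rule riemannian_chart_open_image[OF d W']) blast
  have f: "smooth_on S f" and iso: "\<And>x u v. x \<in> S \<Longrightarrow> chart_metric c x u v =
      chart_metric d (f x) (fderiv f x u) (fderiv f x v)"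
    using F unfolding smooth_isometric_in_def Let_def S_def f_def by auto
  have h: "smooth_on S' h"
    using H unfolding smooth_isometric_in_def Let_def S'_def h_def by auto
  have hf: "f x \<in> S' \<and> h (f x) = x" if x: "x \<in> S" for x
  proof -
    obtain p where p: "p \<in> chart_dom c" "F p \<in> chart_dom d" "x = chart_map c p"
      using x by (auto simp: S_def)
    then show ?thesis
      using HF[OF p(1,2)] by (auto simp: S'_def f_def h_def coord_expr_chart[OF c] coord_expr_chart[OF d])
  qed
  have fh: "h y \<in> S \<and> f (h y) = y" if y: "y \<in> S'" for y
  proof -
    obtain q where q: "q \<in> chart_dom d" "H q \<in> chart_dom c" "y = chart_map d q"
      using y by (auto simp: S'_def)
    then show ?thesis
      using FH[OF q(1,2)] by (auto simp: S_def f_def h_def coord_expr_chart[OF c] coord_expr_chart[OF d])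
  qed
  have surj: "surj (fderiv f x)" if x: "x \<in> S" for x
  proof -
    have y: "f x \<in> S'" "h (f x) = x" using hf[OF x] by auto
    have "((\<lambda>y. f (h y)) has_derivative (\<lambda>v. fderiv f x (fderiv h (f x) v))) (at (f x))"
      using has_derivative_compose[OF smooth_on_has_derivative[OF h y(1)]] smooth_on_has_derivative[OF f x] y(2)
      by simp
    then have "((\<lambda>y. y) has_derivative (\<lambda>v. fderiv f x (fderiv h (f x) v))) (at (f x))"
      by (rule has_derivative_transform_within_open[OF _ oS' y(1)]) (simp add: fh)
    from fderiv_eq[OF this] have "v = fderiv f x (fderiv h (f x) v)" for v
      by simp
    then show ?thesis by (metis surj_def)
  qed
  have "f x \<in> chart_map d ` chart_dom d" if "x \<in> S" for x
    using hf[OF that] by (auto simp: S'_def)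
  then have "isometric_coords S (chart_metric c) (chart_map d ` chart_dom d) (chart_metric d) f"
    using oS mf riemannian_chart_metric_chart[OF d] f iso surj
    by (simp add: isometric_coords_def metric_chart_def isometric_coords_axioms_def)
  then show ?thesis by (simp add: S_def f_def)
qed

lemma riemannian_manifold_chart:
  "riemannian_manifold n M \<Longrightarrow> c \<in> man_atlas M \<Longrightarrow> riemannian_chart (man_top M) c"
  by (simp add: riemannian_manifold_def)

lemma isometric_coords_transition:
  assumes M: "riemannian_manifold n M" and c: "c \<in> man_atlas M" and d: "d \<in> man_atlas M"
  shows "isometric_coords (chart_map c ` {p \<in> chart_dom c. id p \<in> chart_dom d}) (chart_metric c)
    (chart_map d ` chart_dom d) (chart_metric d) (coord_expr c d id)"
proof (rule isometric_coords_charts[where F = id and H = id])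
  have "openin (man_top M) (chart_dom c \<inter> chart_dom d)"
    using riemannian_manifold_chart[OF M] c d by (auto simp: riemannian_chart_def)
  then show "openin (man_top M) {p \<in> chart_dom c. id p \<in> chart_dom d}"
    "openin (man_top M) {p \<in> chart_dom d. id p \<in> chart_dom c}"
    by (simp_all add: Int_def conj_commute)
qed (use assms riemannian_manifold_chart[OF M] in \<open>auto simp: riemannian_manifold_def\<close>)

lemma riemannian_chart_restrict:
  assumes c: "riemannian_chart X c" and U: "openin X U"
  shows "riemannian_chart (subtopology X U) (c\<lparr>chart_dom := chart_dom c \<inter> U\<rparr>)"
proof -
  have *: "openin X (chart_dom c \<inter> U)" using c U by (auto simp: riemannian_chart_def)
  have sub: "chart_dom c \<subseteq> topspace X" using c openin_subset by (auto simp: riemannian_chart_def)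
  have "homeomorphic_map (subtopology (subtopology X (chart_dom c)) U)
      (subtopology (top_of_set (chart_map c ` chart_dom c)) (chart_map c ` (chart_dom c \<inter> U))) (chart_map c)"
    using c sub homeomorphic_map_subtopologies[of "subtopology X (chart_dom c)"
        "top_of_set (chart_map c ` chart_dom c)" "chart_map c" U "chart_map c ` (chart_dom c \<inter> U)"]
    by (auto simp: riemannian_chart_def)
  then have "homeomorphic_map (subtopology (subtopology X U) (chart_dom c \<inter> U))
      (top_of_set (chart_map c ` (chart_dom c \<inter> U))) (chart_map c)"
    by (simp add: subtopology_subtopology Int_absorb1 image_mono Int_left_commute Int_commute)
  moreover have "metric_field_on (chart_map c ` (chart_dom c \<inter> U)) (chart_metric c)"
    using c unfolding metric_field_on_def riemannian_chart_def by (blast intro: smooth_on_subset)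
  moreover have "openin (subtopology X U) (chart_dom c \<inter> U)"
    using * by (simp add: openin_open_subtopology U)
  ultimately show ?thesis
    using riemannian_chart_open_image[OF c *] by (simp add: riemannian_chart_def)
qed


subsection \<open>Products and cones\<close>

text \<open>The metric of \<open>product_chart\<close> as an operation on metric fields; this form,
  like \<open>cone_metric\<close> below, lets curvature be computed without reference to
  charts.\<close>

definition product_metric :: "'e metric_field \<Rightarrow> 'f metric_field \<Rightarrow> ('e \<times> 'f) metric_field" where
  "product_metric G1 G2 = (\<lambda>(x, y) (u1, u2) (v1, v2). G1 x u1 v1 + G2 y u2 v2)"

lemma product_metric_apply [simp]:
  "product_metric G1 G2 (x, y) (u1, u2) (v1, v2) = G1 x u1 v1 + G2 y u2 v2"
  by (simp add: product_metric_def)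

definition cone_metric :: "'e metric_field \<Rightarrow> (real \<times> 'e) metric_field" where
  "cone_metric G = (\<lambda>(t, x) (a, u) (b, v). a * b + t\<^sup>2 * G x u v)"

lemma cone_metric_apply [simp]:
  "cone_metric G (t, x) (a, u) (b, v) = a * b + t\<^sup>2 * G x u v"
  by (simp add: cone_metric_def)

lemma inner_product_add:
  fixes g1 :: "'v::real_vector \<Rightarrow> 'v \<Rightarrow> real" and g2 :: "'w::real_vector \<Rightarrow> 'w \<Rightarrow> real"
  assumes "inner_product g1" "inner_product g2"
  shows "inner_product (\<lambda>(u1, u2) (v1, v2). g1 u1 v1 + g2 u2 v2)"
proof -
  note b = bilinear_ladd[of g1] bilinear_radd[of g1] bilinear_lmul[of g1] bilinear_rmul[of g1]
    bilinear_ladd[of g2] bilinear_radd[of g2] bilinear_lmul[of g2] bilinear_rmul[of g2]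
  have g: "bilinear g1" "bilinear g2" "\<And>u v. g1 u v = g1 v u" "\<And>u v. g2 u v = g2 v u"
    "\<And>u. u \<noteq> 0 \<Longrightarrow> 0 < g1 u u" "\<And>u. u \<noteq> 0 \<Longrightarrow> 0 < g2 u u"
    using assms by (auto simp: inner_product_def)
  have nn: "0 \<le> g1 u u" "0 \<le> g2 v v" for u v
    using g(5)[of u] g(6)[of v] bilinear_lzero[OF g(1), of 0] bilinear_lzero[OF g(2), of 0]
    by (cases "u = 0"; cases "v = 0"; simp)+
  show ?thesis
    unfolding inner_product_def
  proof (intro conjI allI impI)
    show "bilinear (\<lambda>(u1, u2) (v1, v2). g1 u1 v1 + g2 u2 v2)"
      unfolding bilinear_def
      by (intro conjI allI linearI) (auto simp: split_beta b g(1,2) algebra_simps)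
    show "(case u of (u1, u2) \<Rightarrow> \<lambda>(v1, v2). g1 u1 v1 + g2 u2 v2) v
        = (case v of (u1, u2) \<Rightarrow> \<lambda>(v1, v2). g1 u1 v1 + g2 u2 v2) u" for u v
      using g(3)[of "fst u" "fst v"] g(4)[of "snd u" "snd v"] by (simp add: split_beta)
    show "0 < (case u of (u1, u2) \<Rightarrow> \<lambda>(v1, v2). g1 u1 v1 + g2 u2 v2) u" if "u \<noteq> 0" for u
      using that nn g(5)[of "fst u"] g(6)[of "snd u"]
      by (cases u) (auto simp: zero_prod_def intro: add_pos_nonneg add_nonneg_pos)
  qed
qed

lemma inner_product_scale:
  assumes g: "inner_product g" and c: "0 < (c::real)"
  shows "inner_product (\<lambda>u v. c * g u v)"
proof -
  note b = inner_product_bilinear[OF g]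
  have "bilinear (\<lambda>u v. c * g u v)"
    unfolding bilinear_def
    by (intro conjI allI linearI)
      (simp_all add: bilinear_ladd[OF b] bilinear_radd[OF b] bilinear_lmul[OF b] bilinear_rmul[OF b] algebra_simps)
  then show ?thesis
    using g c by (auto simp: inner_product_def)
qed

lemma metric_field_on_product:
  assumes S: "open S1" "open S2" and G: "metric_field_on S1 G1" "metric_field_on S2 G2"
  shows "metric_field_on (S1 \<times> S2) (product_metric G1 G2)"
  unfolding metric_field_on_def
proof (intro conjI ballI allI)
  fix x assume "x \<in> S1 \<times> S2"
  then have "inner_product (\<lambda>(u1, u2) (v1, v2). G1 (fst x) u1 v1 + G2 (snd x) u2 v2)"
    using G by (intro inner_product_add) (auto simp: metric_field_on_def)
  then show "inner_product (product_metric G1 G2 x)"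
    by (simp add: product_metric_def split_beta)
next
  fix u v
  have "smooth_on (S1 \<times> S2) (\<lambda>x. G1 (fst x) (fst u) (fst v) + G2 (snd x) (snd u) (snd v))"
    using G S
    by (intro smooth_on_add open_Times
        smooth_on_linear_arg[OF bounded_linear_fst, of _ S1 "\<lambda>x. G1 x (fst u) (fst v)"]
        smooth_on_linear_arg[OF bounded_linear_snd, of _ S2 "\<lambda>x. G2 x (snd u) (snd v)"])
      (auto simp: metric_field_on_def)
  then show "smooth_on (S1 \<times> S2) (\<lambda>x. product_metric G1 G2 x u v)"
    by (simp add: product_metric_def split_beta)
qed

lemma metric_field_on_cone:
  assumes S: "open S" and G: "metric_field_on S G"
  shows "metric_field_on ({0<..} \<times> S) (cone_metric G)"
  unfolding metric_field_on_def
proof (intro conjI ballI allI)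
  fix x :: "real \<times> 'a" assume x: "x \<in> {0<..} \<times> S"
  have "inner_product (\<lambda>a b::real. a * b)"
    by (auto simp: inner_product_def bilinear_def intro!: linearI simp: algebra_simps zero_less_mult_iff)
  moreover have "inner_product (\<lambda>u v. (fst x)\<^sup>2 * G (snd x) u v)"
    using x G by (intro inner_product_scale) (auto simp: metric_field_on_def)
  ultimately have "inner_product (\<lambda>(a, u) (b, v). a * b + (fst x)\<^sup>2 * G (snd x) u v)"
    by (rule inner_product_add)
  then show "inner_product (cone_metric G x)"
    by (simp add: cone_metric_def split_beta)
next
  fix u v
  have o: "open ({0::real<..} \<times> S)" using S by (intro open_Times) auto
  have fst: "smooth_on ({0<..} \<times> S) (\<lambda>x. fst x :: real)"
    by (rule smooth_on_linear[OF bounded_linear_fst])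
  have "smooth_on ({0<..} \<times> S) (\<lambda>x. fst u * fst v + fst x * (fst x * G (snd x) (snd u) (snd v)))"
    using G
    by (intro smooth_on_add[OF o] smooth_on_const smooth_on_bilinear[OF bounded_bilinear_mult o] fst
        smooth_on_linear_arg[OF bounded_linear_snd _ o, of S "\<lambda>x. G x (snd u) (snd v)"])
      (auto simp: metric_field_on_def)
  then show "smooth_on ({0<..} \<times> S) (\<lambda>x. cone_metric G x u v)"
    by (simp add: cone_metric_def split_beta power2_eq_square mult.assoc)
qed

lemma chart_metric_product: "chart_metric (product_chart c d) = product_metric (chart_metric c) (chart_metric d)"
  by (simp add: product_chart_def product_metric_def)

lemma riemannian_chart_product:
  assumes c: "riemannian_chart X c" and d: "riemannian_chart Y d"
  shows "riemannian_chart (prod_topology X Y) (product_chart c d)"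
proof -
  have im: "chart_map (product_chart c d) ` chart_dom (product_chart c d)
      = (chart_map c ` chart_dom c) \<times> (chart_map d ` chart_dom d)"
    by (simp add: product_chart_def map_prod_surj_on[OF refl refl])
  have "homeomorphic_map (subtopology (prod_topology X Y) (chart_dom c \<times> chart_dom d))
     (top_of_set ((chart_map c ` chart_dom c) \<times> (chart_map d ` chart_dom d)))
     (map_prod (chart_map c) (chart_map d))"
    unfolding subtopology_Times top_of_set_Times[symmetric]
    using c d by (intro homeomorphic_map_prod) (auto simp: riemannian_chart_def)
  then show ?thesis
    using c d unfolding riemannian_chart_def im chart_metric_product
    by (auto simp: product_chart_def openin_prod_Times_iff open_Times metric_field_on_product)
qed

lemma chart_metric_cone: "chart_metric (cone_chart c) = cone_metric (chart_metric c)"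
  by (simp add: cone_chart_def cone_metric_def)

lemma chart_dom_cone: "chart_dom (cone_chart c) = {0<..} \<times> chart_dom c"
  by (simp add: cone_chart_def)

lemma chart_map_cone: "chart_map (cone_chart c) = map_prod id (chart_map c)"
  by (simp add: cone_chart_def map_prod_def)

lemma chart_image_cone:
  "chart_map (cone_chart c) ` chart_dom (cone_chart c) = {0<..} \<times> (chart_map c ` chart_dom c)"
  unfolding chart_map_cone chart_dom_cone by (rule map_prod_surj_on) auto

lemma riemannian_chart_cone:
  assumes c: "riemannian_chart X c"
  shows "riemannian_chart (prod_topology (top_of_set {0<..}) X) (cone_chart c)"
proof -
  have "homeomorphic_map (subtopology (prod_topology (top_of_set {0::real<..}) X) ({0<..} \<times> chart_dom c))
     (top_of_set ({0<..} \<times> (chart_map c ` chart_dom c))) (map_prod id (chart_map c))"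
    unfolding subtopology_Times top_of_set_Times[symmetric]
    using c by (intro homeomorphic_map_prod) (auto simp: riemannian_chart_def subtopology_subtopology)
  then show ?thesis
    using c unfolding riemannian_chart_def chart_image_cone chart_metric_cone
    by (auto simp: chart_map_cone chart_dom_cone openin_prod_Times_iff open_Times metric_field_on_cone)
qed

text \<open>The transition map is the identity in \<open>t\<close> times the transition map
  \<open>f\<close> of \<open>N\<close>, with block diagonal derivative; as \<open>t\<close> is
  preserved, so is the factor \<open>t\<^sup>2\<close>.\<close>

lemma smooth_isometric_cone:
  assumes c: "riemannian_chart X c" and d: "riemannian_chart X d" and iso: "smooth_isometric_in c d id"
  shows "smooth_isometric_in (cone_chart c) (cone_chart d) id"
proof -
  define S where "S = chart_map c ` (chart_dom c \<inter> chart_dom d)"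
  define f where "f = coord_expr c d id"
  have S': "chart_map c ` {p \<in> chart_dom c. id p \<in> chart_dom d} = S"
    by (auto simp: S_def)
  have "openin X (chart_dom c \<inter> chart_dom d)" using c d by (auto simp: riemannian_chart_def)
  then have S: "open S" unfolding S_def by (rule riemannian_chart_open_image[OF c]) blast
  then have o: "open ({0::real<..} \<times> S)" by (intro open_Times) auto
  have f: "smooth_on S f" and f': "\<And>x u v. x \<in> S \<Longrightarrow>
      chart_metric c x u v = chart_metric d (f x) (fderiv f x u) (fderiv f x v)"
    using iso unfolding smooth_isometric_in_def Let_def S' f_def by auto
  have cS: "chart_map (cone_chart c) ` {p \<in> chart_dom (cone_chart c). id p \<in> chart_dom (cone_chart d)} = {0<..} \<times> S"
  proof -
    have "{p \<in> chart_dom (cone_chart c). id p \<in> chart_dom (cone_chart d)}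
        = {0<..} \<times> (chart_dom c \<inter> chart_dom d)"
      by (auto simp: chart_dom_cone)
    then show ?thesis
      unfolding chart_map_cone S_def by (simp add: map_prod_surj_on)
  qed
  have cf: "coord_expr (cone_chart c) (cone_chart d) id (t, x) = (t, f x)" if tx: "(t, x) \<in> {0<..} \<times> S" for t x
  proof -
    obtain p where p: "p \<in> chart_dom c" "x = chart_map c p" using tx by (auto simp: S_def)
    have "coord_expr (cone_chart c) (cone_chart d) id (chart_map (cone_chart c) (t, p)) = chart_map (cone_chart d) (t, p)"
      using coord_expr_chart[OF riemannian_chart_cone[OF c], of "(t, p)" "cone_chart d" id] p tx
      by (simp add: chart_dom_cone)
    then show ?thesis
      using p coord_expr_chart[OF c p(1), of d id] by (simp add: chart_map_cone f_def)
  qed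
  have sm: "smooth_on ({0<..} \<times> S) (\<lambda>p. (fst p :: real, f (snd p)))"
    by (intro smooth_on_Pair[OF o] smooth_on_linear[OF bounded_linear_fst]
        smooth_on_linear_arg[OF bounded_linear_snd _ o f]) auto
  have eq: "(fst p, f (snd p)) = coord_expr (cone_chart c) (cone_chart d) id p" if "p \<in> {0<..} \<times> S" for p
    using cf[of "fst p" "snd p"] that by simp
  have der: "fderiv (coord_expr (cone_chart c) (cone_chart d) id) p v = (fst v, fderiv f (snd p) (snd v))"
    if p: "p \<in> {0<..} \<times> S" for p v
  proof (rule fderiv_eq, rule has_derivative_transform_within_open[OF _ o p eq])
    have "((\<lambda>p. f (snd p)) has_derivative (\<lambda>v. fderiv f (snd p) (snd v))) (at p)"
      using has_derivative_compose[OF bounded_linear_imp_has_derivative[OF bounded_linear_snd]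
          smooth_on_has_derivative[OF f]] p by auto
    then show "((\<lambda>p. (fst p, f (snd p))) has_derivative (\<lambda>v. (fst v, fderiv f (snd p) (snd v)))) (at p)"
      by (intro has_derivative_Pair bounded_linear_imp_has_derivative bounded_linear_fst)
  qed
  show ?thesis
    unfolding smooth_isometric_in_def Let_def cS chart_metric_cone
  proof (intro conjI ballI allI)
    show "smooth_on ({0<..} \<times> S) (coord_expr (cone_chart c) (cone_chart d) id)"
      by (rule smooth_on_cong[OF o eq sm])
    show "cone_metric (chart_metric c) p u v = cone_metric (chart_metric d)
        (coord_expr (cone_chart c) (cone_chart d) id p)
        (fderiv (coord_expr (cone_chart c) (cone_chart d) id) p u)
        (fderiv (coord_expr (cone_chart c) (cone_chart d) id) p v)"
      if p: "p \<in> {0<..} \<times> S" for p u v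
      unfolding der[OF p] eq[OF p, symmetric] using f'[of "snd p"] p
      by (simp add: cone_metric_def split_beta mem_Times_iff)
  qed
qed

lemma cone_manifold_simps [simp]:
  "man_top (cone_manifold N) = prod_topology (top_of_set {0<..}) (man_top N)"
  "man_atlas (cone_manifold N) = cone_chart ` man_atlas N"
  by (simp_all add: cone_manifold_def)

lemma riemannian_manifold_cone:
  fixes N :: "('n, 'e::euclidean_space) rmanifold"
  assumes N: "riemannian_manifold n N"
  shows "riemannian_manifold (Suc n) (cone_manifold N)"
proof -
  have "(\<Union>c\<in>man_atlas N. {0::real<..} \<times> chart_dom c) = {0<..} \<times> (\<Union>c\<in>man_atlas N. chart_dom c)"
    by auto
  moreover have "second_countable (prod_topology (top_of_set {0::real<..}) (man_top N))"
    using N by (intro second_countable_prod_topology second_countable_subtopology second_countable_euclidean)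
      (auto simp: riemannian_manifold_def)
  moreover have "Hausdorff_space (prod_topology (top_of_set {0::real<..}) (man_top N))"
    using N by (auto simp: riemannian_manifold_def Hausdorff_space_prod_topology Hausdorff_space_subtopology)
  moreover have "\<forall>c\<in>cone_chart ` man_atlas N. riemannian_chart (prod_topology (top_of_set {0<..}) (man_top N)) c"
    using riemannian_chart_cone[OF riemannian_manifold_chart[OF N]] by blast
  moreover have "smooth_isometric_in (cone_chart c) (cone_chart d) id"
    if "c \<in> man_atlas N" "d \<in> man_atlas N" for c d
    using N that by (intro smooth_isometric_cone[of "man_top N"]) (simp_all add: riemannian_manifold_def)
  then have "\<forall>c\<in>cone_chart ` man_atlas N. \<forall>d\<in>cone_chart ` man_atlas N. smooth_isometric_in c d id"
    by blast
  moreover have "(\<Union>c\<in>man_atlas N. chart_dom c) = topspace (man_top N)" "DIM('e) = n"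
    using N by (simp_all add: riemannian_manifold_def)
  ultimately show ?thesis
    unfolding riemannian_manifold_def cone_manifold_simps
    by (simp add: chart_dom_cone)
qed

lemma charts_at_cone: "0 < t \<Longrightarrow> charts_at (cone_manifold N) (t, P) = cone_chart ` charts_at N P"
  by (auto simp: charts_at_def chart_dom_cone)

subsection \<open>Curvature of surfaces\<close>

lemma real2_expand: "(u::real^2) = u$1 *\<^sub>R axis 1 1 + u$2 *\<^sub>R axis 2 1"
  by (simp add: vec_eq_iff forall_2 axis_def)

text \<open>Alternating bilinear forms on the plane are multiples of the determinant.\<close>

lemma alternating_real2:
  fixes h :: "real^2 \<Rightarrow> real^2 \<Rightarrow> real"
  assumes h: "bilinear h" and alt: "\<And>u. h u u = 0"
  shows "h u v = (u$1 * v$2 - u$2 * v$1) * h (axis 1 1) (axis 2 1)"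
proof -
  note b = bilinear_ladd[OF h] bilinear_radd[OF h] bilinear_lmul[OF h] bilinear_rmul[OF h]
  have "h (p + q) (p + q) = h p p + h q q + (h p q + h q p)" for p q
    by (simp add: b)
  then have sk: "h (axis 2 1) (axis 1 1) = - h (axis 1 1) (axis 2 1)"
    by (simp add: alt eq_neg_iff_add_eq_0 add.commute)
  have "h u v = h (u$1 *\<^sub>R axis 1 1 + u$2 *\<^sub>R axis 2 1) (v$1 *\<^sub>R axis 1 1 + v$2 *\<^sub>R axis 2 1)"
    by (metis real2_expand)
  then show ?thesis
    by (simp add: b alt sk algebra_simps)
qed

text \<open>Applied to the curvature and to \<open>gram\<close>, this makes the two tensors
  proportional on a surface.\<close>

lemma alternating_pairs_real2:
  fixes T :: "real^2 \<Rightarrow> real^2 \<Rightarrow> real^2 \<Rightarrow> real^2 \<Rightarrow> real"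
  assumes "\<And>w z. bilinear (\<lambda>u v. T u v w z)" "\<And>u v. bilinear (T u v)"
    and "\<And>u w z. T u u w z = 0" "\<And>u v w. T u v w w = 0"
  shows "T u v w z = (u$1 * v$2 - u$2 * v$1) * (w$1 * z$2 - w$2 * z$1)
    * T (axis 1 1) (axis 2 1) (axis 1 1) (axis 2 1)"
  using alternating_real2[of "\<lambda>u v. T u v w z" u v] alternating_real2[of "T (axis 1 1) (axis 2 1)" w z] assms
  by simp

text \<open>The curvature tensor of constant sectional curvature 1; \<open>gram g u v v u\<close> is
  the squared area of the parallelogram on \<open>u\<close> and \<open>v\<close>.\<close>

definition gram :: "('v \<Rightarrow> 'v \<Rightarrow> real) \<Rightarrow> 'v \<Rightarrow> 'v \<Rightarrow> 'v \<Rightarrow> 'v \<Rightarrow> real" where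
  "gram g u v w z = g v w * g u z - g u w * g v z"

text \<open>The equality case of Cauchy-Schwarz: up to the factor \<open>g u u\<close>, the Gram
  determinant is the squared length of the component of \<open>v\<close> orthogonal to
  \<open>u\<close>.\<close>

lemma gram_zero_imp_parallel:
  assumes g: "inner_product g" and u: "u \<noteq> 0" and 0: "gram g u v v u = 0"
  shows "v = (g u v / g u u) *\<^sub>R u"
proof (rule ccontr)
  note b = inner_product_bilinear[OF g]
  define r where "r = g u v / g u u"
  have p: "0 < g u u" and c: "g v u = g u v" using g u by (auto simp: inner_product_def)
  assume "v \<noteq> (g u v / g u u) *\<^sub>R u"
  then have "0 < g (v - r *\<^sub>R u) (v - r *\<^sub>R u)" using g by (auto simp: inner_product_def r_def)
  also have "\<dots> = g v v - r * g u v - r * (g u v - r * g u u)"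
    by (simp add: bilinear_lsub[OF b] bilinear_rsub[OF b] bilinear_lmul[OF b] bilinear_rmul[OF b] c algebra_simps)
  also have "r * g u u = g u v" using p by (simp add: r_def)
  finally have "r * g u v * g u u < g v v * g u u"
    using p by (simp add: mult_strict_right_mono)
  moreover have "r * g u v * g u u = g u v * g u v" using p by (simp add: r_def)
  ultimately show False using 0 by (simp add: gram_def c)
qed

lemma gram_axis_nonzero:
  fixes g :: "real^2 \<Rightarrow> real^2 \<Rightarrow> real"
  assumes "inner_product g"
  shows "gram g (axis 1 1) (axis 2 1) (axis 2 1) (axis 1 1) \<noteq> 0"
proof
  have n: "axis 1 1 \<noteq> (0::real^2)" by (simp add: axis_eq_0_iff)
  assume "gram g (axis 1 1) (axis 2 1) (axis 2 1) (axis 1 1) = 0"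
  from gram_zero_imp_parallel[OF assms n this]
  obtain r where "axis 2 1 = r *\<^sub>R (axis 1 1 :: real^2)" by blast
  then have "(axis 2 1 :: real^2) $ 2 = (r *\<^sub>R axis 1 1 :: real^2) $ 2" by simp
  then show False by (simp add: axis_def)
qed

lemma gram_alternating:
  assumes g: "inner_product g"
  shows "bilinear (\<lambda>u v. gram g u v w z)" "bilinear (gram g u v)" "gram g u u w z = 0" "gram g u v w w = 0"
proof -
  note b = inner_product_bilinear[OF g]
  note s = bilinear_ladd[OF b] bilinear_radd[OF b] bilinear_lmul[OF b] bilinear_rmul[OF b]
  show "bilinear (\<lambda>u v. gram g u v w z)" "bilinear (gram g u v)"
    unfolding bilinear_def gram_def by (intro conjI allI linearI; simp add: s algebra_simps)+
  show "gram g u u w z = 0" "gram g u v w w = 0" by (simp_all add: gram_def)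
qed

text \<open>The numbers \<open>inverse_metric g j k\<close> are the \<open>Basis\<close>
  coefficients of the vector dual to the \<open>j\<close>-th coordinate form, so the sums over
  \<open>k\<close> and \<open>l\<close> merge into the arguments of \<open>A\<close>.\<close>

lemma metric_trace:
  fixes A :: "'e::euclidean_space \<Rightarrow> 'e \<Rightarrow> 'e \<Rightarrow> 'e \<Rightarrow> real"
  assumes A: "\<And>i j. bilinear (A i j)"
  shows "(\<Sum>i\<in>Basis. \<Sum>j\<in>Basis. \<Sum>k\<in>Basis. \<Sum>l\<in>Basis. inverse_metric g j k * inverse_metric g i l * A i j k l)
    = (\<Sum>i\<in>Basis. \<Sum>j\<in>Basis. A i j (sharp g (\<lambda>w. w \<bullet> j)) (sharp g (\<lambda>w. w \<bullet> i)))"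
proof (intro sum.cong refl)
  fix i j :: 'e
  have l1: "linear (A i j k)" and l2: "linear (\<lambda>k. A i j k l)" for k l
    using A by (auto simp: bilinear_def)
  have "(\<Sum>k\<in>Basis. \<Sum>l\<in>Basis. inverse_metric g j k * inverse_metric g i l * A i j k l)
     = (\<Sum>k\<in>Basis. inverse_metric g j k * A i j k (sharp g (\<lambda>w. w \<bullet> i)))"
    using linear_expand[OF l1, of _ "sharp g (\<lambda>w. w \<bullet> i)"]
    by (simp add: inverse_metric_def sum_distrib_left mult.assoc)
  also have "\<dots> = A i j (sharp g (\<lambda>w. w \<bullet> j)) (sharp g (\<lambda>w. w \<bullet> i))"
    using linear_expand[OF l2, of "sharp g (\<lambda>w. w \<bullet> j)" "sharp g (\<lambda>w. w \<bullet> i)"]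
    by (simp add: inverse_metric_def)
  finally show "(\<Sum>k\<in>Basis. \<Sum>l\<in>Basis. inverse_metric g j k * inverse_metric g i l * A i j k l)
    = A i j (sharp g (\<lambda>w. w \<bullet> j)) (sharp g (\<lambda>w. w \<bullet> i))" .
qed

text \<open>The dual vectors satisfy
  \<open>g i (sharp g (\<lambda>w. w \<bullet> j)) = i \<bullet> j\<close>, so each ordered pair of
  distinct basis vectors contributes 1. In dimension 2 this is the normalisation 2 of the unit
  sphere.\<close>

lemma gram_trace:
  fixes g :: "'e::euclidean_space \<Rightarrow> 'e \<Rightarrow> real"
  assumes g: "inner_product g"
  shows "(\<Sum>i\<in>Basis. \<Sum>j\<in>Basis. gram g i j (sharp g (\<lambda>w. w \<bullet> j)) (sharp g (\<lambda>w. w \<bullet> i)))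
    = real DIM('e) * (real DIM('e) - 1)"
proof -
  have s: "g i (sharp g (\<lambda>w. w \<bullet> j)) = i \<bullet> j" for i j
  proof -
    have "g (sharp g (\<lambda>w. w \<bullet> j)) i = i \<bullet> j"
      by (rule inner_product_sharp[OF g]) (simp add: linear_iff inner_add_left)
    then show ?thesis using g by (metis inner_product_def)
  qed
  have "(\<Sum>i\<in>Basis. \<Sum>j\<in>Basis. gram g i j (sharp g (\<lambda>w. w \<bullet> j)) (sharp g (\<lambda>w. w \<bullet> i)))
     = (\<Sum>i\<in>(Basis::'e set). \<Sum>j\<in>Basis. 1 - (if i = j then 1 else 0))"
    by (intro sum.cong refl) (simp add: gram_def s inner_Basis)
  also have "\<dots> = real DIM('e) * (real DIM('e) - 1)"
    by (simp add: sum_subtractf)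
  finally show ?thesis .
qed

lemma riemann_tensor_4 [simp]: "riemann_tensor G x [a, b, c, d] = G x (riemann_op G x a b c) d"
  by (simp add: riemann_tensor_def eval_nat_numeral)

context metric_chart
begin

lemma riemann_bilinear:
  assumes x: "x \<in> S"
  shows "bilinear (\<lambda>u v. G x (riemann_op G x u v w) z)" "bilinear (\<lambda>w z. G x (riemann_op G x u v w) z)"
proof -
  note b = metric_bilinear[OF x]
  note l = riemann_linear[OF x]
  note s = linear_add[OF l(1)] linear_add[OF l(2)] linear_add[OF l(3)]
    linear_cmul[OF l(1)] linear_cmul[OF l(2)] linear_cmul[OF l(3)]
    bilinear_ladd[OF b] bilinear_radd[OF b] bilinear_lmul[OF b] bilinear_rmul[OF b]
  show "bilinear (\<lambda>u v. G x (riemann_op G x u v w) z)" "bilinear (\<lambda>w z. G x (riemann_op G x u v w) z)"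
    unfolding bilinear_def by (intro conjI allI linearI; simp add: s)+
qed

lemma riemann_smooth: "smooth_on S (\<lambda>x. riemann_op G x u v w)"
proof -
  have 1: "smooth_on S (\<lambda>x. fderiv (\<lambda>y. christoffel G y v w) x u)" for u v
    by (rule smooth_on_fderiv[OF christoffel_smooth])
  have 2: "smooth_on S (\<lambda>x. christoffel G x u (christoffel G x v w))" for u v
    unfolding smooth_on_def
  proof
    fix n show "differentiable_upto n S (\<lambda>x. christoffel G x u (christoffel G x v w))"
      by (rule linear_family_differentiable_upto[OF open_S])
        (use christoffel_bilinear christoffel_smooth in \<open>auto simp: bilinear_def smooth_on_def\<close>)
  qed
  have m: "smooth_on S (\<lambda>x. - f x)" if "smooth_on S f" for f :: "'e \<Rightarrow> 'e"
    by (rule smooth_on_compose_linear[OF bounded_linear_minus[OF bounded_linear_ident] open_S that])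
  have "smooth_on S (\<lambda>x. fderiv (\<lambda>y. christoffel G y v w) x u + (- fderiv (\<lambda>y. christoffel G y u w) x v)
      + christoffel G x u (christoffel G x v w) + (- christoffel G x v (christoffel G x u w)))"
    by (intro smooth_on_add[OF open_S] m 1 2)
  then show ?thesis by (simp add: riemann_op_def)
qed

end

locale surface_chart = metric_chart S G for S :: "(real^2) set" and G
begin

text \<open>Curvature and \<open>gram\<close> are proportional at \<open>x\<close>; tracing both
  sides identifies the factor, the Gauss curvature, as half the scalar curvature.\<close>

lemma riemann_surface:
  assumes x: "x \<in> S"
  shows "G x (riemann_op G x u v w) z = scalar_curvature_in G x / 2 * gram (G x) u v w z"
proof -
  define T where "T u v w z = G x (riemann_op G x u v w) z" for u v w z
  note b = metric_bilinear[OF x]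
  note g = inner_product[OF x]
  have T: "T u v w z = (u$1 * v$2 - u$2 * v$1) * (w$1 * z$2 - w$2 * z$1)
      * T (axis 1 1) (axis 2 1) (axis 1 1) (axis 2 1)" for u v w z
  proof (rule alternating_pairs_real2)
    have "riemann_op G x u u w = 0" for u w by (simp add: riemann_op_def)
    then show "T u u w z = 0" for u w z by (simp add: T_def bilinear_lzero[OF b])
  qed (simp_all add: T_def riemann_bilinear[OF x] riemann_last_pair_zero[OF x])
  have Q: "gram (G x) u v w z = (u$1 * v$2 - u$2 * v$1) * (w$1 * z$2 - w$2 * z$1)
      * gram (G x) (axis 1 1) (axis 2 1) (axis 1 1) (axis 2 1)" for u v w z
    by (rule alternating_pairs_real2) (rule gram_alternating[OF g])+
  define k where "k = T (axis 1 1) (axis 2 1) (axis 1 1) (axis 2 1) / gram (G x) (axis 1 1) (axis 2 1) (axis 1 1) (axis 2 1)"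
  \<comment> \<open>This arrangement of the arguments gives the negative of the squared area treated
    in \<open>gram_axis_nonzero\<close>.\<close>
  have "gram (G x) (axis 1 1) (axis 2 1) (axis 1 1) (axis 2 1) \<noteq> 0"
    using gram_axis_nonzero[OF g]
    by (simp add: gram_def mult.commute[of "G x (axis 1 1) (axis 1 1)"] mult.commute[of "G x (axis 2 1) (axis 1 1)"])
  then have k: "T u v w z = k * gram (G x) u v w z" for u v w z
    unfolding T[of u v w z] Q[of u v w z] by (simp add: k_def)
  have "scalar_curvature_in G x = (\<Sum>i\<in>Basis. \<Sum>j\<in>Basis. T i j (sharp (G x) (\<lambda>w. w \<bullet> j)) (sharp (G x) (\<lambda>w. w \<bullet> i)))"
    unfolding scalar_curvature_in_def riemann_tensor_4 T_def
    by (rule metric_trace) (rule riemann_bilinear(2)[OF x])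
  also have "\<dots> = k * (\<Sum>i\<in>Basis. \<Sum>j\<in>Basis. gram (G x) i j (sharp (G x) (\<lambda>w. w \<bullet> j)) (sharp (G x) (\<lambda>w. w \<bullet> i)))"
    by (simp add: k sum_distrib_left)
  also have "\<dots> = 2 * k" by (simp add: gram_trace[OF g])
  finally show ?thesis using k by (simp add: T_def)
qed

text \<open>By \<open>riemann_surface\<close> the scalar curvature is twice the quotient of one
  curvature component by a Gram determinant, so the inverse metric need not be differentiated. This
  makes \<open>scalar_curvature_in G x \<noteq> 2\<close> an open condition.\<close>

lemma scalar_curvature_continuous: "continuous_on S (scalar_curvature_in G)"
proof -
  define a where "a = (axis 1 1 :: real^2)"
  define b where "b = (axis 2 1 :: real^2)"
  have n: "gram (G x) a b b a \<noteq> 0" if "x \<in> S" for x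
    unfolding a_def b_def by (rule gram_axis_nonzero[OF inner_product[OF that]])
  have "differentiable_upto 0 S (\<lambda>x. G x (riemann_op G x a b b) a)"
    by (rule linear_family_differentiable_upto[where T = "\<lambda>x u. G x u a", OF open_S])
      (use metric_bilinear metric_smooth riemann_smooth in \<open>auto simp: bilinear_def smooth_on_def simp del: differentiable_upto.simps\<close>)
  then have 1: "continuous_on S (\<lambda>x. G x (riemann_op G x a b b) a)" by simp
  have 2: "continuous_on S (\<lambda>x. gram (G x) a b b a)"
    unfolding gram_def by (intro continuous_intros smooth_on_continuous[OF metric_smooth])
  have "continuous_on S (\<lambda>x. 2 * (G x (riemann_op G x a b b) a / gram (G x) a b b a))"
    using n by (intro continuous_intros 1 2) auto
  then show ?thesis
    by (rule continuous_on_eq) (simp add: riemann_surface n)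
qed

end

lemma (in isometric_coords) gram_natural:
  "x \<in> S \<Longrightarrow> gram (G x) u v w z = gram (G' (f x)) (fderiv f x u) (fderiv f x v) (fderiv f x w) (fderiv f x z)"
  by (simp add: gram_def isometric)

text \<open>The curvature component and the Gram determinant are both natural, hence so is their
  quotient.\<close>

lemma scalar_curvature_natural:
  fixes f :: "real^2 \<Rightarrow> real^2"
  assumes f: "isometric_coords S G S' G' f" and x: "x \<in> S"
  shows "scalar_curvature_in G' (f x) = scalar_curvature_in G x"
proof -
  interpret isometric_coords S G S' G' f by (rule f)
  interpret D: surface_chart S G by unfold_locales
  interpret C: surface_chart S' G' by unfold_locales
  define a where "a = (axis 1 1 :: real^2)"
  define b where "b = (axis 2 1 :: real^2)"
  have n: "gram (G x) a b b a \<noteq> 0"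
    unfolding a_def b_def by (rule gram_axis_nonzero[OF dom.inner_product[OF x]])
  have "G x (riemann_op G x a b b) a = scalar_curvature_in G' (f x) / 2 * gram (G x) a b b a"
    using riemann_tensor_natural[OF x, of a b b a] C.riemann_surface[OF f_in[OF x]] gram_natural[OF x, of a b b a]
    by simp
  then show ?thesis using D.riemann_surface[OF x, of a b b a] n by simp
qed

text \<open>The transition map to the chart selected by \<open>SOME\<close> is isometric, which
  makes the selection immaterial.\<close>

lemma scalar_curvature_chart:
  fixes N :: "('n, real^2) rmanifold"
  assumes N: "riemannian_manifold 2 N" and c: "c \<in> charts_at N P"
  shows "scalar_curvature_in (chart_metric c) (chart_map c P) = scalar_curvature N P"
proof -
  define d where "d = (SOME c. c \<in> charts_at N P)"
  have d: "d \<in> charts_at N P" unfolding d_def using c by (rule someI)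
  have "isometric_coords (chart_map d ` {p \<in> chart_dom d. id p \<in> chart_dom c}) (chart_metric d)
      (chart_map c ` chart_dom c) (chart_metric c) (coord_expr d c id)"
    using c d by (intro isometric_coords_transition[OF N]) (auto simp: charts_at_def)
  from scalar_curvature_natural[OF this, of "chart_map d P"] c d
  have "scalar_curvature_in (chart_metric c) (coord_expr d c id (chart_map d P))
      = scalar_curvature_in (chart_metric d) (chart_map d P)"
    by (auto simp: charts_at_def)
  moreover have "coord_expr d c id (chart_map d P) = chart_map c P"
    using coord_expr_chart[OF riemannian_manifold_chart[OF N], of d P c id] d by (simp add: charts_at_def)
  ultimately show ?thesis by (simp add: scalar_curvature_def d_def Let_def)
qed


subsection \<open>Curvature of cones and products\<close>

lemma has_derivative_factors:
  assumes "f differentiable at x"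
  shows "((\<lambda>p. f (fst p)) has_derivative (\<lambda>u. fderiv f x (fst u))) (at (x, y))"
    "((\<lambda>p. f (snd p)) has_derivative (\<lambda>u. fderiv f x (snd u))) (at (y, x))"
  using has_derivative_compose[OF bounded_linear_imp_has_derivative[OF bounded_linear_fst], where x = "(x, y)" and g = f]
    has_derivative_compose[OF bounded_linear_imp_has_derivative[OF bounded_linear_snd], where x = "(y, x)" and g = f]
    assms by (auto simp: frechet_derivative_works)

context metric_chart
begin

lemma cone_open: "open ({0::real<..} \<times> S)"
  using open_S by (intro open_Times) auto

lemma metric_chart_cone: "metric_chart ({0<..} \<times> S) (cone_metric G)"
  using cone_open metric_field_on_cone[OF open_S metric_field] by unfold_locales

lemma fderiv_cone_metric:
  assumes t: "0 < t" and x: "x \<in> S"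
  shows "fderiv (\<lambda>y. cone_metric G y (b, v) (c, w)) (t, x) (a, u)
    = 2 * t * a * G x v w + t\<^sup>2 * fderiv (\<lambda>y. G y v w) x u"
proof -
  have 1: "((\<lambda>p. G (snd p) v w) has_derivative (\<lambda>h. fderiv (\<lambda>y. G y v w) x (snd h))) (at (t, x))"
    by (rule has_derivative_factors(2)[OF metric_differentiable[OF x]])
  have 2: "(fst has_derivative fst) (at (t, x))"
    by (rule bounded_linear_imp_has_derivative[OF bounded_linear_fst])
  have "((\<lambda>p. b * c + fst p * fst p * G (snd p) v w) has_derivative
      (\<lambda>h. 0 + (t * t * fderiv (\<lambda>y. G y v w) x (snd h) + (t * fst h + fst h * t) * G x v w))) (at (t, x))"
    using has_derivative_add[OF has_derivative_const[of "b * c"] has_derivative_mult[OF has_derivative_mult[OF 2 2] 1]]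
    by simp
  then have "((\<lambda>y. cone_metric G y (b, v) (c, w)) has_derivative
      (\<lambda>h. 0 + (t * t * fderiv (\<lambda>y. G y v w) x (snd h) + (t * fst h + fst h * t) * G x v w))) (at (t, x))"
    by (simp add: cone_metric_def split_beta power2_eq_square)
  from fderiv_eq[OF this] show ?thesis by (simp add: power2_eq_square algebra_simps)
qed

text \<open>The proposed vector is verified against the Koszul formula. Its radial part
  \<open>- t * G x u v\<close> expresses the bending of the slices of constant \<open>t\<close>, and
  the factor \<open>1 / t\<close> is the growth rate of their lengths.\<close>

lemma christoffel_cone:
  assumes t: "0 < t" and x: "x \<in> S"
  shows "christoffel (cone_metric G) (t, x) (a, u) (b, v)
    = (- t * G x u v, (1 / t) *\<^sub>R (a *\<^sub>R v + b *\<^sub>R u) + christoffel G x u v)"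
proof (rule metric_chart.christoffel_eqI[OF metric_chart_cone])
  show "(t, x) \<in> {0<..} \<times> S" using assms by simp
  note b = metric_bilinear[OF x]
  fix cw :: "real \<times> 'e"
  obtain c w where cw: "cw = (c, w)" by fastforce
  show "cone_metric G (t, x) (- t * G x u v, (1 / t) *\<^sub>R (a *\<^sub>R v + b *\<^sub>R u) + christoffel G x u v) cw
    = (fderiv (\<lambda>y. cone_metric G y (b, v) cw) (t, x) (a, u) + fderiv (\<lambda>y. cone_metric G y (a, u) cw) (t, x) (b, v)
       - fderiv (\<lambda>y. cone_metric G y (a, u) (b, v)) (t, x) cw) / 2"
    unfolding cw fderiv_cone_metric[OF t x] cone_metric_apply
    using t
    by (simp add: bilinear_ladd[OF b] bilinear_lmul[OF b] metric_christoffel[OF x] power2_eq_square field_simps)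
qed

text \<open>The Gauss equation for the slices: the products of a Christoffel factor \<open>t\<close>
  with a factor \<open>1 / t\<close> contribute minus the curvature of the unit sphere, and every
  term with a radial argument cancels.\<close>

lemma riemann_cone:
  assumes t: "0 < t" and x: "x \<in> S"
  shows "riemann_op (cone_metric G) (t, x) (a, u) (b, v) (c, w)
    = (0, riemann_op G x u v w - (G x v w *\<^sub>R u - G x u w *\<^sub>R v))"
proof -
  have tx: "(t, x) \<in> {0<..} \<times> S" using assms by simp
  have d: "fderiv (\<lambda>y. christoffel (cone_metric G) y (b, v) (c, w)) (t, x) (a, u)
     = (- a * G x v w - t * fderiv (\<lambda>y. G y v w) x u,
        - (a / t\<^sup>2) *\<^sub>R (b *\<^sub>R w + c *\<^sub>R v) + fderiv (\<lambda>y. christoffel G y v w) x u)" for a u b v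
  proof -
    have 1: "((\<lambda>p. G (snd p) v w) has_derivative (\<lambda>h. fderiv (\<lambda>y. G y v w) x (snd h))) (at (t, x))"
    by (rule has_derivative_factors(2)[OF metric_differentiable[OF x]])
    have 2: "((\<lambda>p. christoffel G (snd p) v w) has_derivative (\<lambda>h. fderiv (\<lambda>y. christoffel G y v w) x (snd h))) (at (t, x))"
    by (rule has_derivative_factors(2)[OF christoffel_differentiable[OF x]])
    have 3: "(fst has_derivative fst) (at (t, x))"
      by (rule bounded_linear_imp_has_derivative[OF bounded_linear_fst])
    have 4: "((\<lambda>p. 1 / fst p) has_derivative (\<lambda>h. - (fst h / t\<^sup>2))) (at (t, x))"
      using t by (auto intro!: derivative_eq_intros 3 simp: power2_eq_square field_simps)
    have "((\<lambda>p. (- (fst p * G (snd p) v w), (1 / fst p) *\<^sub>R (b *\<^sub>R w + c *\<^sub>R v) + christoffel G (snd p) v w)) has_derivative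
      (\<lambda>h. (- (t * fderiv (\<lambda>y. G y v w) x (snd h) + fst h * G x v w),
        (- (fst h / t\<^sup>2)) *\<^sub>R (b *\<^sub>R w + c *\<^sub>R v) + fderiv (\<lambda>y. christoffel G y v w) x (snd h)))) (at (t, x))"
      using has_derivative_Pair[OF has_derivative_minus[OF has_derivative_mult[OF 3 1]]
          has_derivative_add[OF has_derivative_scaleR_left[OF 4] 2]] by simp
    then have "((\<lambda>y. christoffel (cone_metric G) y (b, v) (c, w)) has_derivative
      (\<lambda>h. (- (t * fderiv (\<lambda>y. G y v w) x (snd h) + fst h * G x v w),
        (- (fst h / t\<^sup>2)) *\<^sub>R (b *\<^sub>R w + c *\<^sub>R v) + fderiv (\<lambda>y. christoffel G y v w) x (snd h)))) (at (t, x))"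
      by (rule has_derivative_transform_within_open[OF _ cone_open tx]) (auto simp: christoffel_cone)
    from fderiv_eq[OF this] show ?thesis by (simp add: algebra_simps)
  qed
  note g = metric_bilinear[OF x]
  note C = christoffel_bilinear[OF x]
  note s = bilinear_radd[OF g] bilinear_rmul[OF g] bilinear_radd[OF C] bilinear_rmul[OF C]
  have sym: "christoffel G x v u = christoffel G x u v" "G x v u = G x u v"
    by (rule christoffel_commute[OF x], rule metric_commute[OF x])
  \<comment> \<open>Both sides equal \<open>- G x (christoffel G x u v) w\<close>, which is
    symmetric in \<open>u\<close> and \<open>v\<close>; this removes the radial component of the
    curvature.\<close>
  have "G x v (christoffel G x u w) - fderiv (\<lambda>y. G y v w) x u
      = G x u (christoffel G x v w) - fderiv (\<lambda>y. G y u w) x v"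
    by (simp add: metric_compatible[OF x] sym(1))
  then have "t * G x v (christoffel G x u w) - t * fderiv (\<lambda>y. G y v w) x u
      = t * G x u (christoffel G x v w) - t * fderiv (\<lambda>y. G y u w) x v"
    by (metis right_diff_distrib)
  then show ?thesis
    unfolding riemann_op_def d christoffel_cone[OF t x] using t sym
    by (simp add: s algebra_simps power2_eq_square)
qed

end

context surface_chart
begin

lemma riemann_cone_surface:
  assumes t: "0 < t" and x: "x \<in> S"
  shows "cone_metric G (t, x) (riemann_op (cone_metric G) (t, x) (a, u) (b, v) (c, w)) (d, z)
    = t\<^sup>2 * (scalar_curvature_in G x / 2 - 1) * gram (G x) u v w z"
proof -
  note b = metric_bilinear[OF x]
  show ?thesis
    unfolding riemann_cone[OF t x] cone_metric_apply bilinear_lsub[OF b] bilinear_lmul[OF b] riemann_surface[OF x]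
    by (simp add: gram_def algebra_simps)
qed

end

lemma sum_Basis_prod:
  fixes h :: "'a::euclidean_space \<times> 'b::euclidean_space \<Rightarrow> 'c::comm_monoid_add"
  shows "sum h Basis = (\<Sum>i\<in>Basis. h (i, 0)) + (\<Sum>i\<in>Basis. h (0, i))"
proof -
  have "inj_on (\<lambda>u. (u::'a, 0::'b)) Basis" "inj_on (\<lambda>u. (0::'a, u::'b)) Basis"
    by (auto intro!: inj_onI Pair_inject)
  then show ?thesis
    unfolding Basis_prod_def
    by (subst sum.union_disjoint) (auto simp: Basis_prod_def sum.reindex)
qed

text \<open>Radial basis vectors contribute nothing. Each of the two tangential dual vectors carries
  a factor \<open>1 / t\<^sup>2\<close>, against one factor \<open>t\<^sup>2\<close> in the
  curvature with lowered index.\<close>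

lemma (in surface_chart) scalar_curvature_cone:
  assumes t: "0 < t" and x: "x \<in> S"
  shows "scalar_curvature_in (cone_metric G) (t, x) = (scalar_curvature_in G x - 2) / t\<^sup>2"
proof -
  interpret cone: metric_chart "{0<..} \<times> S" "cone_metric G" by (rule metric_chart_cone)
  have tx: "(t, x) \<in> {0<..} \<times> S" using assms by simp
  define k where "k = t\<^sup>2 * (scalar_curvature_in G x / 2 - 1)"
  define A where "A i j k l = cone_metric G (t, x) (riemann_op (cone_metric G) (t, x) i j k) l" for i j k l
  have A: "A i j p q = k * gram (G x) (snd i) (snd j) (snd p) (snd q)" for i j p q
    using riemann_cone_surface[OF t x, of "fst i" "snd i" "fst j" "snd j" "fst p" "snd p" "fst q" "snd q"]
    by (simp add: A_def k_def)
  define sh where "sh j = sharp (cone_metric G (t, x)) (\<lambda>w. w \<bullet> j)" for j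
  define s where "s j = sharp (G x) (\<lambda>w. w \<bullet> j)" for j
  note g = inner_product[OF x]
  note b = metric_bilinear[OF x]
  have l: "linear (\<lambda>w. w \<bullet> j)" for j :: "real^2" by (simp add: linear_iff inner_add_left)
  have sh1: "snd (sh (1, 0)) = 0"
  proof -
    have "sh (1, 0) = (1, 0)" unfolding sh_def
      by (rule sharp_eqI[OF cone.inner_product[OF tx]]) (auto simp: cone_metric_def bilinear_lzero[OF b])
    then show ?thesis by simp
  qed
  have sh2: "snd (sh (0, j)) = (1 / t\<^sup>2) *\<^sub>R s j" for j
  proof -
    have "sh (0, j) = (0, (1 / t\<^sup>2) *\<^sub>R s j)" unfolding sh_def s_def using t
      by (intro sharp_eqI[OF cone.inner_product[OF tx]])
        (auto simp: cone_metric_def bilinear_lmul[OF b] inner_product_sharp[OF g l])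
    then show ?thesis by simp
  qed
  have "scalar_curvature_in (cone_metric G) (t, x) = (\<Sum>i\<in>Basis. \<Sum>j\<in>Basis. A i j (sh j) (sh i))"
    unfolding scalar_curvature_in_def riemann_tensor_4 A_def sh_def
    by (rule metric_trace) (rule cone.riemann_bilinear(2)[OF tx])
  also have "\<dots> = (\<Sum>i\<in>Basis. \<Sum>j\<in>Basis. k * (1 / t\<^sup>2) * (1 / t\<^sup>2) * gram (G x) i j (s j) (s i))"
    by (simp add: sum_Basis_prod A sh1 sh2 gram_def bilinear_lzero[OF b] bilinear_rzero[OF b] bilinear_rmul[OF b]
        algebra_simps)
  also have "\<dots> = k * (1 / t\<^sup>2) * (1 / t\<^sup>2) * 2"
    unfolding sum_distrib_left[symmetric] s_def gram_trace[OF g] by simp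
  also have "\<dots> = (scalar_curvature_in G x - 2) / t\<^sup>2"
    using t by (simp add: k_def field_simps)
  finally show ?thesis .
qed

section \<open>Riemannian products in coordinates\<close>

locale product_coords = A: metric_chart S1 G1 + B: metric_chart S2 G2
  for S1 :: "'a::euclidean_space set" and G1 and S2 :: "'b::euclidean_space set" and G2
begin

lemma product_open: "open (S1 \<times> S2)"
  using A.open_S B.open_S by (rule open_Times)

sublocale metric_chart "S1 \<times> S2" "product_metric G1 G2"
  using product_open metric_field_on_product[OF A.open_S B.open_S A.metric_field B.metric_field] by unfold_locales

lemma fderiv_product_metric:
  assumes x: "x \<in> S1" and y: "y \<in> S2"
  shows "fderiv (\<lambda>p. product_metric G1 G2 p (v1, v2) (w1, w2)) (x, y) (u1, u2)
    = fderiv (\<lambda>x. G1 x v1 w1) x u1 + fderiv (\<lambda>y. G2 y v2 w2) y u2"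
proof -
  have "((\<lambda>p. G1 (fst p) v1 w1 + G2 (snd p) v2 w2) has_derivative
      (\<lambda>u. fderiv (\<lambda>x. G1 x v1 w1) x (fst u) + fderiv (\<lambda>y. G2 y v2 w2) y (snd u))) (at (x, y))"
    by (intro has_derivative_add has_derivative_factors A.metric_differentiable[OF x] B.metric_differentiable[OF y])
  then have "((\<lambda>p. product_metric G1 G2 p (v1, v2) (w1, w2)) has_derivative
      (\<lambda>u. fderiv (\<lambda>x. G1 x v1 w1) x (fst u) + fderiv (\<lambda>y. G2 y v2 w2) y (snd u))) (at (x, y))"
    by (simp add: product_metric_def split_beta)
  from fderiv_eq[OF this] show ?thesis by simp
qed

lemma christoffel_product:
  assumes x: "x \<in> S1" and y: "y \<in> S2"
  shows "christoffel (product_metric G1 G2) (x, y) (u1, u2) (v1, v2) = (christoffel G1 x u1 v1, christoffel G2 y u2 v2)"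
proof (rule christoffel_eqI)
  show "(x, y) \<in> S1 \<times> S2" using assms by simp
  fix w :: "'a \<times> 'b"
  obtain w1 w2 where w: "w = (w1, w2)" by fastforce
  show "product_metric G1 G2 (x, y) (christoffel G1 x u1 v1, christoffel G2 y u2 v2) w
    = (fderiv (\<lambda>p. product_metric G1 G2 p (v1, v2) w) (x, y) (u1, u2)
       + fderiv (\<lambda>p. product_metric G1 G2 p (u1, u2) w) (x, y) (v1, v2)
       - fderiv (\<lambda>p. product_metric G1 G2 p (u1, u2) (v1, v2)) (x, y) w) / 2"
    unfolding w fderiv_product_metric[OF x y] product_metric_apply A.metric_christoffel[OF x] B.metric_christoffel[OF y]
    by (simp add: field_simps)
qed

lemma riemann_product:
  assumes x: "x \<in> S1" and y: "y \<in> S2"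
  shows "riemann_op (product_metric G1 G2) (x, y) (u1, u2) (v1, v2) (w1, w2)
    = (riemann_op G1 x u1 v1 w1, riemann_op G2 y u2 v2 w2)"
proof -
  have "fderiv (\<lambda>p. christoffel (product_metric G1 G2) p (v1, v2) (w1, w2)) (x, y) (u1, u2)
     = (fderiv (\<lambda>x. christoffel G1 x v1 w1) x u1, fderiv (\<lambda>y. christoffel G2 y v2 w2) y u2)" for u1 u2 v1 v2
  proof -
    have "((\<lambda>p. (christoffel G1 (fst p) v1 w1, christoffel G2 (snd p) v2 w2)) has_derivative
      (\<lambda>u. (fderiv (\<lambda>x. christoffel G1 x v1 w1) x (fst u), fderiv (\<lambda>y. christoffel G2 y v2 w2) y (snd u)))) (at (x, y))"
      by (intro has_derivative_Pair
          has_derivative_factors A.christoffel_differentiable[OF x] B.christoffel_differentiable[OF y])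
    then have "((\<lambda>p. christoffel (product_metric G1 G2) p (v1, v2) (w1, w2)) has_derivative
      (\<lambda>u. (fderiv (\<lambda>x. christoffel G1 x v1 w1) x (fst u), fderiv (\<lambda>y. christoffel G2 y v2 w2) y (snd u)))) (at (x, y))"
      by (rule has_derivative_transform_within_open[OF _ product_open]) (use assms christoffel_product in auto)
    from fderiv_eq[OF this] show ?thesis by simp
  qed
  then show ?thesis
    unfolding riemann_op_def christoffel_product[OF x y] by simp
qed

end

subsection \<open>Orthonormal bases of an inner product\<close>

context
  fixes g :: "'v::euclidean_space \<Rightarrow> 'v \<Rightarrow> real"
  assumes g: "inner_product g"
begin

private lemmas b = inner_product_bilinear[OF g]

lemma inner_product_commute: "g u v = g v u"
  using g by (simp add: inner_product_def)

lemma inner_product_sum_left: "g (\<Sum>i\<in>I. c i *\<^sub>R v i) w = (\<Sum>i\<in>I. c i * g (v i) w)"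
proof -
  have "linear (\<lambda>u. g u w)" using b by (simp add: bilinear_def)
  from linear_sum[OF this, of "\<lambda>i. c i *\<^sub>R v i" I] show ?thesis by (simp add: bilinear_lmul[OF b])
qed

lemma orthonormal_sum:
  assumes "finite B" "\<And>u v. u \<in> B \<Longrightarrow> v \<in> B \<Longrightarrow> g u v = (if u = v then 1 else 0)" "w \<in> B"
  shows "g (\<Sum>v\<in>B. c v *\<^sub>R v) w = c w"
proof -
  have "g (\<Sum>v\<in>B. c v *\<^sub>R v) w = (\<Sum>v\<in>B. if v = w then c v else 0)"
    unfolding inner_product_sum_left using assms(2,3) by (intro sum.cong refl) simp
  then show ?thesis using assms(1,3) by simp
qed

lemma orthonormal_independent:
  assumes "finite B" "\<And>u v. u \<in> B \<Longrightarrow> v \<in> B \<Longrightarrow> g u v = (if u = v then 1 else 0)"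
  shows "independent B"
proof (rule independent_if_scalars_zero[OF assms(1)])
  fix c w assume 0: "(\<Sum>v\<in>B. c v *\<^sub>R v) = 0" and w: "w \<in> B"
  show "c w = 0"
    using orthonormal_sum[OF assms w, of c] bilinear_lzero[OF b] by (simp add: 0)
qed

lemma orthonormal_residual:
  assumes "finite B" "\<And>u v. u \<in> B \<Longrightarrow> v \<in> B \<Longrightarrow> g u v = (if u = v then 1 else 0)" "v \<in> span B"
  shows "g (w - (\<Sum>v\<in>B. g w v *\<^sub>R v)) v = 0"
proof -
  have "linear (g (w - (\<Sum>v\<in>B. g w v *\<^sub>R v)))" using b by (simp add: bilinear_def)
  moreover have "g (w - (\<Sum>v\<in>B. g w v *\<^sub>R v)) v = 0" if "v \<in> B" for v
    using orthonormal_sum[OF assms(1,2) that, of "g w"] by (simp add: bilinear_lsub[OF b])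
  ultimately show ?thesis using assms(3) linear_eq_0_on_span by blast
qed

text \<open>An orthonormal subset of largest size spans \<open>V\<close>, since otherwise a
  normalised residual would enlarge it. Existence gives meaning to the choice of a basis in
  \<open>higher_jacobi\<close>.\<close>

lemma orthonormal_basis_exists:
  assumes V: "subspace V"
  shows "\<exists>B. orthonormal_basis g V B"
proof -
  define P where "P B \<longleftrightarrow> finite B \<and> B \<subseteq> V \<and> (\<forall>u\<in>B. \<forall>v\<in>B. g u v = (if u = v then 1 else 0))" for B
  have bound: "card B < Suc DIM('v)" if "P B" for B
    using independent_bound[OF orthonormal_independent[of B]] that by (auto simp: P_def)
  have "P {}" by (simp add: P_def)
  from ex_has_greatest_nat[of P, OF this] bound
  obtain B where B: "P B" and max: "\<And>C. P C \<Longrightarrow> card C \<le> card B" by blast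
  have fin: "finite B" and sub: "B \<subseteq> V" and on: "\<And>u v. u \<in> B \<Longrightarrow> v \<in> B \<Longrightarrow> g u v = (if u = v then 1 else 0)"
    using B by (auto simp: P_def)
  have "V \<subseteq> span B"
  proof
    fix w assume w: "w \<in> V"
    show "w \<in> span B"
    proof (rule ccontr)
      assume n: "w \<notin> span B"
      define r where "r = w - (\<Sum>v\<in>B. g w v *\<^sub>R v)"
      define e where "e = (1 / sqrt (g r r)) *\<^sub>R r"
      have s: "(\<Sum>v\<in>B. g w v *\<^sub>R v) \<in> span B"
        by (intro span_sum span_scale span_base)
      then have "r \<noteq> 0" using n by (auto simp: r_def)
      then have p: "0 < g r r" using g by (simp add: inner_product_def)
      have "span B \<subseteq> V" using sub V by (rule span_minimal)
      then have eV: "e \<in> V" unfolding e_def r_def using s w V by (auto intro: subspace_scale subspace_diff)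
      have ee: "g e e = 1"
        using p by (simp add: e_def bilinear_lmul[OF b] bilinear_rmul[OF b] divide_simps flip: power2_eq_square)
      have eB: "g e v = 0" "g v e = 0" if "v \<in> B" for v
        using orthonormal_residual[OF fin on span_base[OF that], of w] inner_product_commute[of v]
        by (simp_all add: e_def bilinear_lmul[OF b] r_def)
      have "e \<notin> B" using eB(1) ee by fastforce
      then have "P (insert e B)" using B eV ee eB by (auto simp: P_def)
      from max[OF this] show False using \<open>e \<notin> B\<close> fin by simp
    qed
  qed
  then have "span B = V" using span_minimal[OF sub V] by blast
  then show ?thesis using fin on by (auto simp: orthonormal_basis_def)
qed

lemma orthonormal_basis_expand:
  assumes B: "orthonormal_basis g V B" and w: "w \<in> V"
  shows "(\<Sum>v\<in>B. g w v *\<^sub>R v) = w"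
proof -
  have "(\<Sum>v\<in>B. g w v *\<^sub>R v) \<in> span B" by (intro span_sum span_scale span_base)
  then have "w - (\<Sum>v\<in>B. g w v *\<^sub>R v) \<in> span B"
    using B w by (auto simp: orthonormal_basis_def intro: span_diff)
  then have "g (w - (\<Sum>v\<in>B. g w v *\<^sub>R v)) (w - (\<Sum>v\<in>B. g w v *\<^sub>R v)) = 0"
    using B by (intro orthonormal_residual) (auto simp: orthonormal_basis_def)
  then show ?thesis using g unfolding inner_product_def by (metis less_irrefl right_minus_eq)
qed

lemma orthonormal_basis_card:
  assumes "orthonormal_basis g UNIV B"
  shows "card B = DIM('v)"
proof -
  have "independent B" using assms by (intro orthonormal_independent) (auto simp: orthonormal_basis_def)
  then show ?thesis
    using assms dim_span_eq_card_independent[of B] by (simp add: orthonormal_basis_def)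
qed

lemma subspace_perp: "subspace (perp g V)"
  by (auto simp: subspace_def perp_def bilinear_rzero[OF b] bilinear_radd[OF b] bilinear_rmul[OF b])

text \<open>Subtracting from \<open>w\<close> its projection to \<open>V\<close> leaves a vector of
  \<open>perp g V\<close>, so the union spans. Thus operators built from separately chosen bases add
  up to an operator of the whole space.\<close>

lemma orthonormal_basis_Un_perp:
  assumes B: "orthonormal_basis g V B" and C: "orthonormal_basis g (perp g V) C"
  shows "B \<inter> C = {}" "orthonormal_basis g UNIV (B \<union> C)"
proof -
  have BV: "B \<subseteq> V" and CV: "C \<subseteq> perp g V"
    using B C span_superset[of B] span_superset[of C] by (simp_all add: orthonormal_basis_def)
  have o: "g u v = 0" "g v u = 0" if "u \<in> B" "v \<in> C" for u v
    using that BV CV inner_product_commute[of v] by (auto simp: perp_def)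
  have 1: "g u u = 1" if "u \<in> B" for u using B that by (auto simp: orthonormal_basis_def)
  show d: "B \<inter> C = {}" using o(1) 1 by fastforce
  have "w \<in> span (B \<union> C)" for w
  proof -
    define p where "p = (\<Sum>v\<in>B. g w v *\<^sub>R v)"
    have "g v (w - p) = 0" if "v \<in> V" for v
      using orthonormal_residual[of B v w] B that inner_product_commute[of v]
      by (auto simp: orthonormal_basis_def p_def)
    then have "w - p \<in> span C" using C by (simp add: orthonormal_basis_def perp_def)
    moreover have "p \<in> span B" unfolding p_def by (intro span_sum span_scale span_base)
    ultimately have "p + (w - p) \<in> span (B \<union> C)"
      by (meson span_add span_mono subsetD sup_ge1 sup_ge2)
    then show ?thesis by simp
  qed
  then have "span (B \<union> C) = UNIV" by blast
  moreover have "g u v = (if u = v then 1 else 0)" if "u \<in> B \<union> C" "v \<in> B \<union> C" for u v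
    using that B C o d unfolding orthonormal_basis_def by auto
  ultimately show "orthonormal_basis g UNIV (B \<union> C)"
    using B C by (simp add: orthonormal_basis_def)
qed

end


subsection \<open>The Jacobi operators of the cone\<close>

lemma model_ip_kmodel: "model_ip (kmodel k c P) = chart_metric c (chart_map c P)"
  by (simp add: kmodel_def Let_def)

lemma model_tensor_kmodel:
  "j \<le> k \<Longrightarrow> model_tensors (kmodel k c P) ! j
     = (cov_deriv (chart_metric c) ^^ j) (riemann_tensor (chart_metric c)) (chart_map c P)"
  by (simp add: kmodel_def Let_def del: upt_Suc)

lemma length_model_tensors_kmodel: "length (model_tensors (kmodel k c P)) = Suc k"
  by (simp add: kmodel_def Let_def)

text \<open>The higher Jacobi operator of the cone on tangential components, without the factor
  \<open>scalar_curvature_in G x / 2 - 1\<close>.\<close>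

definition jacobi_sum :: "('e::real_vector \<Rightarrow> 'e \<Rightarrow> real) \<Rightarrow> (real \<times> 'e) set \<Rightarrow> 'e \<Rightarrow> 'e" where
  "jacobi_sum h B w = (\<Sum>v\<in>B. h (snd v) (snd v) *\<^sub>R w - h w (snd v) *\<^sub>R snd v)"

lemma jacobi_sum_linear:
  assumes "bilinear h"
  shows "linear (jacobi_sum h B)"
  unfolding jacobi_sum_def
  by (intro linear_compose_sum ballI linearI)
    (simp_all add: bilinear_ladd[OF assms] bilinear_lmul[OF assms] algebra_simps)

text \<open>Expanding the radial unit vector in \<open>B\<close> shows that the squared radial
  components sum to 1, so of the \<open>Suc DIM('e)\<close> unit lengths the tangential parts make
  up \<open>DIM('e)\<close>. Expanding \<open>(0, w)\<close> evaluates the other sum as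
  \<open>w\<close> divided by \<open>t\<^sup>2\<close>.\<close>

lemma (in metric_chart) jacobi_sum_UNIV:
  assumes t: "0 < t" and x: "x \<in> S" and B: "orthonormal_basis (cone_metric G (t, x)) UNIV B"
  shows "jacobi_sum (G x) B w = ((real DIM('e) - 1) / t\<^sup>2) *\<^sub>R w"
proof -
  interpret cone: metric_chart "{0<..} \<times> S" "cone_metric G" by (rule metric_chart_cone)
  have g: "inner_product (cone_metric G (t, x))" using t x by (intro cone.inner_product) simp
  note b = metric_bilinear[OF x]
  have fin: "finite B" using B by (simp add: orthonormal_basis_def)
  have g0: "cone_metric G (t, x) (a, w) v = a * fst v + t\<^sup>2 * G x w (snd v)" for a w v
    by (simp add: cone_metric_def split_beta)
  have "(\<Sum>v\<in>B. (fst v)\<^sup>2) = 1"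
  proof -
    have "fst (\<Sum>v\<in>B. cone_metric G (t, x) (1, 0) v *\<^sub>R v) = 1"
      using orthonormal_basis_expand[OF g B, of "(1, 0)"] by simp
    then show ?thesis by (simp add: g0 bilinear_lzero[OF b] fst_sum power2_eq_square)
  qed
  moreover have "(\<Sum>v\<in>B. (fst v)\<^sup>2 + t\<^sup>2 * G x (snd v) (snd v)) = (\<Sum>v\<in>B. cone_metric G (t, x) v v)"
    by (simp add: cone_metric_def split_beta power2_eq_square)
  moreover have "(\<Sum>v\<in>B. cone_metric G (t, x) v v) = (\<Sum>v\<in>B. 1)"
    using B by (intro sum.cong refl) (auto simp: orthonormal_basis_def)
  moreover have "card B = Suc DIM('e)" using orthonormal_basis_card[OF g B] by simp
  ultimately have "t\<^sup>2 * (\<Sum>v\<in>B. G x (snd v) (snd v)) = DIM('e)"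
    by (simp add: sum.distrib sum_distrib_left)
  then have 1: "(\<Sum>v\<in>B. G x (snd v) (snd v)) = DIM('e) / t\<^sup>2" using t by (simp add: field_simps)
  have "snd (\<Sum>v\<in>B. cone_metric G (t, x) (0, w) v *\<^sub>R v) = w"
    using orthonormal_basis_expand[OF g B, of "(0, w)"] by simp
  then have "w = t\<^sup>2 *\<^sub>R (\<Sum>v\<in>B. G x w (snd v) *\<^sub>R snd v)"
    by (simp add: g0 snd_sum scaleR_sum_right)
  then have "(1 / t\<^sup>2) *\<^sub>R w = (1 / t\<^sup>2) *\<^sub>R t\<^sup>2 *\<^sub>R (\<Sum>v\<in>B. G x w (snd v) *\<^sub>R snd v)"
    by (rule arg_cong)
  then have 2: "(\<Sum>v\<in>B. G x w (snd v) *\<^sub>R snd v) = (1 / t\<^sup>2) *\<^sub>R w"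
    using t by simp
  show ?thesis
    unfolding jacobi_sum_def sum_subtractf scaleR_sum_left[symmetric] 1 2
    by (simp add: diff_divide_distrib scaleR_left_diff_distrib)
qed

context surface_chart
begin

lemma riemann_op_cone_surface:
  assumes t: "0 < t" and x: "x \<in> S"
  shows "riemann_op (cone_metric G) (t, x) (a, u) (b, v) (c, w)
    = (0, (scalar_curvature_in G x / 2 - 1) *\<^sub>R (G x v w *\<^sub>R u - G x u w *\<^sub>R v))"
proof -
  note b = metric_bilinear[OF x]
  have "riemann_op G x u v w = (scalar_curvature_in G x / 2) *\<^sub>R (G x v w *\<^sub>R u - G x u w *\<^sub>R v)"
    by (rule inner_product_nondegenerate[OF inner_product[OF x]])
      (simp add: riemann_surface[OF x] gram_def bilinear_lmul[OF b] bilinear_lsub[OF b])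
  then show ?thesis
    by (simp add: riemann_cone[OF t x] scaleR_left_diff_distrib)
qed

lemma jacobi_cone:
  assumes t: "0 < t" and x: "x \<in> S" and c: "chart_metric c = cone_metric G" "chart_map c P = (t, x)"
  shows "jacobi (kmodel k c P) v w = (0, (scalar_curvature_in G x / 2 - 1) *\<^sub>R
    (G x (snd v) (snd v) *\<^sub>R snd w - G x (snd w) (snd v) *\<^sub>R snd v))"
proof -
  interpret cone: metric_chart "{0<..} \<times> S" "cone_metric G" by (rule metric_chart_cone)
  have "jacobi (kmodel k c P) v w = riemann_op (cone_metric G) (t, x) w v v"
    unfolding jacobi_def curvature_operator_def model_ip_kmodel
    using t x by (intro sharp_eqI) (simp_all add: model_tensor_kmodel c cone.inner_product)
  then show ?thesis
    using riemann_op_cone_surface[OF t x, of "fst w" "snd w" "fst v" "snd v" "fst v" "snd v"] by simp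
qed

text \<open>The basis selected inside \<open>higher_jacobi\<close> is exposed, so that it can be
  united with the one selected for the orthogonal complement.\<close>

lemma higher_jacobi_cone:
  assumes t: "0 < t" and x: "x \<in> S" and c: "chart_metric c = cone_metric G" "chart_map c P = (t, x)"
    and V: "subspace V"
  obtains B where "orthonormal_basis (cone_metric G (t, x)) V B"
    "\<And>w. higher_jacobi (kmodel k c P) V w = (0, (scalar_curvature_in G x / 2 - 1) *\<^sub>R jacobi_sum (G x) B (snd w))"
proof
  interpret cone: metric_chart "{0<..} \<times> S" "cone_metric G" by (rule metric_chart_cone)
  have g: "inner_product (cone_metric G (t, x))" using t x by (intro cone.inner_product) simp
  define B where "B = (SOME B. orthonormal_basis (cone_metric G (t, x)) V B)"
  show "orthonormal_basis (cone_metric G (t, x)) V B"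
    unfolding B_def by (rule someI_ex[OF orthonormal_basis_exists[OF g V]])
  show "higher_jacobi (kmodel k c P) V w = (0, (scalar_curvature_in G x / 2 - 1) *\<^sub>R jacobi_sum (G x) B (snd w))" for w
    unfolding higher_jacobi_def model_ip_kmodel c B_def[symmetric] jacobi_sum_def
    by (rule prod_eqI) (simp_all add: jacobi_cone[OF t x c] fst_sum snd_sum scaleR_sum_right)
qed

lemma ricci_operator_cone:
  assumes t: "0 < t" and x: "x \<in> S" and c: "chart_metric c = cone_metric G" "chart_map c P = (t, x)"
  shows "ricci_operator (kmodel k c P) w = (0, ((scalar_curvature_in G x / 2 - 1) / t\<^sup>2) *\<^sub>R snd w)"
proof -
  obtain B where B: "orthonormal_basis (cone_metric G (t, x)) UNIV B"
    "\<And>w. higher_jacobi (kmodel k c P) UNIV w = (0, (scalar_curvature_in G x / 2 - 1) *\<^sub>R jacobi_sum (G x) B (snd w))"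
    using higher_jacobi_cone[OF t x c subspace_UNIV] by blast
  show ?thesis
    by (simp add: ricci_operator_def B(2) jacobi_sum_UNIV[OF t x B(1)])
qed

text \<open>The operators of \<open>V\<close> and of its complement add up to the Ricci operator, which is a multiple
  of the projection onto the directions tangent to \<open>N\<close>.\<close>

lemma puffini_videv_model_cone:
  assumes t: "0 < t" and x: "x \<in> S" and c: "chart_metric c = cone_metric G" "chart_map c P = (t, x)"
  shows "puffini_videv_model (kmodel k c P)"
  unfolding puffini_videv_model_def model_ip_kmodel c
proof (intro allI impI ext)
  fix V :: "(real \<times> (real^2)) set" and w assume V: "subspace V"
  interpret cone: metric_chart "{0<..} \<times> S" "cone_metric G" by (rule metric_chart_cone)
  have g: "inner_product (cone_metric G (t, x))" using t x by (intro cone.inner_product) simp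
  define W where "W = perp (cone_metric G (t, x)) V"
  define r where "r = scalar_curvature_in G x / 2 - 1"
  obtain B where B: "orthonormal_basis (cone_metric G (t, x)) V B"
    "\<And>w. higher_jacobi (kmodel k c P) V w = (0, r *\<^sub>R jacobi_sum (G x) B (snd w))"
    using higher_jacobi_cone[OF t x c V] unfolding r_def by blast
  obtain C where C: "orthonormal_basis (cone_metric G (t, x)) W C"
    "\<And>w. higher_jacobi (kmodel k c P) W w = (0, r *\<^sub>R jacobi_sum (G x) C (snd w))"
    using higher_jacobi_cone[OF t x c subspace_perp[OF g, of V]] unfolding r_def W_def by blast
  note BC = orthonormal_basis_Un_perp[OF g B(1) C(1)[unfolded W_def]]
  have fin: "finite B" "finite C" using B(1) C(1) by (simp_all add: orthonormal_basis_def)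
  note l = jacobi_sum_linear[OF metric_bilinear[OF x]]
  have "jacobi_sum (G x) B u + jacobi_sum (G x) C u = (1 / t\<^sup>2) *\<^sub>R u" for u
    using jacobi_sum_UNIV[OF t x BC(2), of u]
    by (simp add: jacobi_sum_def sum.union_disjoint[OF fin BC(1), symmetric])
  \<comment> \<open>The operator of the complement is a polynomial in that of \<open>V\<close>,
    hence commutes with it.\<close>
  then have "jacobi_sum (G x) C u = (1 / t\<^sup>2) *\<^sub>R u - jacobi_sum (G x) B u" for u
    by (metis add_diff_cancel_left')
  then show "(higher_jacobi (kmodel k c P) V \<circ> higher_jacobi (kmodel k c P) W) w
     = (higher_jacobi (kmodel k c P) W \<circ> higher_jacobi (kmodel k c P) V) w"
    by (simp add: B(2) C(2) linear_cmul[OF l] linear_diff[OF l])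
qed

end


subsection \<open>Indecomposability\<close>

text \<open>If \<open>p\<close> and \<open>q\<close> in the two subspaces had nonzero tangential
  parts, the tangential parts of \<open>V2\<close> would lie on the line of \<open>snd p\<close>,
  those of \<open>V1\<close> on the line of \<open>snd q\<close>, and the two lines would coincide;
  together they could not fill the plane. Serves both for models and for Riemannian
  products.\<close>

lemma cone_splitting:
  fixes h :: "real^2 \<Rightarrow> real^2 \<Rightarrow> real" and V1 V2 :: "(real \<times> (real^2)) set"
  assumes h: "inner_product h"
    and sum: "\<And>v. \<exists>v1\<in>V1. \<exists>v2\<in>V2. v = v1 + v2"
    and 0: "\<And>v1 v2. v1 \<in> V1 \<Longrightarrow> v2 \<in> V2 \<Longrightarrow> gram h (snd v1) (snd v2) (snd v2) (snd v1) = 0"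
  shows "(\<forall>v\<in>V1. snd v = 0) \<or> (\<forall>v\<in>V2. snd v = 0)"
proof (rule ccontr)
  assume "\<not> ?thesis"
  then obtain p q where p: "p \<in> V1" "snd p \<noteq> 0" and q: "q \<in> V2" "snd q \<noteq> 0" by blast
  have comm: "gram h u v v u = gram h v u u v" for u v
    by (simp add: gram_def mult.commute)
  have 2: "\<exists>r. snd v = r *\<^sub>R snd p" if "v \<in> V2" for v
    using gram_zero_imp_parallel[OF h p(2) 0[OF p(1) that]] by blast
  have 1: "\<exists>r. snd v = r *\<^sub>R snd p" if v: "v \<in> V1" for v
  proof -
    have "gram h (snd q) (snd v) (snd v) (snd q) = 0" using 0[OF v q(1)] comm by metis
    then obtain r where "snd v = r *\<^sub>R snd q" using gram_zero_imp_parallel[OF h q(2)] by blast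
    then show ?thesis using 2[OF q(1)] by (metis scaleR_scaleR)
  qed
  have all: "\<exists>r. u = r *\<^sub>R snd p" for u
  proof -
    obtain v1 v2 where v: "v1 \<in> V1" "v2 \<in> V2" "(0, u) = v1 + v2" using sum[of "(0, u)"] by blast
    then have "u = snd v1 + snd v2" by (metis snd_add snd_conv)
    then show ?thesis using 1[OF v(1)] 2[OF v(2)] by (metis scaleR_add_left)
  qed
  obtain r s where "axis 1 1 = r *\<^sub>R snd p" "axis 2 1 = s *\<^sub>R snd p" using all by metis
  then have "gram h (axis 1 1) (axis 2 1) (axis 2 1) (axis 1 1) = 0"
    using inner_product_bilinear[OF h] by (simp add: gram_def bilinear_lmul bilinear_rmul)
  then show False using gram_axis_nonzero[OF h] by blast
qed

lemma splits_along_commute: "splits_along V1 V2 r A \<longleftrightarrow> splits_along V2 V1 r A"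
  by (auto simp: splits_along_def Un_commute)

context surface_chart
begin

text \<open>The radial field \<open>(1, 0)\<close> lies in the kernel of the curvature, but its covariant derivative
  in a direction \<open>u\<close> tangent to \<open>N\<close> is \<open>u / t\<close>.\<close>

lemma cov_deriv_cone:
  assumes t: "0 < t" and x: "x \<in> S"
  shows "cov_deriv (cone_metric G) (riemann_tensor (cone_metric G)) (t, x) [(0, u), (0, v), (0, w), (1, 0), (0, z)]
    = - t * (scalar_curvature_in G x / 2 - 1) * gram (G x) u v w z"
proof -
  have tx: "(t, x) \<in> {0<..} \<times> S" using assms by simp
  note b = metric_bilinear[OF x]
  have z: "cone_metric G y (riemann_op (cone_metric G) y U V W) (1, 0) = 0" if "y \<in> {0<..} \<times> S" for y U V W
    using riemann_cone_surface[of "fst y" "snd y" "fst U" "snd U" "fst V" "snd V" "fst W" "snd W" 1 0] that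
      bilinear_rzero[OF metric_bilinear, of "snd y"]
    by (auto simp: gram_def)
  \<comment> \<open>With the radial field in the fourth slot the curvature vanishes on the whole
    cone, so the coordinate derivative is 0, and of the four correction terms only the one that
    replaces the fourth slot remains.\<close>
  have d: "fderiv (\<lambda>y. riemann_tensor (cone_metric G) y [(0, u), (0, v), (0, w), (1, 0)]) (t, x) = (\<lambda>h. 0)"
    by (rule frechet_derivative_at[symmetric],
        rule has_derivative_transform_within_open[OF has_derivative_const[of 0] cone_open tx]) (simp add: z)
  have "christoffel (cone_metric G) (t, x) (0, z) (1, 0) = (0, (1 / t) *\<^sub>R z)"
    by (simp add: christoffel_cone[OF t x] bilinear_rzero[OF b] bilinear_rzero[OF christoffel_bilinear[OF x]])
  then show ?thesis
    unfolding cov_deriv_def Let_def using t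
    by (simp add: d[unfolded riemann_tensor_4] z[OF tx] lessThan_Suc numeral_eq_Suc riemann_cone_surface[OF t x] gram_def
        bilinear_rmul[OF b] power2_eq_square field_simps)
qed

text \<open>The curvature tensor forces one summand to be the radial line and the other to contain
  all tangential vectors; the component of its covariant derivative with one radial and four
  tangential arguments is then mixed but nonzero.\<close>

lemma indecomposable_cone:
  assumes t: "0 < t" and x: "x \<in> S" and c: "chart_metric c = cone_metric G" "chart_map c P = (t, x)"
    and neq: "scalar_curvature_in G x \<noteq> 2"
  shows "\<not> decomposable (kmodel 1 c P)"
proof
  assume "decomposable (kmodel 1 c P)"
  then obtain V1 V2 where sub: "subspace V1" "subspace V2" and ne: "V1 \<noteq> {0}" "V2 \<noteq> {0}" and int: "V1 \<inter> V2 = {0}"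
    and sum: "\<forall>v. \<exists>v1\<in>V1. \<exists>v2\<in>V2. v = v1 + v2"
    and ip: "\<forall>v1\<in>V1. \<forall>v2\<in>V2. model_ip (kmodel 1 c P) v1 v2 = 0"
    and tensors: "\<forall>j<length (model_tensors (kmodel 1 c P)).
      splits_along V1 V2 (4 + j) (model_tensors (kmodel 1 c P) ! j)"
    unfolding decomposable_def by blast
  have orth: "cone_metric G (t, x) v1 v2 = 0" if "v1 \<in> V1" "v2 \<in> V2" for v1 v2
    using ip that by (simp add: model_ip_kmodel c)
  have split: "splits_along V1 V2 (4 + j) ((cov_deriv (cone_metric G) ^^ j) (riemann_tensor (cone_metric G)) (t, x))"
    if "j \<le> 1" for j
    using tensors that by (simp add: length_model_tensors_kmodel model_tensor_kmodel c)
  note sum = sum[rule_format]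
  interpret cone: metric_chart "{0<..} \<times> S" "cone_metric G" by (rule metric_chart_cone)
  have tx: "(t, x) \<in> {0<..} \<times> S" using assms by simp
  note b = metric_bilinear[OF x]
  \<comment> \<open>Here \<open>V\<close> is the summand without tangential parts; stating this for
    general \<open>V\<close> and \<open>W\<close> covers both orders.\<close>
  have no: False
    if sub: "subspace V" "subspace W" and ne: "V \<noteq> {0}" and int: "V \<inter> W = {0}"
      and sum: "\<And>v. \<exists>v1\<in>V. \<exists>v2\<in>W. v = v1 + v2"
      and orth: "\<And>v1 v2. v1 \<in> V \<Longrightarrow> v2 \<in> W \<Longrightarrow> cone_metric G (t, x) v1 v2 = 0"
      and split: "splits_along V W 5 (cov_deriv (cone_metric G) (riemann_tensor (cone_metric G)) (t, x))"
      and 0: "\<forall>v\<in>V. snd v = 0" for V W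
  proof -
    obtain p where p: "p \<in> V" "p \<noteq> 0" using ne subspace_0[OF sub(1)] by blast
    then have a: "(fst p, 0) \<in> V" "fst p \<noteq> 0" using 0 by (cases p; auto simp: zero_prod_def)+
    have T: "(1, 0) \<in> V" using subspace_scale[OF sub(1) a(1), of "1 / fst p"] a(2) by simp
    \<comment> \<open>In the decomposition of \<open>(0, u)\<close>, the part in \<open>V\<close> is
      radial, and orthogonality to \<open>(1, 0)\<close> removes the radial component of the part in
      \<open>W\<close>.\<close>
    have W: "(0, u) \<in> W" for u
    proof -
      obtain v1 v2 where v: "v1 \<in> V" "v2 \<in> W" "(0, u) = v1 + v2" using sum by blast
      have "cone_metric G (t, x) (1, 0) v2 = fst v2"
        by (simp add: cone_metric_def split_beta bilinear_lzero[OF b])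
      then have "fst v2 = 0" using orth[OF T v(2)] by simp
      moreover have "snd v1 = 0" using 0 v(1) by blast
      ultimately have "v2 = (0, u)" using v(3) by (simp add: prod_eq_iff)
      then show ?thesis using v(2) by simp
    qed
    define e1 where "e1 = (axis 1 1 :: real^2)"
    define e2 where "e2 = (axis 2 1 :: real^2)"
    have "e1 \<noteq> 0" by (simp add: e1_def axis_eq_0_iff)
    then have n1: "(0, e1) \<notin> V" using 0 by (metis snd_conv)
    have n2: "(1, 0) \<notin> W"
    proof
      assume "(1, 0) \<in> W"
      then have "(1, 0) \<in> V \<inter> W" using T by blast
      then show False unfolding int by (simp add: zero_prod_def)
    qed
    \<comment> \<open>The radial vector keeps the list from lying in \<open>W\<close> and
      \<open>e1\<close> keeps it from lying in \<open>V\<close>.\<close>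
    define l where "l = [(0, e1), (0, e2), (0, e2), (1::real, 0), (0, e1)]"
    have "length l = 5" "set l \<subseteq> V \<union> W" "\<not> set l \<subseteq> V" "\<not> set l \<subseteq> W"
      using T W n1 n2 by (simp_all add: l_def)
    then have "cov_deriv (cone_metric G) (riemann_tensor (cone_metric G)) (t, x) l = 0"
      using split unfolding splits_along_def by blast
    moreover have "gram (G x) e1 e2 e2 e1 \<noteq> 0"
      unfolding e1_def e2_def by (rule gram_axis_nonzero[OF inner_product[OF x]])
    ultimately show False using t neq by (simp add: l_def cov_deriv_cone[OF t x])
  qed
  have "gram (G x) (snd v1) (snd v2) (snd v2) (snd v1) = 0" if v: "v1 \<in> V1" "v2 \<in> V2" for v1 v2
  \<comment> \<open>\<open>splits_along\<close> says nothing about lists inside one summand; that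
    happens here only if \<open>v1\<close> or \<open>v2\<close> is 0.\<close>
  proof (cases "v1 \<in> V2 \<or> v2 \<in> V1")
    case True
    then have "v1 = 0 \<or> v2 = 0" using v int by blast
    then show ?thesis by (auto simp: gram_def bilinear_lzero[OF b] bilinear_rzero[OF b])
  next
    case False
    then have "set [v1, v2, v2, v1] \<subseteq> V1 \<union> V2" "\<not> set [v1, v2, v2, v1] \<subseteq> V1" "\<not> set [v1, v2, v2, v1] \<subseteq> V2"
      using v by auto
    moreover have "length [v1, v2, v2, v1] = 4 + 0" by simp
    ultimately have "((cov_deriv (cone_metric G) ^^ 0) (riemann_tensor (cone_metric G)) (t, x)) [v1, v2, v2, v1] = 0"
      using split[of 0] unfolding splits_along_def by blast
    then show ?thesis
      using riemann_cone_surface[OF t x, of "fst v1" "snd v1" "fst v2" "snd v2" "fst v2" "snd v2" "fst v1" "snd v1"] t neq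
      by simp
  qed
  from cone_splitting[OF inner_product[OF x] sum this]
  show False
  proof
    assume "\<forall>v\<in>V1. snd v = 0"
    then show False using no[OF sub ne(1) int sum orth] split[of 1] by simp
  next
    have sum': "\<exists>v1\<in>V2. \<exists>v2\<in>V1. v = v1 + v2" for v using sum[of v] by (metis add.commute)
    have orth': "cone_metric G (t, x) v1 v2 = 0" if "v1 \<in> V2" "v2 \<in> V1" for v1 v2
      using orth[OF that(2,1)] cone.metric_commute[OF tx] by metis
    assume "\<forall>v\<in>V2. snd v = 0"
    then show False
      using no[OF sub(2,1) ne(2) _ sum' orth'] split[of 1] int splits_along_commute[of V1 V2]
      by (simp add: Int_commute)
  qed
qed

end

subsection \<open>Local irreducibility\<close>

text \<open>The radial field \<open>T = (1, 0)\<close> satisfies \<open>\<nabla>\<^sub>X T = X / t\<close> for \<open>X\<close> tangent to \<open>N\<close>. If the image of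
  \<open>T\<close> has no component in one factor near \<open>p\<close>, then neither has its covariant derivative.\<close>

lemma radial_component_zero:
  fixes pr :: "'f::euclidean_space \<Rightarrow> 'c::real_normed_vector"
  assumes f: "isometric_coords S (cone_metric G) S' G' f" and N: "metric_chart S0 G" and S: "S \<subseteq> {0<..} \<times> S0"
    and W: "open W" "W \<subseteq> S" "p \<in> W"
    and pr: "bounded_linear pr" and T: "\<And>y. y \<in> W \<Longrightarrow> pr (fderiv f y (1, 0)) = 0"
    and split: "\<And>u v. pr v = 0 \<Longrightarrow> pr (christoffel G' (f p) u v) = 0"
  shows "pr (fderiv f p v) = 0"
proof -
  interpret isometric_coords S "cone_metric G" S' G' f by (rule f)
  interpret N: metric_chart S0 G by (rule N)
  have p: "p \<in> S" using W by blast
  have "p \<in> {0<..} \<times> S0" using p S by blast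
  then obtain t x where tx: "p = (t, x)" "0 < t" "x \<in> S0" by (elim SigmaE) simp
  note L = f_linear[OF p]
  have "((\<lambda>y. pr (fderiv f y (1, 0))) has_derivative (\<lambda>u. pr (fderiv (\<lambda>y. fderiv f y (1, 0)) p u))) (at p)"
    by (rule bounded_linear.has_derivative[OF pr fderiv_has_derivative[OF p]])
  then have "((\<lambda>y. 0) has_derivative (\<lambda>u. pr (fderiv (\<lambda>y. fderiv f y (1, 0)) p u))) (at p)"
    by (rule has_derivative_transform_within_open[OF _ W(1,3)]) (simp add: T)
  from fderiv_eq[OF this] have d: "pr (fderiv (\<lambda>y. fderiv f y (1, 0)) p u) = 0" for u
    by simp
  have "pr (fderiv f p (0, u)) = 0" for u
  proof -
    have "christoffel (cone_metric G) p (0, u) (1, 0) = (1 / t) *\<^sub>R (0, u)"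
      unfolding tx(1) N.christoffel_cone[OF tx(2,3)]
      by (simp add: bilinear_rzero[OF N.metric_bilinear[OF tx(3)]] bilinear_rzero[OF N.christoffel_bilinear[OF tx(3)]])
    \<comment> \<open>The identity for the covariant derivative of the radial field, transported by
      \<open>f\<close>. On the left, \<open>pr\<close> kills the derivative term by \<open>d\<close>
      and the Christoffel term by \<open>split\<close>; so it kills the image of
      \<open>(0, u)\<close> too.\<close>
    from christoffel_natural[OF p, of "(1, 0)" "(0, u)", unfolded this]
    have "pr (fderiv (\<lambda>y. fderiv f y (1, 0)) p (0, u)
        + christoffel G' (f p) (fderiv f p (0, u)) (fderiv f p (1, 0))) = pr ((1 / t) *\<^sub>R fderiv f p (0, u))"
      by (simp only: linear_cmul[OF L])
    then show ?thesis
      using tx(2) d split[OF T[OF W(3)]]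
      by (simp add: linear_add[OF bounded_linear.linear[OF pr]] linear_cmul[OF bounded_linear.linear[OF pr]])
  qed
  moreover have "fderiv f p v = fst v *\<^sub>R fderiv f p (1, 0) + fderiv f p (0, snd v)"
  proof -
    have "v = fst v *\<^sub>R (1, 0) + (0, snd v)" by (simp add: prod_eq_iff)
    then have "fderiv f p v = fderiv f p (fst v *\<^sub>R (1, 0) + (0, snd v))" by simp
    then show ?thesis by (simp only: linear_add[OF L] linear_cmul[OF L])
  qed
  ultimately show ?thesis
    using T[OF W(3)] by (simp add: linear_add[OF bounded_linear.linear[OF pr]] linear_cmul[OF bounded_linear.linear[OF pr]])
qed

text \<open>Mixed curvature of a product vanishes, so by naturality the preimages of the two tangent
  spaces satisfy \<open>cone_splitting\<close> wherever the curvature condition holds, and the image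
  of \<open>T\<close> lies in one factor. By continuity that factor is the same near
  \<open>p\<close>, and \<open>radial_component_zero\<close> then leaves no room for the other
  factor.\<close>

lemma cone_not_product:
  fixes S1 :: "'a::euclidean_space set" and S2 :: "'b::euclidean_space set"
  assumes f: "isometric_coords S (cone_metric G) (S1 \<times> S2) (product_metric G1 G2) f"
    and N: "surface_chart S0 G" and P: "product_coords S1 G1 S2 G2"
    and S: "S \<subseteq> {0<..} \<times> S0" and p: "p \<in> S" and neq: "scalar_curvature_in G (snd p) \<noteq> 2"
  shows False
proof -
  interpret isometric_coords S "cone_metric G" "S1 \<times> S2" "product_metric G1 G2" f by (rule f)
  interpret N: surface_chart S0 G by (rule N)
  interpret P: product_coords S1 G1 S2 G2 by (rule P)
  define T where "T y = fderiv f y (1, 0)" for y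
  have alt: "fst (T y) = 0 \<or> snd (T y) = 0" if y: "y \<in> S" "scalar_curvature_in G (snd y) \<noteq> 2" for y
  proof -
    have "y \<in> {0<..} \<times> S0" using y S by blast
    then obtain t x where tx: "y = (t, x)" "0 < t" "x \<in> S0" by (elim SigmaE) simp
    obtain q1 q2 where q: "f y = (q1, q2)" "q1 \<in> S1" "q2 \<in> S2" using f_in[OF y(1)] by (elim SigmaE) simp
    note L = f_linear[OF y(1)]
    \<comment> \<open>Preimages of the tangent spaces of the two factors; surjectivity of the
      derivative makes them span.\<close>
    define V1 where "V1 = {v. snd (fderiv f y v) = 0}"
    define V2 where "V2 = {v. fst (fderiv f y v) = 0}"
    have V: "\<exists>v1\<in>V1. \<exists>v2\<in>V2. v = v1 + v2" for v
    proof -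
      obtain v1 where v1: "fderiv f y v1 = (fst (fderiv f y v), 0)" using surj[OF y(1)] by (metis surjD)
      then have "v1 \<in> V1" "v - v1 \<in> V2" by (simp_all add: V1_def V2_def linear_diff[OF L])
      then show ?thesis by (intro bexI[of _ v1] bexI[of _ "v - v1"]) auto
    qed
    have "gram (G x) (snd v1) (snd v2) (snd v2) (snd v1) = 0" if v: "v1 \<in> V1" "v2 \<in> V2" for v1 v2
    proof -
      obtain a b where ab: "fderiv f y v1 = (a, 0)" "fderiv f y v2 = (0, b)"
        using v by (simp add: V1_def V2_def) (metis prod.collapse)
      have "cone_metric G y (riemann_op (cone_metric G) y v1 v2 v2) v1
          = G1 q1 (riemann_op G1 q1 a 0 0) a + G2 q2 (riemann_op G2 q2 0 b b) 0"
        by (simp add: riemann_tensor_natural[OF y(1)] ab q(1) P.riemann_product[OF q(2,3)])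
      also have "\<dots> = 0"
        by (simp add: linear_0[OF P.A.riemann_linear(3)[OF q(2)]] bilinear_lzero[OF P.A.metric_bilinear[OF q(2)]]
            bilinear_rzero[OF P.B.metric_bilinear[OF q(3)]])
      finally show ?thesis
        using N.riemann_cone_surface[OF tx(2,3), of "fst v1" "snd v1" "fst v2" "snd v2" "fst v2" "snd v2" "fst v1" "snd v1"]
          tx y(2) by simp
    qed
    from cone_splitting[OF N.inner_product[OF tx(3)] V this]
    show ?thesis
    proof
      \<comment> \<open>A preimage of the nonzero vector \<open>(i, 0)\<close> is then a multiple of
        the radial vector, so the image of the latter has no component in the second factor.\<close>
      assume 0: "\<forall>v\<in>V1. snd v = 0"
      obtain i :: 'a where i: "i \<in> Basis" using nonempty_Basis by blast
      obtain v where v: "fderiv f y v = (i, 0)" using surj[OF y(1)] by (metis surjD)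
      then have "v \<in> V1" by (simp add: V1_def)
      then have "snd v = 0" using 0 by blast
      then have "v = fst v *\<^sub>R (1, 0)" by (simp add: prod_eq_iff)
      then have "fderiv f y v = fst v *\<^sub>R T y" unfolding T_def using linear_cmul[OF L] by metis
      then have "i = fst v *\<^sub>R fst (T y)" "0 = fst v *\<^sub>R snd (T y)" using v by (metis fst_conv snd_conv fst_scaleR snd_scaleR)+
      then show ?thesis using nonzero_Basis[OF i] by auto
    next
      assume 0: "\<forall>v\<in>V2. snd v = 0"
      obtain i :: 'b where i: "i \<in> Basis" using nonempty_Basis by blast
      obtain v where v: "fderiv f y v = (0, i)" using surj[OF y(1)] by (metis surjD)
      then have "v \<in> V2" by (simp add: V2_def)
      then have "snd v = 0" using 0 by blast
      then have "v = fst v *\<^sub>R (1, 0)" by (simp add: prod_eq_iff)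
      then have "fderiv f y v = fst v *\<^sub>R T y" unfolding T_def using linear_cmul[OF L] by metis
      then have "0 = fst v *\<^sub>R fst (T y)" "i = fst v *\<^sub>R snd (T y)" using v by (metis fst_conv snd_conv fst_scaleR snd_scaleR)+
      then show ?thesis using nonzero_Basis[OF i] by auto
    qed
  qed
  obtain q1 q2 where q: "f p = (q1, q2)" "q1 \<in> S1" "q2 \<in> S2" using f_in[OF p] by (elim SigmaE) simp
  have contT: "continuous_on S T"
    unfolding T_def by (rule smooth_on_continuous[OF smooth_on_fderiv[OF f_smooth]])
  have "continuous_on S (\<lambda>y. scalar_curvature_in G (snd y) - 2)"
    by (intro continuous_intros continuous_on_compose2[OF N.scalar_curvature_continuous]) (use S in auto)
  note contR = this
  \<comment> \<open>The isometry preserves the positive length of the radial vector, so at least one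
    component is nonzero.\<close>
  have T: "T p \<noteq> 0"
  proof
    assume "T p = 0"
    then have "cone_metric G p (1, 0) (1, 0) = 0"
      using isometric[OF p, of "(1, 0)" "(1, 0)"] bilinear_lzero[OF cod.metric_bilinear[OF f_in[OF p]]]
      by (simp add: T_def)
    moreover have "0 < cone_metric G p (1, 0) (1, 0)"
      using dom.inner_product[OF p] by (simp add: inner_product_def zero_prod_def)
    ultimately show False by simp
  qed
  have nbhd: "open W \<and> W \<subseteq> S" if "W = S \<inter> (\<lambda>y. (scalar_curvature_in G (snd y) - 2) * norm (g (T y))) -` (- {0})"
    "bounded_linear g" for W and g :: "'a \<times> 'b \<Rightarrow> 'c::real_normed_vector"
  proof -
    have "continuous_on S (\<lambda>y. (scalar_curvature_in G (snd y) - 2) * norm (g (T y)))"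
      by (intro continuous_on_mult contR continuous_on_norm bounded_linear.continuous_on[OF that(2) contT])
    then show ?thesis unfolding that(1) by (auto intro!: continuous_open_preimage dom.open_S)
  qed
  have L1: "bounded_linear (fst :: 'a \<times> 'b \<Rightarrow> 'a)" and L2: "bounded_linear (snd :: 'a \<times> 'b \<Rightarrow> 'b)"
    by (rule bounded_linear_fst bounded_linear_snd)+
  show False
  proof (cases "fst (T p) = 0")
    case False
    \<comment> \<open>The product is nonzero exactly where the scalar curvature of \<open>N\<close>
      differs from 2 and the first component of \<open>T\<close> does not vanish, so
      \<open>alt\<close> selects the same alternative throughout \<open>W\<close>.\<close>
    define W where "W = S \<inter> (\<lambda>y. (scalar_curvature_in G (snd y) - 2) * norm (fst (T y))) -` (- {0})"
    have W: "open W" "W \<subseteq> S" "p \<in> W" using nbhd[OF W_def L1] p neq False by (auto simp: W_def)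
    have 0: "snd (fderiv f y (1, 0)) = 0" if "y \<in> W" for y
      using alt[of y] that by (auto simp: W_def T_def)
    have sp: "snd (christoffel (product_metric G1 G2) (f p) u v) = 0" if "snd v = 0" for u v
    proof -
      have "snd (christoffel (product_metric G1 G2) (f p) u v) = christoffel G2 q2 (snd u) (snd v)"
        using P.christoffel_product[OF q(2,3), of "fst u" "snd u" "fst v" "snd v"] by (simp add: q(1))
      then show ?thesis by (simp add: that bilinear_rzero[OF P.B.christoffel_bilinear[OF q(3)]])
    qed
    have "snd (fderiv f p v) = 0" for v
      by (rule radial_component_zero[OF f N.metric_chart_axioms S W L2 0 sp])
    then have "snd w = 0" for w :: "'a \<times> 'b" using surj[OF p] by (metis surjD)
    then have "w = 0" for w :: 'b by (metis snd_conv)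
    then show False using nonempty_Basis nonzero_Basis by blast
  next
    case True
    then have "snd (T p) \<noteq> 0" using T by (simp add: prod_eq_iff)
    define W where "W = S \<inter> (\<lambda>y. (scalar_curvature_in G (snd y) - 2) * norm (snd (T y))) -` (- {0})"
    have W: "open W" "W \<subseteq> S" "p \<in> W" using nbhd[OF W_def L2] p neq \<open>snd (T p) \<noteq> 0\<close> by (auto simp: W_def)
    have 0: "fst (fderiv f y (1, 0)) = 0" if "y \<in> W" for y
      using alt[of y] that by (auto simp: W_def T_def)
    have sp: "fst (christoffel (product_metric G1 G2) (f p) u v) = 0" if "fst v = 0" for u v
    proof -
      have "fst (christoffel (product_metric G1 G2) (f p) u v) = christoffel G1 q1 (fst u) (fst v)"
        using P.christoffel_product[OF q(2,3), of "fst u" "snd u" "fst v" "snd v"] by (simp add: q(1))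
      then show ?thesis by (simp add: that bilinear_rzero[OF P.A.christoffel_bilinear[OF q(2)]])
    qed
    have "fst (fderiv f p v) = 0" for v
      by (rule radial_component_zero[OF f N.metric_chart_axioms S W L1 0 sp])
    then have "fst w = 0" for w :: "'a \<times> 'b" using surj[OF p] by (metis surjD)
    then have "w = 0" for w :: 'a by (metis fst_conv)
    then show False using nonempty_Basis nonzero_Basis by blast
  qed
qed

lemma riemannian_chart_surface:
  fixes c :: "('n, real^2) rchart"
  shows "riemannian_chart X c \<Longrightarrow> surface_chart (chart_map c ` chart_dom c) (chart_metric c)"
  by (simp add: surface_chart_def riemannian_chart_metric_chart)

lemma charts_at_nonempty:
  assumes "riemannian_manifold n M" "P \<in> topspace (man_top M)"
  obtains c where "c \<in> charts_at M P"
proof -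
  have "P \<in> (\<Union>c\<in>man_atlas M. chart_dom c)" using assms by (simp add: riemannian_manifold_def)
  then show thesis using that by (auto simp: charts_at_def)
qed

text \<open>The contradiction is local: one cone chart restricted to \<open>U\<close> and one
  product chart around the image point suffice to reach \<open>cone_not_product\<close>.\<close>

lemma locally_irreducible_cone:
  fixes N :: "('n, real^2) rmanifold"
  assumes N: "riemannian_manifold 2 N" and P0: "P0 \<in> topspace (man_top N)" and neq: "scalar_curvature N P0 \<noteq> 2"
    and t: "0 < t"
  shows "locally_irreducible TYPE(('a, 'e1::euclidean_space) rmanifold)
    TYPE(('b, 'e2::euclidean_space) rmanifold) (cone_manifold N) (t, P0)"
  unfolding locally_irreducible_def
proof clarify
  fix U and M1 :: "('a, 'e1) rmanifold" and M2 :: "('b, 'e2) rmanifold" and F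
  assume U: "openin (man_top (cone_manifold N)) U" and P: "(t, P0) \<in> U"
    and M1: "riemannian_manifold DIM('e1) M1" and M2: "riemannian_manifold DIM('e2) M2"
    and F: "isometry (open_submanifold (cone_manifold N) U) (product_manifold M1 M2) F"
  define X where "X = subtopology (man_top (cone_manifold N)) U"
  define Y where "Y = prod_topology (man_top M1) (man_top M2)"
  define H where "H = inv_into (topspace X) F"
  have XU: "topspace X = U" using openin_subset[OF U] by (auto simp: X_def)
  have hom: "homeomorphic_map X Y F"
    using F by (simp add: isometry_def open_submanifold_def product_manifold_def X_def Y_def)
  then have contF: "continuous_map X Y F" and inj: "inj_on F (topspace X)" and onto: "F ` topspace X = topspace Y"
    and openF: "open_map X Y F"
    by (auto simp: homeomorphic_eq_everything_map)
  have HF: "H (F q) = q" if "q \<in> U" for q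
    unfolding H_def using inj that XU by (simp add: inv_into_f_f)
  have FH: "F (H q) = q" "H q \<in> U" if "q \<in> topspace Y" for q
    unfolding H_def using f_inv_into_f[of q F "topspace X"] inv_into_into[of q F "topspace X"] that onto XU by simp_all
  obtain c where c: "c \<in> man_atlas N" "P0 \<in> chart_dom c"
    using charts_at_nonempty[OF N P0] by (auto simp: charts_at_def)
  have "F (t, P0) \<in> topspace Y" using onto XU P by blast
  then have "fst (F (t, P0)) \<in> topspace (man_top M1)" "snd (F (t, P0)) \<in> topspace (man_top M2)"
    by (auto simp: Y_def)
  then obtain d1 d2 where d: "d1 \<in> man_atlas M1" "fst (F (t, P0)) \<in> chart_dom d1"
    "d2 \<in> man_atlas M2" "snd (F (t, P0)) \<in> chart_dom d2"
    using M1 M2 unfolding riemannian_manifold_def by blast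
  note rc = riemannian_manifold_chart[OF N c(1)]
  note rd = riemannian_manifold_chart[OF M1 d(1)] riemannian_manifold_chart[OF M2 d(3)]
  define C where "C = (cone_chart c)\<lparr>chart_dom := chart_dom (cone_chart c) \<inter> U\<rparr>"
  define D where "D = product_chart d1 d2"
  have rC: "riemannian_chart X C"
    unfolding X_def C_def using riemannian_chart_cone[OF rc] U by (intro riemannian_chart_restrict) simp_all
  have rD: "riemannian_chart Y D" unfolding D_def Y_def by (rule riemannian_chart_product[OF rd])
  have oC: "openin X (chart_dom C)" and oD: "openin Y (chart_dom D)"
    using rC rD by (simp_all add: riemannian_chart_def)
  have CU: "chart_dom C \<subseteq> U" by (simp add: C_def)
  have top: "man_top (open_submanifold (cone_manifold N) U) = X"
    by (simp add: open_submanifold_def X_def)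
  have atl: "C \<in> man_atlas (open_submanifold (cone_manifold N) U)" "D \<in> man_atlas (product_manifold M1 M2)"
    using c(1) d(1,3) by (auto simp: C_def D_def open_submanifold_def product_manifold_def)
  have iso: "smooth_isometric_in C D F" "smooth_isometric_in D C H"
    using F[unfolded isometry_def top] atl unfolding H_def by blast+
  have "{p \<in> chart_dom C. F p \<in> chart_dom D} = chart_dom C \<inter> {p \<in> topspace X. F p \<in> chart_dom D}"
    using CU XU by blast
  then have o1: "openin X {p \<in> chart_dom C. F p \<in> chart_dom D}"
    using openin_Int[OF oC openin_continuous_map_preimage[OF contF oD]] by simp
  \<comment> \<open>Written as an image under \<open>F\<close>, this set is open because
    \<open>F\<close> is an open map.\<close>
  have "{q \<in> chart_dom D. H q \<in> chart_dom C} = chart_dom D \<inter> F ` chart_dom C"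
    using FH HF CU openin_subset[OF oD] by (auto simp: image_iff) (metis subsetD)+
  then have o2: "openin Y {q \<in> chart_dom D. H q \<in> chart_dom C}"
    using openin_Int[OF oD] openF oC by (simp add: open_map_def)
  have "isometric_coords (chart_map C ` {p \<in> chart_dom C. F p \<in> chart_dom D}) (chart_metric C)
      (chart_map D ` chart_dom D) (chart_metric D) (coord_expr C D F)"
    using CU HF FH openin_subset[OF oD] by (intro isometric_coords_charts[OF rC rD iso o1 o2]) auto
  moreover have "chart_metric C = cone_metric (chart_metric c)" by (simp add: C_def chart_metric_cone)
  moreover have "chart_metric D = product_metric (chart_metric d1) (chart_metric d2)"
    by (simp add: D_def chart_metric_product)
  moreover have "chart_map D ` chart_dom D = (chart_map d1 ` chart_dom d1) \<times> (chart_map d2 ` chart_dom d2)"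
    by (simp add: D_def product_chart_def map_prod_surj_on[OF refl refl])
  ultimately have f: "isometric_coords (chart_map C ` {p \<in> chart_dom C. F p \<in> chart_dom D}) (cone_metric (chart_metric c))
      ((chart_map d1 ` chart_dom d1) \<times> (chart_map d2 ` chart_dom d2))
      (product_metric (chart_metric d1) (chart_metric d2)) (coord_expr C D F)"
    by simp
  show False
  proof (rule cone_not_product[OF f riemannian_chart_surface[OF rc]])
    show "product_coords (chart_map d1 ` chart_dom d1) (chart_metric d1) (chart_map d2 ` chart_dom d2) (chart_metric d2)"
      by (simp add: product_coords_def riemannian_chart_metric_chart[OF rd(1)] riemannian_chart_metric_chart[OF rd(2)])
    show "chart_map C ` {p \<in> chart_dom C. F p \<in> chart_dom D} \<subseteq> {0<..} \<times> chart_map c ` chart_dom c"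
      by (auto simp: C_def chart_map_cone chart_dom_cone)
    have "F (t, P0) \<in> chart_dom D" using d(2,4) by (simp add: D_def product_chart_def mem_Times_iff)
    then show "chart_map (cone_chart c) (t, P0) \<in> chart_map C ` {p \<in> chart_dom C. F p \<in> chart_dom D}"
      using t c(2) P by (auto simp: C_def chart_dom_cone)
    show "scalar_curvature_in (chart_metric c) (snd (chart_map (cone_chart c) (t, P0))) \<noteq> 2"
      using scalar_curvature_chart[OF N, of c P0] c neq by (simp add: charts_at_def chart_map_cone)
  qed
qed


subsection \<open>Radial geodesics\<close>

lemma scalar_curvature_cone_manifold:
  fixes N :: "('n, real^2) rmanifold"
  assumes N: "riemannian_manifold 2 N" and P: "P \<in> topspace (man_top N)" and t: "0 < t"
  shows "scalar_curvature (cone_manifold N) (t, P) = (scalar_curvature N P - 2) / t\<^sup>2"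
proof -
  define c where "c = (SOME c. c \<in> charts_at (cone_manifold N) (t, P))"
  obtain d where "d \<in> charts_at N P" by (rule charts_at_nonempty[OF N P])
  then have "\<exists>c. c \<in> charts_at (cone_manifold N) (t, P)" unfolding charts_at_cone[OF t] by blast
  then have "c \<in> charts_at (cone_manifold N) (t, P)" unfolding c_def by (rule someI_ex)
  then obtain d where d: "c = cone_chart d" "d \<in> charts_at N P" unfolding charts_at_cone[OF t] by blast
  have rd: "riemannian_chart (man_top N) d" using riemannian_manifold_chart[OF N] d(2) by (simp add: charts_at_def)
  interpret surface_chart "chart_map d ` chart_dom d" "chart_metric d" by (rule riemannian_chart_surface[OF rd])
  have "chart_map d P \<in> chart_map d ` chart_dom d" using d(2) by (simp add: charts_at_def)
  from scalar_curvature_cone[OF t this] show ?thesis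
    using scalar_curvature_chart[OF N d(2)]
    by (simp add: scalar_curvature_def c_def[symmetric] Let_def d(1) chart_metric_cone chart_map_cone)
qed

text \<open>The Christoffel vector of the radial direction with itself vanishes, so the line with
  constant velocity \<open>(1, 0)\<close> solves the geodesic equation in every chart.\<close>

lemma geodesic_radial:
  fixes N :: "('n, 'e::euclidean_space) rmanifold"
  assumes N: "riemannian_manifold n N" and P: "P \<in> topspace (man_top N)"
  shows "geodesic_on (cone_manifold N) (\<lambda>s. (s, P)) {0<..<T}"
  unfolding geodesic_on_def
proof (intro conjI ballI)
  have "continuous_map (top_of_set {0<..<T}) (top_of_set {0<..}) (\<lambda>s. s)"
    by (auto intro: continuous_map_into_subtopology)
  then show "continuous_map (top_of_set {0<..<T}) (man_top (cone_manifold N)) (\<lambda>s. (s, P))"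
    using P by (auto simp: continuous_map_paired)
next
  fix s c assume s: "s \<in> {0<..<T}" and c: "c \<in> charts_at (cone_manifold N) (s, P)"
  have "0 < s" using s by simp
  from charts_at_cone[OF this, of N P] c
  obtain d where d: "c = cone_chart d" "d \<in> charts_at N P" by auto
  have rd: "riemannian_chart (man_top N) d" using riemannian_manifold_chart[OF N] d(2) by (simp add: charts_at_def)
  interpret metric_chart "chart_map d ` chart_dom d" "chart_metric d" by (rule riemannian_chart_metric_chart[OF rd])
  have x: "chart_map d P \<in> chart_map d ` chart_dom d" using d(2) by (simp add: charts_at_def)
  have "christoffel (chart_metric c) (chart_map c (s, P)) (1, 0) (1, 0) = (0, 0)"
    using s by (simp add: d(1) chart_metric_cone chart_map_cone christoffel_cone[OF _ x] bilinear_lzero[OF metric_bilinear[OF x]]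
        bilinear_lzero[OF christoffel_bilinear[OF x]])
  moreover have "((chart_map c \<circ> (\<lambda>s. (s, P))) has_vector_derivative (1, 0)) (at r)" for r
    using has_derivative_Pair[OF has_derivative_ident has_derivative_const]
    by (simp add: has_vector_derivative_def d(1) chart_map_cone o_def)
  ultimately show "\<exists>d. (\<forall>\<^sub>F r in nhds s. ((chart_map c \<circ> (\<lambda>s. (s, P))) has_vector_derivative d r) (at r)) \<and>
      (d has_vector_derivative - christoffel (chart_metric c) (chart_map c (s, P)) (d s) (d s)) (at s)"
    by (intro exI[of _ "\<lambda>r. (1, 0)"]) (simp add: zero_prod_def[symmetric])
qed

lemma scalar_curvature_blowup_cone:
  fixes N :: "('n, real^2) rmanifold"
  assumes N: "riemannian_manifold 2 N" and P: "P \<in> topspace (man_top N)" and neq: "scalar_curvature N P \<noteq> 2"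
  shows "scalar_curvature_blowup (cone_manifold N)"
  unfolding scalar_curvature_blowup_def
proof (intro exI conjI)
  show "(0::real) < 1" by simp
  show "geodesic_on (cone_manifold N) (\<lambda>s. (s, P)) {0<..<1}" by (rule geodesic_radial[OF N P])
  have "filterlim (\<lambda>t::real. inverse t ^ 2) at_top (at_right 0)"
    by (rule filterlim_pow_at_top[OF _ filterlim_inverse_at_top_right]) simp
  then have "filterlim (\<lambda>t::real. \<bar>scalar_curvature N P - 2\<bar> * inverse t ^ 2) at_top (at_right 0)"
    using neq by (intro filterlim_tendsto_pos_mult_at_top[OF tendsto_const]) auto
  moreover have "\<forall>\<^sub>F t in at_right 0. \<bar>scalar_curvature N P - 2\<bar> * inverse t ^ 2
      = \<bar>scalar_curvature (cone_manifold N) (t, P)\<bar>"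
    using eventually_at_right_less[of "0::real"]
    by eventually_elim (simp add: scalar_curvature_cone_manifold[OF N P] abs_mult power_inverse divide_inverse)
  ultimately show "filterlim (\<lambda>t. \<bar>scalar_curvature (cone_manifold N) (t, P)\<bar>) at_top (at_right 0)"
    by (rule filterlim_mono_eventually[OF _ order_refl order_refl])
qed

section \<open>Reduction of the assertions to coordinates\<close>

text \<open>Every chart of the cone comes from a chart of \<open>N\<close>, so statements about all
  charts around a point reduce to the locale \<open>surface_chart\<close>.\<close>

lemma cone_chart_coords:
  fixes N :: "('n, real^2) rmanifold"
  assumes N: "riemannian_manifold 2 N" and t: "0 < t" and c: "c \<in> charts_at (cone_manifold N) (t, P)"
  obtains S G x where "surface_chart S G" "x \<in> S" "chart_metric c = cone_metric G" "chart_map c (t, P) = (t, x)"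
    "scalar_curvature_in G x = scalar_curvature N P"
proof -
  obtain d where d: "c = cone_chart d" "d \<in> charts_at N P" using c unfolding charts_at_cone[OF t] by blast
  have "riemannian_chart (man_top N) d" using riemannian_manifold_chart[OF N] d(2) by (simp add: charts_at_def)
  from that[OF riemannian_chart_surface[OF this], of "chart_map d P"] d(2) scalar_curvature_chart[OF N d(2)]
  show thesis by (simp add: charts_at_def d(1) chart_metric_cone chart_map_cone)
qed

theorem theorem1p4:
  fixes N :: "('n, real ^ 2) rmanifold" and P0 :: 'n
  assumes "riemannian_manifold 2 N"
    and "P0 \<in> topspace (man_top N)"
    and "scalar_curvature N P0 \<noteq> 2"
  shows "(riemannian_manifold 3 (cone_manifold N) \<and> puffini_videv (cone_manifold N)) \<and>
         (\<forall>t>0. indecomposable_at (cone_manifold N) 1 (t, P0) \<and>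
                locally_irreducible TYPE(('a, 'e1::euclidean_space) rmanifold)
                  TYPE(('b, 'e2::euclidean_space) rmanifold) (cone_manifold N) (t, P0)) \<and>
         (scalar_curvature_blowup (cone_manifold N) \<and> \<not> einstein (cone_manifold N))"
proof (intro conjI allI impI)
  note N = assms(1) and P0 = assms(2) and neq = assms(3)
  show "riemannian_manifold 3 (cone_manifold N)"
    using riemannian_manifold_cone[OF N] by (simp add: numeral_3_eq_3)
  show "puffini_videv (cone_manifold N)"
    unfolding puffini_videv_def
  proof (intro ballI)
    fix Q c assume Q: "Q \<in> topspace (man_top (cone_manifold N))" and c: "c \<in> charts_at (cone_manifold N) Q"
    have "Q \<in> {0<..} \<times> topspace (man_top N)" using Q by simp
    then obtain t P where tP: "Q = (t, P)" "0 < t" by (elim SigmaE) simp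
    obtain S G x where G: "surface_chart S G" "x \<in> S" "chart_metric c = cone_metric G" "chart_map c (t, P) = (t, x)"
      by (rule cone_chart_coords[OF N tP(2) c[unfolded tP(1)]])
    show "puffini_videv_model (kmodel 0 c Q)"
      unfolding tP(1) by (rule surface_chart.puffini_videv_model_cone[OF G(1) tP(2) G(2-4)])
  qed
  fix t :: real assume t: "0 < t"
  show "indecomposable_at (cone_manifold N) 1 (t, P0)"
    unfolding indecomposable_at_def
  proof
    fix c assume c: "c \<in> charts_at (cone_manifold N) (t, P0)"
    obtain S G x where G: "surface_chart S G" "x \<in> S" "chart_metric c = cone_metric G" "chart_map c (t, P0) = (t, x)"
      and R: "scalar_curvature_in G x = scalar_curvature N P0"
      by (rule cone_chart_coords[OF N t c])
    show "\<not> decomposable (kmodel 1 c (t, P0))"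
      by (rule surface_chart.indecomposable_cone[OF G(1) t G(2-4)]) (simp add: R neq)
  qed
  show "locally_irreducible TYPE(('a, 'e1) rmanifold) TYPE(('b, 'e2) rmanifold) (cone_manifold N) (t, P0)"
    by (rule locally_irreducible_cone[OF N P0 neq t])
next
  note N = assms(1) and P0 = assms(2) and neq = assms(3)
  show "scalar_curvature_blowup (cone_manifold N)"
    by (rule scalar_curvature_blowup_cone[OF N P0 neq])
  show "\<not> einstein (cone_manifold N)"
  proof
    assume E: "einstein (cone_manifold N)"
    obtain d where "d \<in> charts_at N P0" by (rule charts_at_nonempty[OF N P0])
    \<comment> \<open>The point with \<open>t = 1\<close> over \<open>P0\<close>, where the factor
      \<open>1 / t\<^sup>2\<close> in the Ricci operator disappears.\<close>
    then obtain c where c: "c \<in> charts_at (cone_manifold N) (1, P0)" unfolding charts_at_cone[OF zero_less_one] by blast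
    have "(1, P0) \<in> topspace (man_top (cone_manifold N))" using P0 by simp
    then obtain r where r: "\<And>v. ricci_operator (kmodel 0 c (1, P0)) v = r *\<^sub>R v"
      using E c unfolding einstein_def by blast
    obtain S G x where G: "surface_chart S G" "x \<in> S" "chart_metric c = cone_metric G" "chart_map c (1, P0) = (1, x)"
      "scalar_curvature_in G x = scalar_curvature N P0"
      by (rule cone_chart_coords[OF N zero_less_one c])
    have ric: "ricci_operator (kmodel 0 c (1, P0)) v = (0, (scalar_curvature N P0 / 2 - 1) *\<^sub>R snd v)" for v
      using surface_chart.ricci_operator_cone[OF G(1) zero_less_one G(2-4)] by (simp add: G(5))
    \<comment> \<open>The radial vector lies in the kernel of the Ricci operator, while tangential
      vectors are scaled by a nonzero number.\<close>
    have "r = 0" using r[of "(1, 0)"] ric[of "(1, 0)"] by simp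
    then show False
      using r[of "(0, axis 1 1)"] ric[of "(0, axis 1 1)"] neq by (simp add: axis_eq_0_iff zero_prod_def)
  qed
qed

end
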